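(* Let $Q_0\subset\mathbb R^d$ be a cube, $1\le r\le\infty$, $k\in\mathbb N$ with $k<d$, and $b<-1/r$. Then $$\|f^{\#}_{Q_0}\|_{L_{\infty,r}(\log L)_b(Q_0)}\lesssim\|f\|_{W^kL_{d/k,r}(\log L)_{b+1/r}(Q_0)}$$ for all $f\in W^kL_{d/k,r}(\log L)_{b+1/r}(Q_0)$, with a constant independent of $f$.
   Context: Cubes have sides parallel to the axes; Lebesgue measure $|\cdot|_d$ is used. $f^*(t)=\inf\{\lambda\ge0:|\{|f|>\lambda\}|_d\le t\}$. $f^{\#}_{Q_0}(x)=\sup_{x\in Q\subset Q_0}\frac1{|Q|_d}\int_Q|f-f_Q|$, $f_Q=\frac1{|Q|_d}\int_Qf$. The Lorentz--Zygmund quasi-norm for $0<p\le\infty$ is $\|g\|_{L_{p,r}(\log L)_b(Q_0)}=\big(\int_0^1(t^{1/p}(1+|\log t|)^bg^*(t))^r\frac{dt}t\big)^{1/r}$ (supremum if $r=\infty$; $t^{1/p}=1$ if $p=\infty$). $W^kL_{p,r}(\log L)_b(Q_0)$ consists of $k$-times weakly differentiable $f$ on $Q_0$ with $\|f\|_{W^kL_{p,r}(\log L)_b(Q_0)}=\sum_{m=0}^k\|\,|\nabla^mf|\,\|_{L_{p,r}(\log L)_b(Q_0)}<\infty$, $|\nabla^mf|=\big(\sum_{|\alpha|_1=m}|D^\alpha f|^2\big)^{1/2}$. $A\lesssim B$ means $A\le CB$ with a constant $C>0$. *)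

theory Defs
  imports "HOL-Analysis.Analysis"
begin

section \<open>Cubes and the local sharp maximal function\<close>

text \<open>Cubes are closed and nondegenerate, with sides parallel to the axes.\<close>

definition is_cube :: "(real ^ 'n) set \<Rightarrow> bool" where
  "is_cube Q \<longleftrightarrow> (\<exists>a l. 0 < l \<and> Q = cbox a (\<chi> i. a $ i + l))"

definition cube_mean :: "(real ^ 'n) set \<Rightarrow> (real ^ 'n \<Rightarrow> real) \<Rightarrow> real" where
  "cube_mean Q f = (LINT x:Q|lebesgue. f x) / measure lebesgue Q"

definition mean_osc :: "(real ^ 'n) set \<Rightarrow> (real ^ 'n \<Rightarrow> real) \<Rightarrow> ennreal" where
  "mean_osc Q f = (\<integral>\<^sup>+x\<in>Q. ennreal \<bar>f x - cube_mean Q f\<bar> \<partial>lebesgue) / emeasure lebesgue Q"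

definition sharp_max :: "(real ^ 'n) set \<Rightarrow> (real ^ 'n \<Rightarrow> real) \<Rightarrow> real ^ 'n \<Rightarrow> ennreal" where
  "sharp_max Q0 f x = (SUP Q \<in> {Q. is_cube Q \<and> x \<in> Q \<and> Q \<subseteq> Q0}. mean_osc Q f)"


section \<open>Rearrangements and Lorentz--Zygmund quasi-norms\<close>

text \<open>Functions enter the rearrangement and the quasi-norms through their modulus, which is
  allowed to take the value \<open>\<infinity>\<close> (as the sharp maximal function may); as usual
  \<open>Inf {} = \<infinity>\<close>.  The superlevel sets of the sharp maximal function are unions of closed
  cubes, which need not be Borel but are Lebesgue measurable, hence the measure
  \<^term>\<open>lebesgue\<close>.\<close>

definition rearr :: "(real ^ 'n) set \<Rightarrow> (real ^ 'n \<Rightarrow> ennreal) \<Rightarrow> real \<Rightarrow> ennreal" where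
  "rearr Q g t =
     (INF u \<in> {u::real. 0 \<le> u \<and> emeasure lebesgue {x \<in> Q. g x > ennreal u} \<le> ennreal t}. ennreal u)"

text \<open>The real number \<open>1/p\<close> for \<open>p \<in> (0, \<infinity>]\<close>, with \<open>1/\<infinity> = 0\<close>.\<close>

definition recip :: "ennreal \<Rightarrow> real" where
  "recip p = enn2real (inverse p)"

text \<open>Real powers of extended nonnegative numbers; only used for exponents \<open>a > 0\<close>.\<close>

definition enn_powr :: "ennreal \<Rightarrow> real \<Rightarrow> ennreal" where
  "enn_powr x a = (if x = \<infinity> then \<infinity> else ennreal (enn2real x powr a))"

definition lz_weighted ::
    "ennreal \<Rightarrow> real \<Rightarrow> (real ^ 'n) set \<Rightarrow> (real ^ 'n \<Rightarrow> ennreal) \<Rightarrow> real \<Rightarrow> ennreal" where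
  "lz_weighted p b Q g t =
     ennreal (t powr recip p * (1 + \<bar>ln t\<bar>) powr b) * rearr Q g t"

definition lz_norm ::
    "ennreal \<Rightarrow> ennreal \<Rightarrow> real \<Rightarrow> (real ^ 'n) set \<Rightarrow> (real ^ 'n \<Rightarrow> ennreal) \<Rightarrow> ennreal" where
  "lz_norm p r b Q g =
     (if r = \<infinity> then (SUP t \<in> {0<..<1}. lz_weighted p b Q g t)
      else enn_powr
        (\<integral>\<^sup>+t\<in>{0<..<1}. enn_powr (lz_weighted p b Q g t) (enn2real r) * ennreal (1 / t) \<partial>lborel)
        (recip r))"


section \<open>Weak derivatives\<close>

definition partial :: "'n \<Rightarrow> (real ^ 'n \<Rightarrow> real) \<Rightarrow> real ^ 'n \<Rightarrow> real" where
  "partial i \<phi> x = frechet_derivative \<phi> (at x) (axis i 1)"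

definition iter_partial :: "'n list \<Rightarrow> (real ^ 'n \<Rightarrow> real) \<Rightarrow> real ^ 'n \<Rightarrow> real" where
  "iter_partial is \<phi> = foldr partial is \<phi>"

text \<open>All iterated partial derivatives exist and are (totally) differentiable, hence
  continuous; this is \<open>C\<^sup>\<infinity>\<close>.\<close>

definition smooth :: "(real ^ 'n \<Rightarrow> real) \<Rightarrow> bool" where
  "smooth \<phi> \<longleftrightarrow> (\<forall>is x. iter_partial is \<phi> differentiable (at x))"

definition test_fun :: "(real ^ 'n) set \<Rightarrow> (real ^ 'n \<Rightarrow> real) \<Rightarrow> bool" where
  "test_fun \<Omega> \<phi> \<longleftrightarrow>
     smooth \<phi> \<and> compact (closure {x. \<phi> x \<noteq> 0}) \<and> closure {x. \<phi> x \<noteq> 0} \<subseteq> \<Omega>"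

text \<open>A multi-index is a function \<open>\<alpha> :: 'n \<Rightarrow> nat\<close> of length \<open>sum \<alpha> UNIV\<close>.  As the index type
  is unordered, the order of differentiation is chosen arbitrarily, which is immaterial for
  smooth functions.\<close>

definition multi_partial :: "('n::finite \<Rightarrow> nat) \<Rightarrow> (real ^ 'n \<Rightarrow> real) \<Rightarrow> real ^ 'n \<Rightarrow> real" where
  "multi_partial \<alpha> \<phi> = iter_partial (SOME is. \<forall>i. count_list is i = \<alpha> i) \<phi>"

definition locally_integrable :: "(real ^ 'n) set \<Rightarrow> (real ^ 'n \<Rightarrow> real) \<Rightarrow> bool" where
  "locally_integrable \<Omega> f \<longleftrightarrow> (\<forall>K. compact K \<and> K \<subseteq> \<Omega> \<longrightarrow> f absolutely_integrable_on K)"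

definition has_weak_deriv ::
    "(real ^ 'n) set \<Rightarrow> ('n::finite \<Rightarrow> nat) \<Rightarrow> (real ^ 'n \<Rightarrow> real) \<Rightarrow> (real ^ 'n \<Rightarrow> real) \<Rightarrow> bool" where
  "has_weak_deriv \<Omega> \<alpha> f g \<longleftrightarrow>
     locally_integrable \<Omega> f \<and> locally_integrable \<Omega> g \<and>
     (\<forall>\<phi>. test_fun \<Omega> \<phi> \<longrightarrow>
        (LINT x:\<Omega>|lebesgue. f x * multi_partial \<alpha> \<phi> x)
          = (-1) ^ sum \<alpha> UNIV * (LINT x:\<Omega>|lebesgue. g x * \<phi> x))"

text \<open>Weak derivatives are unique up to null sets, which neither rearrangements nor
  quasi-norms see; a representative is fixed, with \<open>D\<^sup>0 f = f\<close>.\<close>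

definition weak_deriv ::
    "(real ^ 'n) set \<Rightarrow> ('n::finite \<Rightarrow> nat) \<Rightarrow> (real ^ 'n \<Rightarrow> real) \<Rightarrow> real ^ 'n \<Rightarrow> real" where
  "weak_deriv \<Omega> \<alpha> f = (if \<alpha> = (\<lambda>_. 0) then f else (SOME g. has_weak_deriv \<Omega> \<alpha> f g))"

definition weakly_differentiable :: "nat \<Rightarrow> (real ^ 'n::finite) set \<Rightarrow> (real ^ 'n \<Rightarrow> real) \<Rightarrow> bool" where
  "weakly_differentiable k \<Omega> f \<longleftrightarrow>
     (\<forall>\<alpha>. sum \<alpha> UNIV \<le> k \<longrightarrow> (\<exists>g. has_weak_deriv \<Omega> \<alpha> f g))"

definition grad_modulus ::
    "(real ^ 'n::finite) set \<Rightarrow> nat \<Rightarrow> (real ^ 'n \<Rightarrow> real) \<Rightarrow> real ^ 'n \<Rightarrow> real" where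
  "grad_modulus \<Omega> m f x = sqrt (\<Sum>\<alpha> | sum \<alpha> UNIV = m. (weak_deriv \<Omega> \<alpha> f x)\<^sup>2)"


section \<open>Lorentz--Zygmund--Sobolev spaces on a cube\<close>

text \<open>Weak derivatives live on the open cube; its boundary is a null set.\<close>

definition lz_sobolev_norm ::
    "nat \<Rightarrow> ennreal \<Rightarrow> ennreal \<Rightarrow> real \<Rightarrow> (real ^ 'n::finite) set \<Rightarrow> (real ^ 'n \<Rightarrow> real) \<Rightarrow> ennreal" where
  "lz_sobolev_norm k p r b Q f =
     (\<Sum>m\<le>k. lz_norm p r b Q (\<lambda>x. ennreal (grad_modulus (interior Q) m f x)))"

definition lz_sobolev ::
    "nat \<Rightarrow> ennreal \<Rightarrow> ennreal \<Rightarrow> real \<Rightarrow> (real ^ 'n::finite) set \<Rightarrow> (real ^ 'n \<Rightarrow> real) set" where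
  "lz_sobolev k p r b Q =
     {f. weakly_differentiable k (interior Q) f \<and> lz_sobolev_norm k p r b Q f < \<infinity>}"

end

theory Submission
  imports Defs
begin

text \<open>Poincare's inequality on cubes compares the mean of \<open>\<bar>\<nabla>\<^sup>m f\<bar>\<close> over a cube with its mean over a doubled
  cube, up to an error governed by \<open>\<bar>\<nabla>\<^sup>m\<^sup>+\<^sup>1 f\<bar>\<close>. Doubling up to \<open>Q\<^sub>0\<close> and iterating in \<open>m\<close>
  bounds the sharp maximal function pointwise by the fractional maximal function of order \<open>k\<close> of
  \<open>\<bar>\<nabla>\<^sup>k f\<bar>\<close> plus the means over \<open>Q\<^sub>0\<close> of the lower order gradients, so no Sobolev embedding is
  needed. With \<open>a = k / d\<close>, the rearrangement of the fractional maximal function of \<open>g\<close> at \<open>t\<close> is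
  at most a multiple of the supremum of \<open>s powr (a - 1) * (\<integral>\<^sub>0\<^sup>s g\<^sup>*)\<close> over \<open>t \<le> s \<le> 1\<close>, and a Hardy inequality
  with logarithmic weights, where \<open>b < -1/r\<close> enters, concludes.

  Weak derivatives are tested only with products of one-dimensional bump functions. For these,
  iterated partial derivatives are explicit and visibly independent of the order of
  differentiation.\<close>

section \<open>Test functions of product type\<close>

text \<open>Membership in the space gives no integrability beforehand. It is extracted from the
  Hardy inequality itself: an infinite \<open>\<integral>\<^sub>0\<^sup>1 g\<^sup>*\<close> would
  make its left side infinite, while the right side is a multiple of a finite quasi-norm. Weak
  derivatives are used only through the identity \<open>u (x + h e) - u x =
  \<integral>\<^sub>0\<^sup>h v (x + s e) ds\<close>, valid almost everywhere for axis directions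
  \<open>e\<close>. It takes the place of approximation by smooth functions and reduces Poincare's
  inequality to Fubini and translation invariance. The two restrictions on the exponents act
  separately. \<open>k < d\<close> means \<open>a < 1\<close>: then \<open>u powr (- a)\<close> is
  integrable at 0, and the kernel left by the fractional averages decays like
  \<open>(u / t) powr (1 - a)\<close>. For finite \<open>r\<close>, \<open>b < -1/r\<close> makes
  \<open>(1 + |ln t|) powr (b r)\<close> integrable against \<open>dt / t\<close> at 0; this
  integral gains one power of the logarithm, which is the shift from \<open>b\<close> to
  \<open>b + 1/r\<close>.\<close>

definition cube :: "real ^ 'n \<Rightarrow> real \<Rightarrow> (real ^ 'n) set" where
  "cube a l = cbox a (\<chi> i. a $ i + l)"

lemma emeasure_cube:
  fixes a :: "real ^ 'n::finite"
  assumes "0 \<le> l"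
  shows "emeasure lborel (cube a l) = ennreal (l ^ CARD('n))"
proof -
  have "a \<bullet> b \<le> (\<chi> i. a $ i + l) \<bullet> b" if "b \<in> Basis" for b :: "real ^ 'n"
    using that assms by (auto simp: Basis_vec_def cart_eq_inner_axis[symmetric])
  then have "emeasure lborel (cube a l) = ennreal (\<Prod>b\<in>Basis. ((\<chi> i. a $ i + l) - a) \<bullet> b)"
    unfolding cube_def by (rule emeasure_lborel_cbox)
  also have "(\<Prod>b\<in>Basis. ((\<chi> i. a $ i + l) - a) \<bullet> b) = (\<Prod>b\<in>(Basis :: (real ^ 'n) set). l)"
    by (intro prod.cong) (auto simp: Basis_vec_def cart_eq_inner_axis[symmetric])
  finally show ?thesis by simp
qed

lemma measure_cube:
  fixes a :: "real ^ 'n::finite"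
  assumes "0 \<le> l"
  shows "measure lborel (cube a l) = l ^ CARD('n)"
  using emeasure_cube[OF assms, of a] assms by (simp add: measure_def)

lemma cube_borel [measurable]: "cube a l \<in> sets borel"
  by (simp add: cube_def)

text \<open>The polynomial numerator and the power of \<open>q\<close> make the class closed under
  differentiation: every derivative of the standard bump, which is the case \<open>p = 1\<close>,
  \<open>m = 0\<close>, \<open>q = (t - a) * (b - t)\<close>, has this shape again.\<close>

definition exp_cutoff :: "real poly \<Rightarrow> real poly \<Rightarrow> nat \<Rightarrow> real \<Rightarrow> real \<Rightarrow> real" where
  "exp_cutoff q p m c t =
     (if poly q t > 0 then poly p t / poly q t ^ m * exp (- c / poly q t) else 0)"

text \<open>The term of order \<open>m + 2\<close> of the exponential series already gives the
  bound. The two powers beyond \<open>m\<close> leave \<open>y\<^sup>2\<close>, which makes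
  difference quotients vanish at the zeros of \<open>q\<close>.\<close>

lemma exp_minus_inverse_bound:
  fixes c y :: real
  assumes "0 < c" "0 < y"
  shows "exp (- c / y) / y ^ m \<le> fact (m + 2) / c ^ (m + 2) * y\<^sup>2"
proof -
  have "(c / y) ^ (m + 2) / fact (m + 2) \<le> exp (c / y)"
  proof -
    have "(\<Sum>n\<in>{m+2}. (c/y)^n /\<^sub>R fact n) \<le> (\<Sum>n. (c/y)^n /\<^sub>R fact n)"
      using assms by (intro sum_le_suminf summable_exp_generic) auto
    then show ?thesis by (simp add: exp_def divide_inverse mult.commute)
  qed
  then have "c ^ (m + 2) \<le> exp (c / y) * (y ^ (m + 2) * fact (m + 2))"
    using assms by (simp add: field_simps power_divide del: fact_Suc power_Suc)
  then have "exp (- c / y) * c ^ (m + 2) \<le> exp (- c / y) * (exp (c / y) * (y ^ (m + 2) * fact (m + 2)))"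
    by (intro mult_left_mono) auto
  also have "\<dots> = y ^ (m + 2) * fact (m + 2)"
    by (simp add: exp_minus field_simps del: fact_Suc power_Suc)
  finally show ?thesis
    using assms by (simp add: field_simps power_add power2_eq_square del: fact_Suc)
qed

text \<open>Numerator of the derivative of \<open>p / q ^ m * exp (- c / q)\<close> over the common
  denominator \<open>q ^ (m + 2)\<close>.\<close>

definition exp_cutoff_deriv :: "real poly \<Rightarrow> real \<Rightarrow> real poly \<Rightarrow> nat \<Rightarrow> real poly" where
  "exp_cutoff_deriv q c p m = pderiv p * q ^ 2 - of_nat m * p * pderiv q * q + smult c (p * pderiv q)"

lemma DERIV_exp_cutoff:
  assumes "0 < c"
  shows "(exp_cutoff q p m c has_field_derivative
           exp_cutoff q (exp_cutoff_deriv q c p m) (m + 2) c t) (at t)"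
proof (cases "poly q t > 0")
  case True
  have o: "open {s. 0 < poly q s}"
    by (intro open_Collect_less continuous_intros)
  have d: "((\<lambda>s. poly p s / poly q s ^ m * exp (- c / poly q s)) has_field_derivative
           exp_cutoff q (exp_cutoff_deriv q c p m) (m + 2) c t) (at t)"
  proof (cases m)
    case 0
    show ?thesis
      using True unfolding exp_cutoff_def exp_cutoff_deriv_def 0
      by (auto intro!: derivative_eq_intros simp: divide_simps power2_eq_square)
        (simp_all add: algebra_simps)
  next
    case (Suc j)
    show ?thesis
      using True unfolding exp_cutoff_def exp_cutoff_deriv_def Suc
      by (auto intro!: derivative_eq_intros simp: divide_simps power2_eq_square)
        (cases j; simp add: algebra_simps)
  qed
  show ?thesis
    by (rule has_field_derivative_transform_within_open[OF d o]) (use True in \<open>auto simp: exp_cutoff_def\<close>)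
next
  case False
  define K where "K = fact (m + 2) / c ^ (m + 2)"
  have K: "K \<ge> 0" using assms by (simp add: K_def)
  \<comment> \<open>Since \<open>poly q t \<le> 0\<close>, a positive \<open>poly q s\<close> is at
    most \<open>poly q s - poly q t\<close>. This treats zeros of \<open>q\<close> and points with
    negative \<open>q\<close> together and makes the function quadratically small near
    \<open>t\<close>.\<close>
  have bd: "\<bar>exp_cutoff q p m c s\<bar> \<le> K * \<bar>poly p s\<bar> * (poly q s - poly q t)\<^sup>2" for s
  proof (cases "poly q s > 0")
    case True
    have "\<bar>exp_cutoff q p m c s\<bar> = \<bar>poly p s\<bar> * (exp (- c / poly q s) / poly q s ^ m)"
      using True by (simp add: exp_cutoff_def abs_mult)
    also have "\<dots> \<le> \<bar>poly p s\<bar> * (K * (poly q s)\<^sup>2)"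
      using exp_minus_inverse_bound[OF assms True, of m] by (intro mult_left_mono) (auto simp: K_def)
    also have "\<dots> \<le> \<bar>poly p s\<bar> * (K * (poly q s - poly q t)\<^sup>2)"
      using False True K by (intro mult_left_mono power_mono) auto
    finally show ?thesis by (simp add: algebra_simps)
  qed (use K in \<open>auto simp: exp_cutoff_def\<close>)
  have "((\<lambda>s. (exp_cutoff q p m c s - exp_cutoff q p m c t) / (s - t)) \<longlongrightarrow> 0) (at t)"
  proof (rule Lim_null_comparison)
    show "\<forall>\<^sub>F s in at t. norm ((exp_cutoff q p m c s - exp_cutoff q p m c t) / (s - t))
            \<le> K * \<bar>poly p s\<bar> * (\<bar>(poly q s - poly q t) / (s - t)\<bar> * \<bar>poly q s - poly q t\<bar>)"
    proof (rule eventuallyI)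
      fix s
      have "norm ((exp_cutoff q p m c s - exp_cutoff q p m c t) / (s - t)) = \<bar>exp_cutoff q p m c s\<bar> / \<bar>s - t\<bar>"
        using False by (simp add: exp_cutoff_def)
      also have "\<dots> \<le> (K * \<bar>poly p s\<bar> * (poly q s - poly q t)\<^sup>2) / \<bar>s - t\<bar>"
        by (intro divide_right_mono bd) auto
      also have "\<dots> = K * \<bar>poly p s\<bar> * (\<bar>(poly q s - poly q t) / (s - t)\<bar> * \<bar>poly q s - poly q t\<bar>)"
        by (simp add: power2_eq_square abs_mult_self_eq flip: abs_mult)
      finally show "norm ((exp_cutoff q p m c s - exp_cutoff q p m c t) / (s - t))
            \<le> K * \<bar>poly p s\<bar> * (\<bar>(poly q s - poly q t) / (s - t)\<bar> * \<bar>poly q s - poly q t\<bar>)" .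
    qed
    have "((\<lambda>s. (poly q s - poly q t) / (s - t)) \<longlongrightarrow> poly (pderiv q) t) (at t)"
      using poly_DERIV[of q t] by (simp add: has_field_derivative_iff)
    then have "((\<lambda>s. K * \<bar>poly p s\<bar> * (\<bar>(poly q s - poly q t) / (s - t)\<bar> * \<bar>poly q s - poly q t\<bar>)) \<longlongrightarrow>
        K * \<bar>poly p t\<bar> * (\<bar>poly (pderiv q) t\<bar> * \<bar>poly q t - poly q t\<bar>)) (at t)"
      by (intro tendsto_intros)
    then show "((\<lambda>s. K * \<bar>poly p s\<bar> * (\<bar>(poly q s - poly q t) / (s - t)\<bar> * \<bar>poly q s - poly q t\<bar>)) \<longlongrightarrow> 0) (at t)"
      by simp
  qed
  then show ?thesis
    using False by (simp add: has_field_derivative_iff exp_cutoff_def)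
qed

text \<open>Carrying all derivatives along as a sequence turns differentiation into a shift of the
  index.\<close>

definition deriv_tower :: "(nat \<Rightarrow> real \<Rightarrow> real) \<Rightarrow> bool" where
  "deriv_tower D \<longleftrightarrow> (\<forall>n t. (D n has_field_derivative D (Suc n) t) (at t))"

definition bump_tower :: "real \<Rightarrow> real \<Rightarrow> (nat \<Rightarrow> real \<Rightarrow> real) \<Rightarrow> bool" where
  "bump_tower a b D \<longleftrightarrow> deriv_tower D \<and> (\<forall>n t. t \<notin> {a<..<b} \<longrightarrow> D n t = 0)"

text \<open>The parameter \<open>c\<close> is kept free so that it can tend to 0 later: the bumps
  then increase to the indicator of the open interval.\<close>

lemma bump_tower_exists:
  fixes a b c :: real
  assumes "a < b" "0 < c"
  shows "\<exists>D. bump_tower a b D \<and>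
    D 0 = (\<lambda>t. if t \<in> {a<..<b} then exp (- c / ((t - a) * (b - t))) else 0)"
proof -
  define q :: "real poly" where "q = [:-a, 1:] * [:b, -1:]"
  have q: "poly q t = (t - a) * (b - t)" for t
    by (simp add: q_def algebra_simps)
  have pos: "poly q t > 0 \<longleftrightarrow> t \<in> {a<..<b}" for t
    using assms by (auto simp: q zero_less_mult_iff)
  define P :: "nat \<Rightarrow> real poly \<times> nat" where
    "P = rec_nat (1, 0) (\<lambda>_ (p, m). (exp_cutoff_deriv q c p m, m + 2))"
  define D where "D n = exp_cutoff q (fst (P n)) (snd (P n)) c" for n
  have "P (Suc n) = (exp_cutoff_deriv q c (fst (P n)) (snd (P n)), snd (P n) + 2)" for n
    by (simp add: P_def case_prod_beta)
  then have "deriv_tower D"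
    using DERIV_exp_cutoff[OF assms(2)] by (simp add: deriv_tower_def D_def)
  moreover have "D n t = 0" if "t \<notin> {a<..<b}" for n t
    using that pos[of t] by (auto simp: D_def exp_cutoff_def)
  moreover have "D 0 = (\<lambda>t. if t \<in> {a<..<b} then exp (- c / ((t - a) * (b - t))) else 0)"
  proof
    fix t
    show "D 0 t = (if t \<in> {a<..<b} then exp (- c / ((t - a) * (b - t))) else 0)"
      using pos[of t] by (simp add: D_def P_def exp_cutoff_def q)
  qed
  ultimately show ?thesis
    unfolding bump_tower_def by blast
qed

lemma bump_tower_shift:
  assumes "bump_tower a b D"
  shows "bump_tower (a + s) (b + s) (\<lambda>n t. D n (t - s))"
proof -
  have "((\<lambda>t. D n (t - s)) has_field_derivative D (Suc n) (t - s)) (at t)" for n t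
  proof -
    have "(D n has_field_derivative D (Suc n) (t - s)) (at (t - s))"
      using assms by (simp add: bump_tower_def deriv_tower_def)
    then have "((\<lambda>t. D n (t - s)) has_field_derivative D (Suc n) (t - s) * 1) (at t)"
      by (rule DERIV_chain2) (auto intro!: derivative_eq_intros)
    then show ?thesis by simp
  qed
  then show ?thesis
    using assms by (auto simp: bump_tower_def deriv_tower_def)
qed

section \<open>Products of one-variable bumps and their partial derivatives\<close>

definition tensor :: "('n::finite \<Rightarrow> nat \<Rightarrow> real \<Rightarrow> real) \<Rightarrow> ('n \<Rightarrow> nat) \<Rightarrow> real ^ 'n \<Rightarrow> real" where
  "tensor D e x = (\<Prod>i\<in>UNIV. D i (e i) (x $ i))"

lemma tensor_has_derivative:
  assumes "\<And>i. deriv_tower (D i)"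
  shows "(tensor D e has_derivative
      (\<lambda>y. \<Sum>i\<in>UNIV. (D i (Suc (e i)) (x $ i) * y $ i) * (\<Prod>j\<in>UNIV - {i}. D j (e j) (x $ j)))) (at x)"
proof -
  have *: "((\<lambda>x. D i (e i) (x $ i)) has_derivative (\<lambda>y. D i (Suc (e i)) (x $ i) * y $ i)) (at x)" for i
  proof -
    have "(D i (e i) has_derivative (\<lambda>h. D i (Suc (e i)) (x $ i) * h)) (at (x $ i))"
      using assms[of i] by (simp add: deriv_tower_def has_field_derivative_def)
    moreover have "((\<lambda>x. x $ i) has_derivative (\<lambda>y. y $ i)) (at x)"
      by (simp add: bounded_linear_imp_has_derivative bounded_linear_vec_nth)
    ultimately show ?thesis
      by (rule has_derivative_compose[rotated])
  qed
  show ?thesis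
    unfolding tensor_def[abs_def] by (rule has_derivative_prod) (rule *)
qed

lemma partial_tensor:
  assumes "\<And>i. deriv_tower (D i)"
  shows "partial j (tensor D e) = tensor D (e(j := Suc (e j)))"
proof
  fix x
  have "partial j (tensor D e) x = (\<Sum>i\<in>UNIV. (D i (Suc (e i)) (x $ i) * axis j 1 $ i) * (\<Prod>j\<in>UNIV - {i}. D j (e j) (x $ j)))"
    unfolding partial_def frechet_derivative_at[OF tensor_has_derivative[OF assms], symmetric] ..
  also have "\<dots> = (\<Sum>i\<in>UNIV. if i = j then D j (Suc (e j)) (x $ j) * (\<Prod>i\<in>UNIV - {j}. D i (e i) (x $ i)) else 0)"
    by (intro sum.cong) (auto simp: axis_def)
  also have "\<dots> = D j (Suc (e j)) (x $ j) * (\<Prod>i\<in>UNIV - {j}. D i (e i) (x $ i))"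
    by simp
  also have "\<dots> = tensor D (e(j := Suc (e j))) x"
    unfolding tensor_def by (subst prod.remove[of UNIV j]) (auto intro!: arg_cong2[of _ _ _ _ "(*)"] prod.cong)
  finally show "partial j (tensor D e) x = tensor D (e(j := Suc (e j))) x" .
qed

lemma iter_partial_tensor:
  assumes "\<And>i. deriv_tower (D i)"
  shows "iter_partial is (tensor D e) = tensor D (\<lambda>i. e i + count_list is i)"
proof (induction "is")
  case Nil
  then show ?case by (simp add: iter_partial_def)
next
  case (Cons j js)
  have "iter_partial (j # js) (tensor D e) = partial j (tensor D (\<lambda>i. e i + count_list js i))"
    using Cons by (simp add: iter_partial_def)
  also have "\<dots> = tensor D (\<lambda>i. e i + count_list (j # js) i)"
    by (subst partial_tensor[OF assms]) (auto intro!: arg_cong[where f = "tensor D"])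
  finally show ?case .
qed

lemma smooth_tensor:
  assumes "\<And>i. deriv_tower (D i)"
  shows "smooth (tensor D e)"
  unfolding smooth_def iter_partial_tensor[OF assms]
  by (intro allI, rule differentiableI, rule tensor_has_derivative, rule assms)

text \<open>Guarantees that the choice of a list in \<open>multi_partial\<close> succeeds. The
  witness has one block of repeated entries per coordinate.\<close>

lemma ex_count_list: "\<exists>is. \<forall>i. count_list is i = \<alpha> i" for \<alpha> :: "'n::finite \<Rightarrow> nat"
proof -
  obtain xs where xs: "set xs = (UNIV :: 'n set)" "distinct xs"
    using finite_distinct_list[OF finite] by metis
  have r: "count_list (replicate m j) i = (if i = j then m else 0)" for m i and j :: 'n
    by (induction m) auto
  have "count_list (concat (map (\<lambda>i. replicate (\<alpha> i) i) ys)) i = (if i \<in> set ys then \<alpha> i else 0)"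
    if "distinct ys" for ys i
    using that by (induction ys) (auto simp: count_list_append r)
  from this[OF xs(2)] xs(1) show ?thesis
    by (intro exI[of _ "concat (map (\<lambda>i. replicate (\<alpha> i) i) xs)"]) simp
qed

lemma multi_partial_tensor:
  assumes "\<And>i. deriv_tower (D i)"
  shows "multi_partial \<alpha> (tensor D e) = tensor D (\<lambda>i. e i + \<alpha> i)"
  unfolding multi_partial_def iter_partial_tensor[OF assms]
  using someI_ex[OF ex_count_list[of \<alpha>]] by simp

lemma continuous_on_tensor:
  assumes "\<And>i. deriv_tower (D i)"
  shows "continuous_on UNIV (tensor D e)"
  by (meson assms continuous_at_imp_continuous_on has_derivative_continuous tensor_has_derivative)

lemma tensor_eq_0:
  assumes "\<And>i. bump_tower (a $ i) (b $ i) (D i)" "x \<notin> box a b"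
  shows "tensor D e x = 0"
proof -
  from assms(2) obtain i where "x $ i \<notin> {a $ i<..<b $ i}"
    by (auto simp: mem_box_cart)
  then have "D i (e i) (x $ i) = 0"
    using assms(1)[of i] by (simp add: bump_tower_def)
  then show ?thesis
    unfolding tensor_def by (intro prod_zero) auto
qed

lemma test_fun_tensor:
  assumes "\<And>i. bump_tower (a $ i) (b $ i) (D i)" "cbox a b \<subseteq> \<Omega>"
  shows "test_fun \<Omega> (tensor D e)"
proof -
  have "{x. tensor D e x \<noteq> 0} \<subseteq> cbox a b"
    using tensor_eq_0[OF assms(1)] box_subset_cbox[of a b] by blast
  then have "closure {x. tensor D e x \<noteq> 0} \<subseteq> cbox a b"
    by (rule closure_minimal) (rule closed_cbox)
  moreover from this have "compact (closure {x. tensor D e x \<noteq> 0})"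
    by (metis bounded_cbox bounded_subset closed_closure compact_eq_bounded_closed)
  ultimately show ?thesis
    using assms smooth_tensor[of D] by (auto simp: test_fun_def bump_tower_def)
qed

lemma sum_fun_upd_Suc:
  fixes \<alpha> :: "'n::finite \<Rightarrow> nat"
  shows "sum (\<alpha>(j := Suc (\<alpha> j))) UNIV = Suc (sum \<alpha> UNIV)"
proof -
  have "sum (\<alpha>(j := Suc (\<alpha> j))) UNIV = Suc (\<alpha> j) + sum (\<alpha>(j := Suc (\<alpha> j))) (UNIV - {j})"
    by (subst sum.remove[of _ j]) auto
  also have "sum (\<alpha>(j := Suc (\<alpha> j))) (UNIV - {j}) = sum \<alpha> (UNIV - {j})"
    by (rule sum.cong) auto
  also have "Suc (\<alpha> j) + sum \<alpha> (UNIV - {j}) = Suc (sum \<alpha> UNIV)"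
    by (subst (2) sum.remove[of _ j]) auto
  finally show ?thesis .
qed

text \<open>Differentiating \<open>tensor D (\<lambda>_. 0)\<close> by the larger multi-index is the
  same as differentiating its \<open>j\<close>-th partial derivative by \<open>\<alpha>\<close>. The
  integral of \<open>f\<close> against the result can be read with either weak derivative, and the
  two signs differ by one factor -1.\<close>

lemma weak_deriv_step:
  fixes \<alpha> :: "'n::finite \<Rightarrow> nat"
  assumes u: "has_weak_deriv \<Omega> \<alpha> f u" and v: "has_weak_deriv \<Omega> (\<alpha>(j := Suc (\<alpha> j))) f v"
    and D: "\<And>i. bump_tower (a $ i) (b $ i) (D i)" and ab: "cbox a b \<subseteq> \<Omega>"
  shows "(LINT x:\<Omega>|lebesgue. u x * tensor D ((\<lambda>_. 0)(j := 1)) x)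
       = - (LINT x:\<Omega>|lebesgue. v x * tensor D (\<lambda>_. 0) x)"
proof -
  have T: "\<And>i. deriv_tower (D i)" using D by (simp add: bump_tower_def)
  let ?e = "(\<lambda>_. 0)(j := 1) :: 'n \<Rightarrow> nat"
  let ?\<beta> = "\<alpha>(j := Suc (\<alpha> j))"
  have eq: "multi_partial \<alpha> (tensor D ?e) = multi_partial ?\<beta> (tensor D (\<lambda>_. 0))"
    by (auto simp: multi_partial_tensor[OF T] intro!: arg_cong[where f = "tensor D"])
  have s: "sum ?\<beta> UNIV = Suc (sum \<alpha> UNIV)" by (rule sum_fun_upd_Suc)
  have "(-1) ^ sum \<alpha> UNIV * (LINT x:\<Omega>|lebesgue. u x * tensor D ?e x)
      = (LINT x:\<Omega>|lebesgue. f x * multi_partial \<alpha> (tensor D ?e) x)"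
    using u test_fun_tensor[OF D ab, of ?e] by (simp add: has_weak_deriv_def)
  also have "\<dots> = (-1) ^ Suc (sum \<alpha> UNIV) * (LINT x:\<Omega>|lebesgue. v x * tensor D (\<lambda>_. 0) x)"
    using v test_fun_tensor[OF D ab, of "\<lambda>_. 0"] unfolding has_weak_deriv_def eq s by blast
  finally show ?thesis
    by (cases "even (sum \<alpha> UNIV)") auto
qed

section \<open>Weak derivatives and differences\<close>

lemma nn_integral_lborel_translate:
  fixes f :: "'a::euclidean_space \<Rightarrow> ennreal"
  assumes [measurable]: "f \<in> borel_measurable borel"
  shows "(\<integral>\<^sup>+x. f (x + c) \<partial>lborel) = (\<integral>\<^sup>+x. f x \<partial>lborel)"
proof -
  have "(\<integral>\<^sup>+x. f x \<partial>lborel) = (\<integral>\<^sup>+x. f x \<partial>distr lborel borel ((+) c))"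
    by (simp add: lborel_distr_plus)
  also have "\<dots> = (\<integral>\<^sup>+x. f (x + c) \<partial>lborel)"
    by (subst nn_integral_distr) (auto simp: add.commute)
  finally show ?thesis ..
qed

lemma integral_lborel_translate:
  fixes f :: "'a::euclidean_space \<Rightarrow> real"
  assumes [measurable]: "f \<in> borel_measurable borel"
  shows "(\<integral>x. f (x + c) \<partial>lborel) = (\<integral>x. f x \<partial>lborel)"
proof -
  have "(\<integral>x. f x \<partial>lborel) = (\<integral>x. f x \<partial>distr lborel borel ((+) c))"
    by (simp add: lborel_distr_plus)
  also have "\<dots> = (\<integral>x. f (x + c) \<partial>lborel)"
    by (subst integral_distr) (auto simp: add.commute)
  finally show ?thesis ..
qed

lemma integrable_lborel_translate:
  fixes f :: "'a::euclidean_space \<Rightarrow> real"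
  assumes "integrable lborel f"
  shows "integrable lborel (\<lambda>x. f (x + c))"
proof -
  have [measurable]: "f \<in> borel_measurable borel"
    using assms by (simp add: borel_measurable_integrable)
  show ?thesis
    using assms nn_integral_lborel_translate[of "\<lambda>x. ennreal (norm (f x))" c]
    by (simp add: integrable_iff_bounded)
qed

lemma AE_lborel_translate:
  fixes c :: "'a::euclidean_space"
  assumes "AE x in lborel. P x"
  shows "AE x in lborel. P (x + c)"
proof -
  obtain N where N: "{x. \<not> P x} \<subseteq> N" "N \<in> sets lborel" "emeasure lborel N = 0"
    using assms by (auto elim: AE_E)
  have [measurable]: "N \<in> sets borel" using N by simp
  have "(\<integral>\<^sup>+x. indicator N (x + c) \<partial>lborel) = (\<integral>\<^sup>+x. indicator N x \<partial>lborel)"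
    by (rule nn_integral_lborel_translate) simp
  then have "(\<integral>\<^sup>+x. indicator N (x + c) \<partial>lborel) = 0"
    using N by simp
  then have "AE x in lborel. indicator N (x + c) = (0::ennreal)"
    by (subst (asm) nn_integral_0_iff_AE) auto
  then show ?thesis
  proof eventually_elim
    case (elim x)
    then show ?case using N(1) by (auto simp: indicator_def split: if_splits)
  qed
qed

text \<open>For fixed \<open>s\<close> a translation preserves the integral of \<open>|v|\<close>,
  so integrating over \<open>s\<close> only contributes the length of the interval. The factor
  \<open>g\<close> and the direction \<open>c\<close>, which may be 0, are general enough for both
  integrands to which Fubini is applied in \<open>line_defect_orthogonal\<close>.\<close>

lemma integrable_translate_pair:
  fixes v :: "'a::euclidean_space \<Rightarrow> real" and g :: "'a \<Rightarrow> real \<Rightarrow> real"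
  assumes v: "integrable lborel v"
    and g [measurable]: "(\<lambda>(x, s). g x s) \<in> borel_measurable (borel \<Otimes>\<^sub>M borel)"
    and bd: "\<And>x s. s \<in> {0..h} \<Longrightarrow> \<bar>g x s\<bar> \<le> C"
  shows "integrable (lborel \<Otimes>\<^sub>M lborel) (\<lambda>(x, s). indicator {0..h} s * (v (x + s *\<^sub>R c) * g x s))"
proof -
  have [measurable]: "v \<in> borel_measurable borel"
    using v by (simp add: borel_measurable_integrable)
  have "(\<integral>\<^sup>+p. ennreal (norm ((\<lambda>(x, s). indicator {0..h} s * (v (x + s *\<^sub>R c) * g x s)) p)) \<partial>(lborel \<Otimes>\<^sub>M lborel))
     \<le> (\<integral>\<^sup>+p. (\<lambda>(x, s). indicator {0..h} s * (ennreal \<bar>C\<bar> * ennreal \<bar>v (x + s *\<^sub>R c)\<bar>)) p \<partial>(lborel \<Otimes>\<^sub>M lborel))"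
  proof (intro nn_integral_mono, clarify)
    fix x s
    show "ennreal (norm (indicator {0..h} s * (v (x + s *\<^sub>R c) * g x s)))
        \<le> indicator {0..h} s * (ennreal \<bar>C\<bar> * ennreal \<bar>v (x + s *\<^sub>R c)\<bar>)"
      using order_trans[OF bd abs_ge_self, of s x]
      by (auto simp: indicator_def abs_mult mult.commute intro!: mult_right_mono simp flip: ennreal_mult)
  qed
  also have "\<dots> = (\<integral>\<^sup>+s. (\<integral>\<^sup>+x. indicator {0..h} s * (ennreal \<bar>C\<bar> * ennreal \<bar>v (x + s *\<^sub>R c)\<bar>) \<partial>lborel) \<partial>lborel)"
    by (subst lborel_pair.nn_integral_snd[symmetric]) auto
  also have "\<dots> = (\<integral>\<^sup>+s. indicator {0..h} s * (ennreal \<bar>C\<bar> * (\<integral>\<^sup>+x. ennreal \<bar>v x\<bar> \<partial>lborel)) \<partial>lborel)"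
    by (intro nn_integral_cong) (simp add: nn_integral_cmult nn_integral_lborel_translate[where f = "\<lambda>x. ennreal \<bar>v x\<bar>"])
  also have "\<dots> = (\<integral>\<^sup>+s. (ennreal \<bar>C\<bar> * (\<integral>\<^sup>+x. ennreal \<bar>v x\<bar> \<partial>lborel)) * indicator {0..h} s \<partial>lborel)"
    by (simp add: mult.commute)
  also have "\<dots> = (ennreal \<bar>C\<bar> * (\<integral>\<^sup>+x. ennreal \<bar>v x\<bar> \<partial>lborel)) * emeasure lborel {0..h}"
    by (subst nn_integral_cmult_indicator) auto
  also have "\<dots> < \<infinity>"
  proof -
    have "(\<integral>\<^sup>+x. ennreal \<bar>v x\<bar> \<partial>lborel) < \<infinity>"
      using v by (simp add: integrable_iff_bounded)
    moreover have "emeasure lborel {0..h} < \<infinity>"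
      by (cases "0 \<le> h") auto
    ultimately show ?thesis by (simp add: ennreal_mult_less_top)
  qed
  finally show ?thesis
    by (intro integrableI_bounded) auto
qed

text \<open>The integrals run over the whole space, where translations are available; the test
  functions vanish outside \<open>cbox a b \<subseteq> \<Omega>\<close> anyway.\<close>

definition weak_partial :: "(real ^ 'n::finite) set \<Rightarrow> 'n \<Rightarrow> (real ^ 'n \<Rightarrow> real) \<Rightarrow> (real ^ 'n \<Rightarrow> real) \<Rightarrow> bool" where
  "weak_partial \<Omega> j u v \<longleftrightarrow>
     (\<forall>D a b. (\<forall>i. bump_tower (a $ i) (b $ i) (D i)) \<longrightarrow> cbox a b \<subseteq> \<Omega> \<longrightarrow>
       (\<integral>x. u x * tensor D ((\<lambda>_. 0)(j := 1)) x \<partial>lborel) = - (\<integral>x. v x * tensor D (\<lambda>_. 0) x \<partial>lborel))"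

lemma tensor_shift:
  "tensor (\<lambda>i n t. D i n (t - (if i = j then s else 0))) e x = tensor D e (x - s *\<^sub>R axis j 1)"
  unfolding tensor_def by (intro prod.cong) (auto simp: axis_def)

lemma tensor_bounded:
  assumes "\<And>i. bump_tower (a $ i) (b $ i) (D i)"
  obtains C where "\<And>x. \<bar>tensor D e x\<bar> \<le> C"
proof -
  have T: "\<And>i. deriv_tower (D i)" using assms by (simp add: bump_tower_def)
  have "compact (tensor D e ` cbox a b)"
    by (intro compact_continuous_image continuous_on_subset[OF continuous_on_tensor[OF T]]) auto
  then obtain C where C: "\<And>x. x \<in> cbox a b \<Longrightarrow> \<bar>tensor D e x\<bar> \<le> C"
    by (force simp: bounded_iff dest!: compact_imp_bounded)
  have "\<bar>tensor D e x\<bar> \<le> max C 0" for x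
  proof (cases "x \<in> cbox a b")
    case False
    then have "tensor D e x = 0"
      using tensor_eq_0[OF assms, where x = x and e = e] box_subset_cbox[of a b] by blast
    then show ?thesis by simp
  qed (use C in force)
  then show ?thesis by (rule that)
qed

lemma borel_measurable_tensor:
  assumes "\<And>i. deriv_tower (D i)"
  shows "tensor D e \<in> borel_measurable borel"
  using continuous_on_tensor[OF assms] by (rule borel_measurable_continuous_onI)

lemma tensor_line_deriv:
  assumes "\<And>i. deriv_tower (D i)"
  shows "((\<lambda>s. tensor D e (x - s *\<^sub>R axis j 1)) has_real_derivative
           - tensor D (e(j := Suc (e j))) (x - s *\<^sub>R axis j 1)) (at s)"
proof -
  let ?y = "x - s *\<^sub>R axis j 1"
  have "((\<lambda>s. x - s *\<^sub>R axis j 1) has_derivative (\<lambda>s. - (s *\<^sub>R axis j 1))) (at s)"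
    by (auto intro!: derivative_eq_intros)
  moreover have "(tensor D e has_derivative frechet_derivative (tensor D e) (at ?y)) (at ?y)"
    unfolding frechet_derivative_works[symmetric]
    by (rule differentiableI, rule tensor_has_derivative, rule assms)
  ultimately have *: "((\<lambda>s. tensor D e (x - s *\<^sub>R axis j 1)) has_derivative
      (\<lambda>s. frechet_derivative (tensor D e) (at ?y) (- (s *\<^sub>R axis j 1)))) (at s)"
    by (rule has_derivative_compose)
  have lin: "linear (frechet_derivative (tensor D e) (at ?y))"
    by (rule linear_frechet_derivative, rule differentiableI, rule tensor_has_derivative, rule assms)
  have "frechet_derivative (tensor D e) (at ?y) (- (s *\<^sub>R axis j 1)) = - partial j (tensor D e) ?y * s" for s
    by (simp add: linear_neg[OF lin] linear_cmul[OF lin] partial_def)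
  then show ?thesis
    unfolding partial_tensor[OF assms] has_field_derivative_def
    by (intro has_derivative_eq_rhs[OF *] ext)
qed

text \<open>The error in the fundamental theorem of calculus along a segment parallel to an axis. It
  is shown to vanish first against bumps, then in the mean over boxes, then almost
  everywhere.\<close>

definition line_defect :: "'n::finite \<Rightarrow> real \<Rightarrow> (real ^ 'n \<Rightarrow> real) \<Rightarrow> (real ^ 'n \<Rightarrow> real) \<Rightarrow> real ^ 'n \<Rightarrow> real" where
  "line_defect j h u v x =
     u (x + h *\<^sub>R axis j 1) - u x - (\<integral>s. indicator {0..h} s * v (x + s *\<^sub>R axis j 1) \<partial>lborel)"

lemma integrable_line_integral:
  fixes v :: "real ^ 'n::finite \<Rightarrow> real"
  assumes "integrable lborel v"
  shows "integrable lborel (\<lambda>x. \<integral>s. indicator {0..h} s * v (x + s *\<^sub>R axis j 1) \<partial>lborel)"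
    and "AE x in lborel. integrable lborel (\<lambda>s. indicator {0..h} s * v (x + s *\<^sub>R axis j 1))"
proof -
  have "integrable (lborel \<Otimes>\<^sub>M lborel) (\<lambda>(x, s). indicator {0..h} s * v (x + s *\<^sub>R axis j 1))"
    using integrable_translate_pair[OF assms, of "\<lambda>_ _. 1" h 1 "axis j 1"] by simp
  then show "integrable lborel (\<lambda>x. \<integral>s. indicator {0..h} s * v (x + s *\<^sub>R axis j 1) \<partial>lborel)"
    and "AE x in lborel. integrable lborel (\<lambda>s. indicator {0..h} s * v (x + s *\<^sub>R axis j 1))"
    by (rule lborel_pair.integrable_fst, rule lborel_pair.AE_integrable_fst)
qed

lemma integrable_line_defect:
  fixes u v :: "real ^ 'n::finite \<Rightarrow> real"
  assumes "integrable lborel u" "integrable lborel v"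
  shows "integrable lborel (line_defect j h u v)"
  unfolding line_defect_def[abs_def]
  by (intro Bochner_Integration.integrable_diff integrable_lborel_translate integrable_line_integral assms)

text \<open>A translation moves the difference onto the test function, where it becomes an integral
  of the derivative along the segment. After Fubini the weak identity is applied, for each
  \<open>s\<close>, to the test function shifted by \<open>s\<close>; this is why all shifted boxes
  must lie in \<open>\<Omega>\<close>.\<close>

lemma line_defect_orthogonal:
  fixes u v :: "real ^ 'n::finite \<Rightarrow> real"
  assumes u: "integrable lborel u" and v: "integrable lborel v"
    and w: "weak_partial \<Omega> j u v"
    and D: "\<And>i. bump_tower (a $ i) (b $ i) (D i)"
    and h: "0 \<le> h"
    and \<Omega>: "\<And>s. 0 \<le> s \<Longrightarrow> s \<le> h \<Longrightarrow> cbox (a + s *\<^sub>R axis j 1) (b + s *\<^sub>R axis j 1) \<subseteq> \<Omega>"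
  shows "(\<integral>x. line_defect j h u v x * tensor D (\<lambda>_. 0) x \<partial>lborel) = 0"
proof -
  let ?e = "axis j 1 :: real ^ 'n"
  define \<phi> where "\<phi> = tensor D (\<lambda>_. 0)"
  define \<psi> where "\<psi> = tensor D ((\<lambda>_. 0)(j := 1))"
  have T: "\<And>i. deriv_tower (D i)" using D by (simp add: bump_tower_def)
  have [measurable]: "u \<in> borel_measurable borel" "v \<in> borel_measurable borel"
    using u v by (simp_all add: borel_measurable_integrable)
  have [measurable]: "\<phi> \<in> borel_measurable borel" "\<psi> \<in> borel_measurable borel"
    unfolding \<phi>_def \<psi>_def by (intro borel_measurable_tensor T)+
  obtain C1 where C1: "\<And>x. \<bar>\<phi> x\<bar> \<le> C1"
    unfolding \<phi>_def using tensor_bounded[OF D] by metis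
  obtain C2 where C2: "\<And>x. \<bar>\<psi> x\<bar> \<le> C2"
    unfolding \<psi>_def using tensor_bounded[OF D] by metis
  have int_phi: "integrable lborel (\<lambda>x. f x * g x)"
    if "integrable lborel f" "g \<in> borel_measurable borel" "\<And>x. \<bar>g x\<bar> \<le> C" for f g :: "real ^ 'n \<Rightarrow> real" and C
  proof (rule Bochner_Integration.integrable_bound)
    show "integrable lborel (\<lambda>x. C * f x)" using that by simp
    show "(\<lambda>x. f x * g x) \<in> borel_measurable lborel"
      using that by (auto intro!: borel_measurable_times simp: borel_measurable_integrable)
    show "AE x in lborel. norm (f x * g x) \<le> norm (C * f x)"
      using order_trans[OF that(3) abs_ge_self] by (auto simp: abs_mult mult.commute[of C] abs_le_iff intro!: mult_left_mono)
  qed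
  have ftc: "\<phi> (x - h *\<^sub>R ?e) - \<phi> x = - (\<integral>s. indicator {0..h} s * \<psi> (x - s *\<^sub>R ?e) \<partial>lborel)" for x
  proof -
    have "(\<integral>s. - \<psi> (x - s *\<^sub>R ?e) * indicator {0..h} s \<partial>lborel) = \<phi> (x - h *\<^sub>R ?e) - \<phi> (x - 0 *\<^sub>R ?e)"
    proof (rule integral_FTC_Icc_real[OF h])
      fix s
      show "DERIV (\<lambda>s. \<phi> (x - s *\<^sub>R ?e)) s :> - \<psi> (x - s *\<^sub>R ?e)"
        using tensor_line_deriv[OF T, where e = "\<lambda>_. 0" and x = x and j = j and s = s] by (simp add: \<phi>_def \<psi>_def)
      have "continuous_on UNIV (\<lambda>s. \<psi> (x - s *\<^sub>R ?e))"
        unfolding \<psi>_def by (rule continuous_on_compose2[OF continuous_on_tensor[OF T]]) (auto intro!: continuous_intros)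
      then show "isCont (\<lambda>s. - \<psi> (x - s *\<^sub>R ?e)) s"
        by (simp add: continuous_on_eq_continuous_at)
    qed
    then show ?thesis by (simp add: mult.commute)
  qed
  have slice: "(\<integral>x. u x * \<psi> (x - s *\<^sub>R ?e) \<partial>lborel) = - (\<integral>x. v (x + s *\<^sub>R ?e) * \<phi> x \<partial>lborel)"
    if "0 \<le> s" "s \<le> h" for s
  proof -
    let ?D = "\<lambda>i n t. D i n (t - (if i = j then s else 0))"
    have "bump_tower ((a + s *\<^sub>R ?e) $ i) ((b + s *\<^sub>R ?e) $ i) (?D i)" for i
      using bump_tower_shift[OF D[of i], of "if i = j then s else 0"] by (cases "i = j") (simp_all add: axis_def)
    then have "(\<integral>x. u x * tensor ?D ((\<lambda>_. 0)(j := 1)) x \<partial>lborel) = - (\<integral>x. v x * tensor ?D (\<lambda>_. 0) x \<partial>lborel)"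
      by (rule w[unfolded weak_partial_def, rule_format]) (rule \<Omega>[OF that])
    then have "(\<integral>x. u x * \<psi> (x - s *\<^sub>R ?e) \<partial>lborel) = - (\<integral>x. v x * \<phi> (x - s *\<^sub>R ?e) \<partial>lborel)"
      by (simp add: tensor_shift \<phi>_def \<psi>_def)
    also have "(\<integral>x. v x * \<phi> (x - s *\<^sub>R ?e) \<partial>lborel) = (\<integral>x. v (x + s *\<^sub>R ?e) * \<phi> x \<partial>lborel)"
      by (subst integral_lborel_translate[symmetric, where c = "s *\<^sub>R ?e"]) auto
    finally show ?thesis .
  qed
  have I1: "integrable (lborel \<Otimes>\<^sub>M lborel) (\<lambda>(x, s). indicator {0..h} s * (u x * \<psi> (x - s *\<^sub>R ?e)))"
    using integrable_translate_pair[OF u, of "\<lambda>x s. \<psi> (x - s *\<^sub>R ?e)" h C2 0] C2 by simp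
  have I2: "integrable (lborel \<Otimes>\<^sub>M lborel) (\<lambda>(x, s). indicator {0..h} s * (v (x + s *\<^sub>R ?e) * \<phi> x))"
    using integrable_translate_pair[OF v, of "\<lambda>x s. \<phi> x" h C1 ?e] C1 by simp
  have "(\<integral>x. (u (x + h *\<^sub>R ?e) - u x) * \<phi> x \<partial>lborel)
      = (\<integral>x. u (x + h *\<^sub>R ?e) * \<phi> x \<partial>lborel) - (\<integral>x. u x * \<phi> x \<partial>lborel)"
    by (subst Bochner_Integration.integral_diff[symmetric])
      (auto simp: left_diff_distrib intro!: int_phi[where C = C1] C1 u integrable_lborel_translate)
  also have "(\<integral>x. u (x + h *\<^sub>R ?e) * \<phi> x \<partial>lborel) = (\<integral>x. u x * \<phi> (x - h *\<^sub>R ?e) \<partial>lborel)"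
    by (subst integral_lborel_translate[symmetric, where c = "h *\<^sub>R ?e"]) auto
  also have "(\<integral>x. u x * \<phi> (x - h *\<^sub>R ?e) \<partial>lborel) - (\<integral>x. u x * \<phi> x \<partial>lborel)
      = (\<integral>x. u x * (\<phi> (x - h *\<^sub>R ?e) - \<phi> x) \<partial>lborel)"
    by (subst Bochner_Integration.integral_diff[symmetric])
      (auto simp: right_diff_distrib intro!: int_phi[where C = C1] C1 u)
  also have "\<dots> = - (\<integral>x. (\<integral>s. indicator {0..h} s * (u x * \<psi> (x - s *\<^sub>R ?e)) \<partial>lborel) \<partial>lborel)"
    by (simp add: ftc mult.left_commute)
  also have "\<dots> = - (\<integral>s. (\<integral>x. indicator {0..h} s * (u x * \<psi> (x - s *\<^sub>R ?e)) \<partial>lborel) \<partial>lborel)"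
    by (subst lborel_pair.Fubini_integral[OF I1]) simp
  also have "\<dots> = (\<integral>s. (\<integral>x. indicator {0..h} s * (v (x + s *\<^sub>R ?e) * \<phi> x) \<partial>lborel) \<partial>lborel)"
    by (subst Bochner_Integration.integral_minus[symmetric], intro Bochner_Integration.integral_cong refl)
      (auto simp: slice indicator_def)
  also have "\<dots> = (\<integral>x. (\<integral>s. indicator {0..h} s * (v (x + s *\<^sub>R ?e) * \<phi> x) \<partial>lborel) \<partial>lborel)"
    by (rule lborel_pair.Fubini_integral[OF I2])
  also have "\<dots> = (\<integral>x. (\<integral>s. indicator {0..h} s * v (x + s *\<^sub>R ?e) \<partial>lborel) * \<phi> x \<partial>lborel)"
    by (simp flip: mult.assoc)
  finally have eq: "(\<integral>x. (u (x + h *\<^sub>R ?e) - u x) * \<phi> x \<partial>lborel)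
      = (\<integral>x. (\<integral>s. indicator {0..h} s * v (x + s *\<^sub>R ?e) \<partial>lborel) * \<phi> x \<partial>lborel)" .
  have "(\<integral>x. line_defect j h u v x * \<phi> x \<partial>lborel) = (\<integral>x. (u (x + h *\<^sub>R ?e) - u x) * \<phi> x \<partial>lborel)
      - (\<integral>x. (\<integral>s. indicator {0..h} s * v (x + s *\<^sub>R ?e) \<partial>lborel) * \<phi> x \<partial>lborel)"
    unfolding line_defect_def left_diff_distrib[of _ _ "\<phi> _"]
    by (intro Bochner_Integration.integral_diff)
      (auto simp flip: left_diff_distrib intro!: int_phi[where C = C1] C1 u v
        integrable_lborel_translate integrable_line_integral Bochner_Integration.integrable_diff)
  then show ?thesis
    using eq by (simp add: \<phi>_def)
qed

text \<open>Bumps with parameter \<open>1 / (m + 1)\<close> are bounded by 1 and converge to the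
  indicator of the open box, so dominated convergence carries the orthogonality over.\<close>

lemma line_defect_box_integral:
  fixes u v :: "real ^ 'n::finite \<Rightarrow> real"
  assumes u: "integrable lborel u" and v: "integrable lborel v"
    and w: "weak_partial \<Omega> j u v"
    and ab: "\<And>i. a $ i < b $ i"
    and h: "0 \<le> h"
    and \<Omega>: "\<And>s. 0 \<le> s \<Longrightarrow> s \<le> h \<Longrightarrow> cbox (a + s *\<^sub>R axis j 1) (b + s *\<^sub>R axis j 1) \<subseteq> \<Omega>"
  shows "(\<integral>x. line_defect j h u v x * indicator (box a b) x \<partial>lborel) = 0"
proof -
  let ?w = "line_defect j h u v"
  have W: "integrable lborel ?w" by (rule integrable_line_defect[OF u v])
  then have [measurable]: "?w \<in> borel_measurable borel" by (simp add: borel_measurable_integrable)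
  define \<rho> where "\<rho> m i t = (if t \<in> {a $ i<..<b $ i} then exp (- (1 / real (Suc m)) / ((t - a $ i) * (b $ i - t))) else 0)" for m i t
  have "\<exists>D. bump_tower (a $ i) (b $ i) D \<and> D 0 = \<rho> m i" for m i
    using bump_tower_exists[OF ab[of i], of "1 / real (Suc m)"] unfolding \<rho>_def by simp
  then have "\<forall>m. \<forall>i. \<exists>D. bump_tower (a $ i) (b $ i) D \<and> D 0 = \<rho> m i"
    by blast
  then obtain D where D: "\<And>m i. bump_tower (a $ i) (b $ i) (D m i)" "\<And>m i. D m i 0 = \<rho> m i"
    unfolding choice_iff by blast
  define \<phi> where "\<phi> m = tensor (D m) (\<lambda>_. 0)" for m
  have [measurable]: "\<phi> m \<in> borel_measurable borel" for m
    unfolding \<phi>_def using D(1)[of _ m] by (intro borel_measurable_tensor) (simp add: bump_tower_def)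
  have \<rho>: "0 \<le> \<rho> m i t \<and> \<rho> m i t \<le> 1" for m i t
    by (auto simp: \<rho>_def)
  have bd: "\<bar>\<phi> m x\<bar> \<le> 1" for m x
    using \<rho> by (auto simp: \<phi>_def tensor_def D abs_prod intro!: prod_le_1)
  have lim1: "(\<lambda>m. \<rho> m i t) \<longlonglongrightarrow> indicator {a $ i<..<b $ i} t" for i t
  proof (cases "t \<in> {a $ i<..<b $ i}")
    case True
    have "(\<lambda>m. exp (- (1 / real (Suc m)) / ((t - a $ i) * (b $ i - t)))) \<longlonglongrightarrow> exp (- 0 / ((t - a $ i) * (b $ i - t)))"
      by (intro tendsto_intros LIMSEQ_Suc[OF lim_1_over_n]) (use True in auto)
    then show ?thesis using True by (simp add: \<rho>_def)
  next
    case False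
    then have "(\<lambda>m. \<rho> m i t) = (\<lambda>_. 0)" by (auto simp: \<rho>_def)
    moreover have "indicat_real {a $ i<..<b $ i} t = 0" using False by (rule indicator_simps(2))
    ultimately show ?thesis by (simp only: tendsto_const)
  qed
  have lim: "(\<lambda>m. \<phi> m x) \<longlonglongrightarrow> indicator (box a b) x" for x
  proof -
    have "(\<lambda>m. \<Prod>i\<in>UNIV. \<rho> m i (x $ i)) \<longlonglongrightarrow> (\<Prod>i\<in>UNIV. indicator {a $ i<..<b $ i} (x $ i))"
      by (intro tendsto_prod lim1)
    moreover have "(\<Prod>i\<in>UNIV. indicator {a $ i<..<b $ i} (x $ i)) = (indicator (box a b) x :: real)"
      by (auto simp: indicator_def mem_box_cart prod_zero_iff)
    ultimately show ?thesis by (simp add: \<phi>_def tensor_def D)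
  qed
  have "(\<lambda>m. \<integral>x. ?w x * \<phi> m x \<partial>lborel) \<longlonglongrightarrow> (\<integral>x. ?w x * indicator (box a b) x \<partial>lborel)"
  proof (rule integral_dominated_convergence)
    show "integrable lborel (\<lambda>x. norm (?w x))" using W by simp
    show "AE x in lborel. (\<lambda>m. ?w x * \<phi> m x) \<longlonglongrightarrow> ?w x * indicator (box a b) x"
      by (intro AE_I2 tendsto_intros lim)
    show "AE x in lborel. norm (?w x * \<phi> m x) \<le> norm (?w x)" for m
      using bd[of m] by (auto simp: abs_mult intro!: mult_left_le)
  qed auto
  moreover have "(\<integral>x. ?w x * \<phi> m x \<partial>lborel) = 0" for m
    unfolding \<phi>_def by (rule line_defect_orthogonal[OF u v w D(1) h \<Omega>])
  ultimately show ?thesis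
    by (simp add: LIMSEQ_const_iff)
qed

text \<open>At a Lebesgue point the value is the limit of averages over small cubes, and all these
  averages vanish.\<close>

lemma AE_line_defect_eq_0:
  fixes u v :: "real ^ 'n::finite \<Rightarrow> real"
  assumes u: "integrable lborel u" and v: "integrable lborel v"
    and w: "weak_partial (box p q) j u v" and h: "0 \<le> h"
  shows "AE x in lborel. x \<in> box p q \<and> x + h *\<^sub>R axis j 1 \<in> box p q \<longrightarrow> line_defect j h u v x = 0"
proof -
  let ?w = "line_defect j h u v" and ?e = "axis j 1 :: real ^ 'n"
  have W: "integrable lborel ?w" by (rule integrable_line_defect[OF u v])
  then have [measurable]: "?w \<in> borel_measurable borel" by (simp add: borel_measurable_integrable)
  have si: "set_integrable lborel S ?w" if "S \<in> sets borel" for S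
    unfolding set_integrable_def using W that by (intro integrable_mult_indicator) auto
  have "?w integrable_on cbox a b" for a b
    using set_borel_integral_eq_integral(1)[OF si[of "cbox a b"]] by simp
  \<comment> \<open>Lebesgue differentiation along cubes that have \<open>x\<close> as their lowest
    corner.\<close>
  from integrable_ccontinuous_explicit[OF this] obtain N where N: "negligible N"
    "\<And>x e. \<lbrakk>x \<notin> N; 0 < e\<rbrakk> \<Longrightarrow> \<exists>d>0. \<forall>h. 0 < h \<and> h < d \<longrightarrow>
        norm (integral (cbox x (x + h *\<^sub>R One)) ?w /\<^sub>R h ^ DIM(real ^ 'n) - ?w x) < e"
    by blast
  have "?w x = 0" if "x \<notin> N" and x: "x \<in> box p q" "x + h *\<^sub>R ?e \<in> box p q" for x
  proof (rule ccontr)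
    assume "?w x \<noteq> 0"
    with N(2)[OF \<open>x \<notin> N\<close>, of "\<bar>?w x\<bar>"] obtain d where d: "d > 0"
      "\<And>\<delta>. 0 < \<delta> \<Longrightarrow> \<delta> < d \<Longrightarrow> norm (integral (cbox x (x + \<delta> *\<^sub>R One)) ?w /\<^sub>R \<delta> ^ DIM(real ^ 'n) - ?w x) < \<bar>?w x\<bar>"
      by auto
    have One: "(One :: real ^ 'n) $ i = 1" for i
      unfolding cart_eq_inner_axis by (simp add: axis_in_Basis_iff)
    \<comment> \<open>The distance from the far end of the segment to the upper faces of the box.
      The cubes grow from \<open>x\<close> upwards only, so a side below \<open>m\<close> keeps all
      their shifts along the segment inside the box.\<close>
    define m where "m = Min (range (\<lambda>i. q $ i - (x + h *\<^sub>R ?e) $ i))"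
    have m: "m \<le> q $ i - (x + h *\<^sub>R ?e) $ i" for i
      unfolding m_def by (intro Min_le) auto
    have "m > 0"
      unfolding m_def using x(2) by (subst Min_gr_iff) (auto simp: mem_box_cart)
    define \<delta> where "\<delta> = min m d / 2"
    have \<delta>: "0 < \<delta>" "\<delta> < d" "\<delta> < m"
      using \<open>m > 0\<close> \<open>d > 0\<close> by (auto simp: \<delta>_def)
    define b where "b = x + \<delta> *\<^sub>R One"
    have b: "b $ i = x $ i + \<delta>" for i
      unfolding b_def vector_add_component vector_scaleR_component One by simp
    have sub: "cbox (x + s *\<^sub>R ?e) (b + s *\<^sub>R ?e) \<subseteq> box p q" if s: "0 \<le> s" "s \<le> h" for s
    proof
      fix y assume y: "y \<in> cbox (x + s *\<^sub>R ?e) (b + s *\<^sub>R ?e)"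
      show "y \<in> box p q"
        unfolding mem_box_cart
      proof (intro allI conjI)
        fix i
        have "(x + s *\<^sub>R ?e) $ i \<le> y $ i" "y $ i \<le> (b + s *\<^sub>R ?e) $ i"
          using y by (auto simp: mem_box_cart)
        then show "p $ i < y $ i" "y $ i < q $ i"
          using x m[of i] \<delta> s b[of i] by (auto simp: mem_box_cart axis_def split: if_splits dest!: spec[of _ i])
      qed
    qed
    have "(\<integral>y. ?w y * indicator (box x b) y \<partial>lborel) = 0"
      using \<delta>(1) by (intro line_defect_box_integral[OF u v w _ h sub]) (simp add: b)
    then have "integral (box x b) ?w = 0"
      using set_borel_integral_eq_integral(2)[OF si[of "box x b"]]
      by (simp add: set_lebesgue_integral_def mult.commute)
    then have "integral (cbox x b) ?w = 0"
      by (simp add: integral_open_interval)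
    with d(2)[OF \<delta>(1,2)] b_def show False by simp
  qed
  then have "{x. \<not> (x \<in> box p q \<and> x + h *\<^sub>R ?e \<in> box p q \<longrightarrow> ?w x = 0)} \<subseteq> N"
    by blast
  then have "AE x in lebesgue. x \<in> box p q \<and> x + h *\<^sub>R ?e \<in> box p q \<longrightarrow> ?w x = 0"
    using N(1) by (auto simp: eventually_ae_filter negligible_iff_null_sets)
  then show ?thesis
    by (simp only: AE_completion_iff)
qed

section \<open>Poincare's inequality and iterated oscillation bounds\<close>

lemma AE_box_eq_cbox: "AE x in lborel. x \<in> cbox p q \<longrightarrow> x \<in> box p (q :: real ^ 'n::finite)"
proof -
  have "negligible (cbox p q - box p q)"
    by (rule negligible_frontier_interval)
  then have "AE x in lebesgue. x \<notin> cbox p q - box p q"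
    by (intro AE_not_in) (simp add: negligible_iff_null_sets)
  then have "AE x in lborel. x \<notin> cbox p q - box p q"
    by (simp only: AE_completion_iff)
  then show ?thesis by eventually_elim auto
qed

lemma nn_integral_difference_line_nonneg:
  fixes u v :: "real ^ 'n::finite \<Rightarrow> real"
  assumes u: "integrable lborel u" and v: "integrable lborel v"
    and w: "weak_partial \<Omega> j u v" and \<Omega>: "box p q \<subseteq> \<Omega>" and h: "0 \<le> h"
  shows "(\<integral>\<^sup>+x. indicator (cbox p q) x * indicator (cbox p q) (x + h *\<^sub>R axis j 1) * ennreal \<bar>u (x + h *\<^sub>R axis j 1) - u x\<bar> \<partial>lborel)
     \<le> ennreal h * (\<integral>\<^sup>+x. indicator (cbox p q) x * ennreal \<bar>v x\<bar> \<partial>lborel)"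
proof -
  let ?e = "axis j 1 :: real ^ 'n" and ?Q = "cbox p q"
  have [measurable]: "u \<in> borel_measurable borel" "v \<in> borel_measurable borel"
    using u v by (simp_all add: borel_measurable_integrable)
  have w': "weak_partial (box p q) j u v"
    using w \<Omega> unfolding weak_partial_def by blast
  \<comment> \<open>The box is convex, so the segment stays inside and the line integral sees
    \<open>v\<close> on the box only.\<close>
  have line: "x + s *\<^sub>R ?e \<in> ?Q" if "x \<in> ?Q" "x + h *\<^sub>R ?e \<in> ?Q" "0 \<le> s" "s \<le> h" for x s
    unfolding mem_box_cart
  proof
    fix i
    show "p $ i \<le> (x + s *\<^sub>R ?e) $ i \<and> (x + s *\<^sub>R ?e) $ i \<le> q $ i"
      using that by (auto simp: mem_box_cart axis_def split: if_splits dest!: spec[of _ i])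
  qed
  have "AE x in lborel. indicator ?Q x * indicator ?Q (x + h *\<^sub>R ?e) * ennreal \<bar>u (x + h *\<^sub>R ?e) - u x\<bar>
      \<le> (\<integral>\<^sup>+s. indicator {0..h} s * (indicator ?Q (x + s *\<^sub>R ?e) * ennreal \<bar>v (x + s *\<^sub>R ?e)\<bar>) \<partial>lborel)"
    using AE_box_eq_cbox[of p q] AE_lborel_translate[OF AE_box_eq_cbox[of p q], of "h *\<^sub>R ?e"]
      AE_line_defect_eq_0[OF u v w' h] integrable_line_integral(2)[OF v, of h j]
  proof eventually_elim
    case (elim x)
    show ?case
    proof (cases "x \<in> ?Q \<and> x + h *\<^sub>R ?e \<in> ?Q")
      case True
      with elim have "u (x + h *\<^sub>R ?e) - u x = (\<integral>s. indicator {0..h} s * v (x + s *\<^sub>R ?e) \<partial>lborel)"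
        by (simp add: line_defect_def)
      then have "ennreal \<bar>u (x + h *\<^sub>R ?e) - u x\<bar> \<le> (\<integral>\<^sup>+s. ennreal \<bar>indicator {0..h} s * v (x + s *\<^sub>R ?e)\<bar> \<partial>lborel)"
        using integral_norm_bound_ennreal[OF elim(4)] by simp
      also have "\<dots> = (\<integral>\<^sup>+s. indicator {0..h} s * (indicator ?Q (x + s *\<^sub>R ?e) * ennreal \<bar>v (x + s *\<^sub>R ?e)\<bar>) \<partial>lborel)"
        using True line by (intro nn_integral_cong) (auto simp: indicator_def)
      finally show ?thesis using True by simp
    qed auto
  qed
  then have "(\<integral>\<^sup>+x. indicator ?Q x * indicator ?Q (x + h *\<^sub>R ?e) * ennreal \<bar>u (x + h *\<^sub>R ?e) - u x\<bar> \<partial>lborel)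
      \<le> (\<integral>\<^sup>+x. (\<integral>\<^sup>+s. indicator {0..h} s * (indicator ?Q (x + s *\<^sub>R ?e) * ennreal \<bar>v (x + s *\<^sub>R ?e)\<bar>) \<partial>lborel) \<partial>lborel)"
    by (rule nn_integral_mono_AE)
  also have "\<dots> = (\<integral>\<^sup>+s. (\<integral>\<^sup>+x. indicator {0..h} s * (indicator ?Q (x + s *\<^sub>R ?e) * ennreal \<bar>v (x + s *\<^sub>R ?e)\<bar>) \<partial>lborel) \<partial>lborel)"
    by (subst lborel_pair.Fubini') auto
  also have "\<dots> = (\<integral>\<^sup>+s. indicator {0..h} s * (\<integral>\<^sup>+x. indicator ?Q x * ennreal \<bar>v x\<bar> \<partial>lborel) \<partial>lborel)"
    by (simp add: nn_integral_cmult nn_integral_lborel_translate[where f = "\<lambda>x. indicator ?Q x * ennreal \<bar>v x\<bar>"])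
  also have "\<dots> = (\<integral>\<^sup>+s. (\<integral>\<^sup>+x. indicator ?Q x * ennreal \<bar>v x\<bar> \<partial>lborel) * indicator {0..h} s \<partial>lborel)"
    by (simp only: mult.commute)
  also have "\<dots> = ennreal h * (\<integral>\<^sup>+x. indicator ?Q x * ennreal \<bar>v x\<bar> \<partial>lborel)"
    using h by (subst nn_integral_cmult_indicator) (auto simp: mult.commute)
  finally show ?thesis .
qed

text \<open>A negative \<open>h\<close> becomes positive after a translation by \<open>- h\<close>
  along the axis, which exchanges the two end points.\<close>

lemma nn_integral_difference_line:
  fixes u v :: "real ^ 'n::finite \<Rightarrow> real"
  assumes u: "integrable lborel u" and v: "integrable lborel v"
    and w: "weak_partial \<Omega> j u v" and \<Omega>: "box p q \<subseteq> \<Omega>"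
  shows "(\<integral>\<^sup>+x. indicator (cbox p q) x * indicator (cbox p q) (x + h *\<^sub>R axis j 1) * ennreal \<bar>u (x + h *\<^sub>R axis j 1) - u x\<bar> \<partial>lborel)
     \<le> ennreal \<bar>h\<bar> * (\<integral>\<^sup>+x. indicator (cbox p q) x * ennreal \<bar>v x\<bar> \<partial>lborel)"
proof (cases "0 \<le> h")
  case True
  then show ?thesis using nn_integral_difference_line_nonneg[OF assms True] by simp
next
  case False
  let ?e = "axis j 1 :: real ^ 'n" and ?Q = "cbox p q"
  have [measurable]: "u \<in> borel_measurable borel"
    using u by (simp_all add: borel_measurable_integrable)
  have "(\<integral>\<^sup>+x. indicator ?Q x * indicator ?Q (x + h *\<^sub>R ?e) * ennreal \<bar>u (x + h *\<^sub>R ?e) - u x\<bar> \<partial>lborel)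
     = (\<integral>\<^sup>+x. indicator ?Q (x + (- h) *\<^sub>R ?e) * indicator ?Q x * ennreal \<bar>u x - u (x + (- h) *\<^sub>R ?e)\<bar> \<partial>lborel)"
    by (subst nn_integral_lborel_translate[symmetric, where c = "(- h) *\<^sub>R ?e"]) auto
  also have "\<dots> = (\<integral>\<^sup>+x. indicator ?Q x * indicator ?Q (x + (- h) *\<^sub>R ?e) * ennreal \<bar>u (x + (- h) *\<^sub>R ?e) - u x\<bar> \<partial>lborel)"
    by (simp only: mult.commute abs_minus_commute)
  also have "\<dots> \<le> ennreal (- h) * (\<integral>\<^sup>+x. indicator ?Q x * ennreal \<bar>v x\<bar> \<partial>lborel)"
    by (rule nn_integral_difference_line_nonneg[OF assms]) (use False in simp)
  finally show ?thesis using False by simp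
qed

text \<open>The way from \<open>x\<close> to \<open>x + z\<close> is travelled one coordinate at a
  time. Translation invariance reduces every leg to a difference along one axis.\<close>

lemma nn_integral_difference:
  fixes u :: "real ^ 'n::finite \<Rightarrow> real" and v :: "'n \<Rightarrow> real ^ 'n \<Rightarrow> real"
  assumes u: "integrable lborel u" and v: "\<And>j. integrable lborel (v j)"
    and w: "\<And>j. weak_partial \<Omega> j u (v j)" and \<Omega>: "box p q \<subseteq> \<Omega>"
  shows "(\<integral>\<^sup>+x. indicator (cbox p q) x * indicator (cbox p q) (x + z) * ennreal \<bar>u (x + z) - u x\<bar> \<partial>lborel)
     \<le> (\<Sum>j\<in>UNIV. ennreal \<bar>z $ j\<bar> * (\<integral>\<^sup>+x. indicator (cbox p q) x * ennreal \<bar>v j x\<bar> \<partial>lborel))"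
proof -
  let ?Q = "cbox p q"
  have [measurable]: "u \<in> borel_measurable borel"
    using u by (simp_all add: borel_measurable_integrable)
  define zI where "zI I = (\<chi> i. if i \<in> I then z $ i else 0)" for I
  \<comment> \<open>Every coordinate of an intermediate point is that of \<open>x\<close> or that of
    the end point, so intermediate points stay in the box.\<close>
  have mid: "x + zI I \<in> ?Q" if "I \<subseteq> J" "x \<in> ?Q" "x + zI J \<in> ?Q" for I J x
    unfolding mem_box_cart
  proof
    fix i
    show "p $ i \<le> (x + zI I) $ i \<and> (x + zI I) $ i \<le> q $ i"
      using that by (auto simp: mem_box_cart zI_def split: if_splits dest!: spec[of _ i])
  qed
  have "(\<integral>\<^sup>+x. indicator ?Q x * indicator ?Q (x + zI I) * ennreal \<bar>u (x + zI I) - u x\<bar> \<partial>lborel)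
     \<le> (\<Sum>j\<in>I. ennreal \<bar>z $ j\<bar> * (\<integral>\<^sup>+x. indicator ?Q x * ennreal \<bar>v j x\<bar> \<partial>lborel))" for I
  proof (induction I rule: finite_induct[OF finite])
    case 1
    have "zI {} = 0" by (simp add: zI_def vec_eq_iff)
    then show ?case by simp
  next
    case (2 j I)
    let ?e = "z $ j *\<^sub>R axis j 1"
    have z: "zI (insert j I) = zI I + ?e"
      using 2 by (auto simp: zI_def vec_eq_iff axis_def)
    have "(\<integral>\<^sup>+x. indicator ?Q x * indicator ?Q (x + zI (insert j I)) * ennreal \<bar>u (x + zI (insert j I)) - u x\<bar> \<partial>lborel)
      \<le> (\<integral>\<^sup>+x. indicator ?Q (x + zI I) * indicator ?Q (x + zI I + ?e) * ennreal \<bar>u (x + zI I + ?e) - u (x + zI I)\<bar>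
            + indicator ?Q x * indicator ?Q (x + zI I) * ennreal \<bar>u (x + zI I) - u x\<bar> \<partial>lborel)"
    proof (rule nn_integral_mono)
      fix x
      have "x + zI I \<in> ?Q" if "x \<in> ?Q" "x + zI (insert j I) \<in> ?Q"
        using mid[OF _ that] by blast
      moreover have "ennreal \<bar>u (x + zI I + ?e) - u x\<bar> \<le> ennreal \<bar>u (x + zI I + ?e) - u (x + zI I)\<bar> + ennreal \<bar>u (x + zI I) - u x\<bar>"
        by (simp flip: ennreal_plus)
      ultimately show "indicator ?Q x * indicator ?Q (x + zI (insert j I)) * ennreal \<bar>u (x + zI (insert j I)) - u x\<bar>
          \<le> indicator ?Q (x + zI I) * indicator ?Q (x + zI I + ?e) * ennreal \<bar>u (x + zI I + ?e) - u (x + zI I)\<bar>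
            + indicator ?Q x * indicator ?Q (x + zI I) * ennreal \<bar>u (x + zI I) - u x\<bar>"
        by (auto simp: indicator_def z add.assoc)
    qed
    also have "\<dots> = (\<integral>\<^sup>+x. indicator ?Q (x + zI I) * indicator ?Q (x + zI I + ?e) * ennreal \<bar>u (x + zI I + ?e) - u (x + zI I)\<bar> \<partial>lborel)
        + (\<integral>\<^sup>+x. indicator ?Q x * indicator ?Q (x + zI I) * ennreal \<bar>u (x + zI I) - u x\<bar> \<partial>lborel)"
      by (rule nn_integral_add) auto
    also have "(\<integral>\<^sup>+x. indicator ?Q (x + zI I) * indicator ?Q (x + zI I + ?e) * ennreal \<bar>u (x + zI I + ?e) - u (x + zI I)\<bar> \<partial>lborel)
        = (\<integral>\<^sup>+x. indicator ?Q x * indicator ?Q (x + ?e) * ennreal \<bar>u (x + ?e) - u x\<bar> \<partial>lborel)"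
      by (rule nn_integral_lborel_translate) auto
    also have "\<dots> \<le> ennreal \<bar>z $ j\<bar> * (\<integral>\<^sup>+x. indicator ?Q x * ennreal \<bar>v j x\<bar> \<partial>lborel)"
      by (rule nn_integral_difference_line[OF u v w \<Omega>])
    also note 2(3)
    finally show ?case
      using 2 by (simp add: add_mono)
  qed
  from this[of UNIV] show ?thesis
    by (simp add: zI_def)
qed

text \<open>The deviation from the mean is at most the average of \<open>|u y - u x|\<close> over
  \<open>y\<close>. Substituting \<open>y = x + z\<close> and exchanging the integrals leaves the
  difference estimate for each \<open>z\<close>. The differences \<open>z\<close> of points of the
  cube fill a cube of side \<open>2 * l\<close>, so the constant is
  \<open>l * (2 * l) ^ d / l ^ d\<close>.\<close>

theorem Poincare_cube:
  fixes u :: "real ^ 'n::finite \<Rightarrow> real" and v :: "'n \<Rightarrow> real ^ 'n \<Rightarrow> real"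
  assumes u: "integrable lborel u" and v: "\<And>j. integrable lborel (v j)"
    and w: "\<And>j. weak_partial \<Omega> j u (v j)" and \<Omega>: "interior (cube a l) \<subseteq> \<Omega>" and l: "0 < l"
  defines "m \<equiv> (\<integral>x. indicator (cube a l) x * u x \<partial>lborel) / l ^ CARD('n)"
  shows "(\<integral>\<^sup>+x. indicator (cube a l) x * ennreal \<bar>u x - m\<bar> \<partial>lborel)
      \<le> ennreal (2 ^ CARD('n) * l) * (\<Sum>j\<in>UNIV. \<integral>\<^sup>+x. indicator (cube a l) x * ennreal \<bar>v j x\<bar> \<partial>lborel)"
proof -
  let ?Q = "cube a l" and ?V = "l ^ CARD('n)"
  let ?S = "\<Sum>j\<in>UNIV. \<integral>\<^sup>+x. indicator ?Q x * ennreal \<bar>v j x\<bar> \<partial>lborel"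
  have [measurable]: "u \<in> borel_measurable borel"
    using u by (simp_all add: borel_measurable_integrable)
  have V: "0 < ?V" using l by simp
  have iQ: "integrable lborel (\<lambda>x. indicator ?Q x * u x)" "integrable lborel (indicator ?Q :: _ \<Rightarrow> real)"
    using u emeasure_cube[of l a] l integrable_mult_indicator[of ?Q lborel u]
    by (auto intro!: integrable_real_indicator)
  have pt: "ennreal \<bar>u x - m\<bar> \<le> ennreal (1 / ?V) * (\<integral>\<^sup>+y. indicator ?Q y * ennreal \<bar>u y - u x\<bar> \<partial>lborel)" for x
  proof -
    have i: "integrable lborel (\<lambda>y. indicator ?Q y * (u y - u x))"
      using iQ by (simp add: right_diff_distrib)
    have "(\<integral>y. indicator ?Q y * (u y - u x) \<partial>lborel) = m * ?V - u x * ?V"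
    proof -
      have "(\<lambda>y. indicator ?Q y * (u y - u x)) = (\<lambda>y. indicator ?Q y * u y - u x * indicator ?Q y)"
        by (auto simp: algebra_simps)
      then have "(\<integral>y. indicator ?Q y * (u y - u x) \<partial>lborel)
          = (\<integral>y. indicator ?Q y * u y \<partial>lborel) - u x * measure lborel ?Q"
        using iQ by simp
      also have "\<dots> = m * ?V - u x * ?V"
        using V l by (simp add: m_def measure_cube)
      finally show ?thesis .
    qed
    then have "ennreal (\<bar>m - u x\<bar> * ?V) \<le> (\<integral>\<^sup>+y. ennreal \<bar>indicator ?Q y * (u y - u x)\<bar> \<partial>lborel)"
      using integral_norm_bound_ennreal[OF i] V by (simp add: abs_mult flip: left_diff_distrib)
    also have "\<dots> = (\<integral>\<^sup>+y. indicator ?Q y * ennreal \<bar>u y - u x\<bar> \<partial>lborel)"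
      by (intro nn_integral_cong) (auto simp: indicator_def)
    finally have "ennreal (1 / ?V) * ennreal (\<bar>m - u x\<bar> * ?V)
       \<le> ennreal (1 / ?V) * (\<integral>\<^sup>+y. indicator ?Q y * ennreal \<bar>u y - u x\<bar> \<partial>lborel)"
      by (rule mult_left_mono) simp
    then show ?thesis
      using V l by (simp add: abs_minus_commute flip: ennreal_mult)
  qed
  have "(\<integral>\<^sup>+x. indicator ?Q x * ennreal \<bar>u x - m\<bar> \<partial>lborel)
     \<le> (\<integral>\<^sup>+x. indicator ?Q x * (ennreal (1 / ?V) * (\<integral>\<^sup>+y. indicator ?Q y * ennreal \<bar>u y - u x\<bar> \<partial>lborel)) \<partial>lborel)"
    by (intro nn_integral_mono mult_left_mono pt) auto
  also have "\<dots> = ennreal (1 / ?V) * (\<integral>\<^sup>+x. (\<integral>\<^sup>+y. indicator ?Q x * (indicator ?Q y * ennreal \<bar>u y - u x\<bar>) \<partial>lborel) \<partial>lborel)"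
  proof -
    have "ennreal (1 / ?V) * (\<integral>\<^sup>+x. (\<integral>\<^sup>+y. indicator ?Q x * (indicator ?Q y * ennreal \<bar>u y - u x\<bar>) \<partial>lborel) \<partial>lborel)
        = (\<integral>\<^sup>+x. ennreal (1 / ?V) * (\<integral>\<^sup>+y. indicator ?Q x * (indicator ?Q y * ennreal \<bar>u y - u x\<bar>) \<partial>lborel) \<partial>lborel)"
      by (rule nn_integral_cmult[symmetric]) measurable
    then show ?thesis
      by (simp add: nn_integral_cmult mult.left_commute)
  qed
  also have "(\<integral>\<^sup>+x. (\<integral>\<^sup>+y. indicator ?Q x * (indicator ?Q y * ennreal \<bar>u y - u x\<bar>) \<partial>lborel) \<partial>lborel)
      = (\<integral>\<^sup>+x. (\<integral>\<^sup>+z. indicator ?Q x * (indicator ?Q (x + z) * ennreal \<bar>u (x + z) - u x\<bar>) \<partial>lborel) \<partial>lborel)"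
  proof (rule nn_integral_cong)
    fix x
    show "(\<integral>\<^sup>+y. indicator ?Q x * (indicator ?Q y * ennreal \<bar>u y - u x\<bar>) \<partial>lborel)
      = (\<integral>\<^sup>+z. indicator ?Q x * (indicator ?Q (x + z) * ennreal \<bar>u (x + z) - u x\<bar>) \<partial>lborel)"
      by (subst nn_integral_lborel_translate[symmetric, where c = x]) (auto simp: add.commute)
  qed
  also have "\<dots> = (\<integral>\<^sup>+z. (\<integral>\<^sup>+x. indicator ?Q x * (indicator ?Q (x + z) * ennreal \<bar>u (x + z) - u x\<bar>) \<partial>lborel) \<partial>lborel)"
    by (subst lborel_pair.Fubini') auto
  also have "\<dots> \<le> (\<integral>\<^sup>+z. (ennreal l * ?S) * indicator (cube ((\<chi> i. - l) :: real ^ 'n) (2 * l)) z \<partial>lborel)"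
  proof (rule nn_integral_mono)
    fix z
    show "(\<integral>\<^sup>+x. indicator ?Q x * (indicator ?Q (x + z) * ennreal \<bar>u (x + z) - u x\<bar>) \<partial>lborel)
       \<le> (ennreal l * ?S) * indicator (cube ((\<chi> i. - l) :: real ^ 'n) (2 * l)) z"
    proof (cases "z \<in> cube ((\<chi> i. - l) :: real ^ 'n) (2 * l)")
      case True
      then have z: "\<bar>z $ j\<bar> \<le> l" for j
        by (auto simp: cube_def mem_box_cart abs_le_iff dest!: spec[of _ j])
      have "(\<integral>\<^sup>+x. indicator ?Q x * (indicator ?Q (x + z) * ennreal \<bar>u (x + z) - u x\<bar>) \<partial>lborel)
         \<le> (\<Sum>j\<in>UNIV. ennreal \<bar>z $ j\<bar> * (\<integral>\<^sup>+x. indicator ?Q x * ennreal \<bar>v j x\<bar> \<partial>lborel))"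
        using nn_integral_difference[OF u v w, of a "\<chi> i. a $ i + l" z] \<Omega>
        by (simp add: cube_def interior_cbox mult.assoc)
      also have "\<dots> \<le> (\<Sum>j\<in>UNIV. ennreal l * (\<integral>\<^sup>+x. indicator ?Q x * ennreal \<bar>v j x\<bar> \<partial>lborel))"
        by (intro sum_mono mult_right_mono ennreal_leI z) auto
      finally show ?thesis using True by (simp add: sum_distrib_left)
    next
      case False
      have "x + z \<notin> ?Q" if "x \<in> ?Q" for x
      proof
        assume "x + z \<in> ?Q"
        with that have "-l \<le> z $ i \<and> z $ i \<le> l" for i
          by (auto simp: cube_def mem_box_cart dest!: spec[of _ i])
        with False show False
          by (simp add: cube_def mem_box_cart)
      qed
      then have "(\<lambda>x. indicator ?Q x * (indicator ?Q (x + z) * ennreal \<bar>u (x + z) - u x\<bar>)) = (\<lambda>x. 0)"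
        by (intro ext) (auto simp: indicator_def)
      then show ?thesis by simp
    qed
  qed
  also have "\<dots> = ennreal l * ?S * ennreal ((2 * l) ^ CARD('n))"
    using l by (subst nn_integral_cmult_indicator) (auto simp: emeasure_cube)
  finally have "(\<integral>\<^sup>+x. indicator ?Q x * ennreal \<bar>u x - m\<bar> \<partial>lborel)
     \<le> ennreal (1 / ?V) * (ennreal l * ?S * ennreal ((2 * l) ^ CARD('n)))"
    by (simp add: mult_left_mono)
  also have "\<dots> = ennreal ((1 / ?V) * (l * (2 * l) ^ CARD('n))) * ?S"
  proof -
    have "ennreal ((1 / ?V) * (l * (2 * l) ^ CARD('n))) = ennreal (1 / ?V) * (ennreal l * ennreal ((2 * l) ^ CARD('n)))"
      using l by (simp flip: ennreal_mult)
    then show ?thesis by (simp only: mult_ac)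
  qed
  also have "(1 / ?V) * (l * (2 * l) ^ CARD('n)) = 2 ^ CARD('n) * l"
    using l by (simp add: power_mult_distrib)
  finally show ?thesis .
qed

section \<open>Nested cubes and the doubling argument\<close>

lemma cube_subset_cube_iff:
  fixes a b :: "real ^ 'n::finite"
  assumes "0 \<le> l"
  shows "cube a l \<subseteq> cube b L \<longleftrightarrow> (\<forall>i. b $ i \<le> a $ i \<and> a $ i + l \<le> b $ i + L)"
  using assms by (simp add: cube_def subset_interval_cart)

lemma double_cube:
  fixes a c :: "real ^ 'n::finite"
  assumes "0 < l" "2 * l \<le> L" "cube c l \<subseteq> cube a L"
  obtains c' where "cube c l \<subseteq> cube c' (2 * l)" "cube c' (2 * l) \<subseteq> cube a L"
proof -
  \<comment> \<open>The doubled cube with lowest corner \<open>c\<close> may stick out of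
    \<open>cube a L\<close>; the minimum slides it back just far enough.\<close>
  define c' where "c' = (\<chi> i. min (c $ i) (a $ i + L - 2 * l))"
  have c: "a $ i \<le> c $ i" "c $ i + l \<le> a $ i + L" for i
    using assms by (auto simp: cube_subset_cube_iff)
  show ?thesis
  proof
    have c': "c' $ i \<le> c $ i \<and> c $ i \<le> c' $ i + l \<and> a $ i \<le> c' $ i \<and> c' $ i + 2 * l \<le> a $ i + L" for i
      using assms(1,2) c(1)[of i] c(2)[of i] unfolding c'_def by (simp add: min_def)
    then have "c' $ i \<le> c $ i \<and> c $ i + l \<le> c' $ i + 2 * l" for i
      using c'[of i] by linarith
    then show "cube c l \<subseteq> cube c' (2 * l)" "cube c' (2 * l) \<subseteq> cube a L"
      using assms(1) c' by (simp_all add: cube_subset_cube_iff)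
  qed
qed

abbreviation l1_on :: "(real ^ 'n::finite) set \<Rightarrow> (real ^ 'n \<Rightarrow> real) \<Rightarrow> ennreal" where
  "l1_on R u \<equiv> \<integral>\<^sup>+y. indicator R y * ennreal \<bar>u y\<bar> \<partial>lborel"

text \<open>The cubes \<open>R\<close> through \<open>x\<close> are doubled inside \<open>cube a L\<close> until their side exceeds \<open>L / 2\<close>.
  As \<open>1 \<le> m\<close>, each doubling halves the old bound, so the oscillations produced on the way
  sum up geometrically.\<close>

lemma mean_bound_by_doubling:
  fixes u :: "real ^ 'n::finite \<Rightarrow> real" and v :: "'n \<Rightarrow> real ^ 'n \<Rightarrow> real" and K N :: ennreal
  assumes u: "integrable lborel u" and v: "\<And>j. integrable lborel (v j)"
    and w: "\<And>j. weak_partial \<Omega> j u (v j)" and \<Omega>: "interior (cube a L) \<subseteq> \<Omega>"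
    and m: "1 \<le> m"
    and K: "\<And>c l. 0 < l \<Longrightarrow> x \<in> cube c l \<Longrightarrow> cube c l \<subseteq> cube a L \<Longrightarrow>
       ennreal (l ^ (m + 1)) * (\<Sum>j\<in>UNIV. l1_on (cube c l) (v j)) \<le> K * ennreal (l ^ CARD('n))"
    and N: "l1_on (cube a L) u \<le> N * ennreal (L ^ CARD('n))"
    and l: "0 < l" "x \<in> cube c l" "cube c l \<subseteq> cube a L"
  shows "ennreal (l ^ m) * l1_on (cube c l) u
     \<le> (ennreal (4 ^ CARD('n)) * K + ennreal (L ^ m * 2 ^ CARD('n)) * N) * ennreal (l ^ CARD('n))"
proof -
  let ?d = "CARD('n)"
  have [measurable]: "u \<in> borel_measurable borel"
    using u by (simp add: borel_measurable_integrable)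
  \<comment> \<open>Chosen to survive the recursion, in which twice the new bound is at most
    \<open>4 ^ d * K\<close> plus the old one: the first summand gives
    \<open>4 ^ d * K + B \<le> B + B\<close>. The second summand covers the cubes at which doubling
    stops; the volume of \<open>cube a L\<close> is at most \<open>2 ^ d\<close> times
    theirs.\<close>
  define B where "B = ennreal (4 ^ ?d) * K + ennreal (L ^ m * 2 ^ ?d) * N"
  have "ennreal (l ^ m) * l1_on (cube c l) u \<le> B * ennreal (l ^ ?d)"
    if "L / 2 ^ n \<le> l" "0 < l" "x \<in> cube c l" "cube c l \<subseteq> cube a L" for n l c
    using that
  proof (induction n arbitrary: l c)
    case (0 l c)
    then have "L \<le> l" by simp
    \<comment> \<open>\<open>undefined\<close> stands for an arbitrary coordinate; all sides of a
      cube are equal, so one coordinate decides.\<close>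
    have "l \<le> L"
      using 0 by (auto simp: cube_subset_cube_iff dest!: spec[of _ "undefined"])
    with \<open>L \<le> l\<close> have [simp]: "l = L" by simp
    have "ennreal (l ^ m) * l1_on (cube c l) u
       \<le> ennreal (l ^ m) * l1_on (cube a L) u"
      using 0 by (intro mult_left_mono nn_integral_mono mult_right_mono) (auto simp: indicator_def)
    also have "\<dots> \<le> ennreal (l ^ m) * (N * ennreal (L ^ ?d))"
      by (intro mult_left_mono N) auto
    also have "\<dots> = (ennreal (L ^ m) * N) * ennreal (l ^ ?d)"
      by (simp add: mult_ac)
    also have "\<dots> \<le> B * ennreal (l ^ ?d)"
    proof (intro mult_right_mono)
      have "L ^ m * 1 \<le> L ^ m * 2 ^ ?d"
        using 0 by (intro mult_left_mono one_le_power) auto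
      then have "ennreal (L ^ m) * N \<le> ennreal (L ^ m * 2 ^ ?d) * N"
        by (intro mult_right_mono ennreal_leI) auto
      then show "ennreal (L ^ m) * N \<le> B"
        unfolding B_def by (rule order_trans) simp
    qed simp
    finally show ?case .
  next
    case (Suc n l c)
    note l = \<open>0 < l\<close>
    show ?case
    proof (cases "2 * l \<le> L")
      case False
      have "L ^ ?d \<le> (2 * l) ^ ?d"
        using False l by (intro power_mono) (use Suc.prems in \<open>auto simp: cube_subset_cube_iff dest!: spec[of _ "undefined"]\<close>)
      then have Ld: "L ^ ?d \<le> 2 ^ ?d * l ^ ?d" by (simp add: power_mult_distrib)
      have "l \<le> L"
        using Suc.prems by (auto simp: cube_subset_cube_iff dest!: spec[of _ "undefined"])
      have "ennreal (l ^ m) * l1_on (cube c l) u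
         \<le> ennreal (L ^ m) * l1_on (cube a L) u"
        using Suc.prems \<open>l \<le> L\<close>
        by (intro mult_mono nn_integral_mono mult_right_mono ennreal_leI power_mono) (auto simp: indicator_def)
      also have "\<dots> \<le> ennreal (L ^ m) * (N * ennreal (2 ^ ?d * l ^ ?d))"
        using N Ld by (intro mult_left_mono order_trans[OF N] ennreal_leI) auto
      also have "\<dots> = (ennreal (L ^ m * 2 ^ ?d) * N) * ennreal (l ^ ?d)"
        using l \<open>l \<le> L\<close> by (simp add: ennreal_mult mult_ac)
      also have "\<dots> \<le> B * ennreal (l ^ ?d)"
        unfolding B_def by (intro mult_right_mono) auto
      finally show ?thesis .
    next
      case True
      obtain c' where c': "cube c l \<subseteq> cube c' (2 * l)" "cube c' (2 * l) \<subseteq> cube a L"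
        using double_cube[OF l True Suc.prems(4)] by blast
      let ?R = "cube c l" and ?R' = "cube c' (2 * l)"
      let ?I = "l1_on ?R u"
      let ?I' = "l1_on ?R' u"
      let ?V = "\<Sum>j\<in>UNIV. l1_on ?R' (v j)"
      \<comment> \<open>On \<open>?R\<close>, \<open>u\<close> is compared with its mean over the
        doubled cube. The deviation is paid for by Poincare's inequality. The mean contributes with
        the ratio \<open>1 / 2 ^ d\<close> of the volumes, which cancels against
        \<open>(2 * l) ^ d\<close> in the induction hypothesis.\<close>
      define \<mu> where "\<mu> = (\<integral>y. indicator ?R' y * u y \<partial>lborel) / (2 * l) ^ ?d"
      have x': "x \<in> ?R'" using c' Suc.prems by blast
      have IH: "ennreal ((2 * l) ^ m) * ?I' \<le> B * ennreal ((2 * l) ^ ?d)"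
        using Suc.prems c' x' by (intro Suc.IH) (auto simp: field_simps)
      have KR: "ennreal ((2 * l) ^ (m + 1)) * ?V \<le> K * ennreal ((2 * l) ^ ?d)"
        using l x' c' by (intro K) auto
      have P: "(\<integral>\<^sup>+y. indicator ?R' y * ennreal \<bar>u y - \<mu>\<bar> \<partial>lborel) \<le> ennreal (2 ^ ?d * (2 * l)) * ?V"
        unfolding \<mu>_def using l interior_mono[OF c'(2)] \<Omega>
        by (intro Poincare_cube[OF u v w]) auto
      have iR': "integrable lborel (\<lambda>y. indicator ?R' y * u y)"
        using integrable_mult_indicator[of ?R' lborel u] u by simp
      have mu: "ennreal \<bar>\<mu>\<bar> * ennreal (l ^ ?d) \<le> ennreal (1 / 2 ^ ?d) * ?I'"
      proof -
        have "\<bar>\<mu>\<bar> * l ^ ?d = (1 / 2 ^ ?d) * \<bar>\<integral>y. indicator ?R' y * u y \<partial>lborel\<bar>"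
          using l by (simp add: \<mu>_def abs_divide power_mult_distrib abs_mult)
        then have "ennreal \<bar>\<mu>\<bar> * ennreal (l ^ ?d) = ennreal (1 / 2 ^ ?d) * ennreal \<bar>\<integral>y. indicator ?R' y * u y \<partial>lborel\<bar>"
          using l by (simp flip: ennreal_mult)
        also have "\<dots> \<le> ennreal (1 / 2 ^ ?d) * (\<integral>\<^sup>+y. ennreal \<bar>indicator ?R' y * u y\<bar> \<partial>lborel)"
          using integral_norm_bound_ennreal[OF iR'] by (intro mult_left_mono) auto
        also have "(\<integral>\<^sup>+y. ennreal \<bar>indicator ?R' y * u y\<bar> \<partial>lborel) = ?I'"
          by (intro nn_integral_cong) (auto simp: indicator_def)
        finally show ?thesis .
      qed
      have "?I \<le> (\<integral>\<^sup>+y. indicator ?R' y * ennreal \<bar>u y - \<mu>\<bar> + ennreal \<bar>\<mu>\<bar> * indicator ?R y \<partial>lborel)"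
      proof (rule nn_integral_mono)
        fix y
        have "ennreal \<bar>u y\<bar> \<le> ennreal \<bar>u y - \<mu>\<bar> + ennreal \<bar>\<mu>\<bar>"
          by (simp flip: ennreal_plus)
        then show "indicator ?R y * ennreal \<bar>u y\<bar> \<le> indicator ?R' y * ennreal \<bar>u y - \<mu>\<bar> + ennreal \<bar>\<mu>\<bar> * indicator ?R y"
          using c'(1) by (auto simp: indicator_def)
      qed
      also have "\<dots> = (\<integral>\<^sup>+y. indicator ?R' y * ennreal \<bar>u y - \<mu>\<bar> \<partial>lborel) + (\<integral>\<^sup>+y. ennreal \<bar>\<mu>\<bar> * indicator ?R y \<partial>lborel)"
        by (intro nn_integral_add) auto
      also have "(\<integral>\<^sup>+y. ennreal \<bar>\<mu>\<bar> * indicator ?R y \<partial>lborel) = ennreal \<bar>\<mu>\<bar> * ennreal (l ^ ?d)"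
        using l by (subst nn_integral_cmult_indicator) (auto simp: emeasure_cube)
      also note P
      also note mu
      finally have I: "?I \<le> ennreal (2 ^ ?d * (2 * l)) * ?V + ennreal (1 / 2 ^ ?d) * ?I'"
        by (simp add: add_mono)
      have "ennreal 2 * (ennreal (l ^ m) * ?I) \<le> ennreal (2 ^ m) * (ennreal (l ^ m) * ?I)"
      proof (intro mult_right_mono ennreal_leI)
        show "2 \<le> (2::real) ^ m" using m self_le_power[of "2::real" m] by simp
      qed simp
      also have "\<dots> = ennreal ((2 * l) ^ m) * ?I"
        using l by (simp add: power_mult_distrib ennreal_mult mult.assoc)
      also have "\<dots> \<le> ennreal ((2 * l) ^ m) * (ennreal (2 ^ ?d * (2 * l)) * ?V + ennreal (1 / 2 ^ ?d) * ?I')"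
        by (intro mult_left_mono I) auto
      also have "\<dots> = ennreal (2 ^ ?d) * (ennreal ((2 * l) ^ (m + 1)) * ?V) + ennreal (1 / 2 ^ ?d) * (ennreal ((2 * l) ^ m) * ?I')"
        using l by (simp add: distrib_left ennreal_mult mult_ac)
      also have "\<dots> \<le> ennreal (2 ^ ?d) * (K * ennreal ((2 * l) ^ ?d)) + ennreal (1 / 2 ^ ?d) * (B * ennreal ((2 * l) ^ ?d))"
        by (intro add_mono mult_left_mono KR IH) auto
      also have "\<dots> = (ennreal (4 ^ ?d) * K + B) * ennreal (l ^ ?d)"
      proof -
        have "(4::real) ^ ?d = 2 ^ ?d * 2 ^ ?d" by (simp flip: power_mult_distrib)
        then have "ennreal (4 ^ ?d) * ennreal (l ^ ?d) = ennreal (2 ^ ?d) * ennreal ((2 * l) ^ ?d)"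
          using l by (simp add: power_mult_distrib flip: ennreal_mult)
        moreover have "ennreal (1 / 2 ^ ?d) * ennreal ((2 * l) ^ ?d) = ennreal (l ^ ?d)"
          using l by (simp add: power_mult_distrib flip: ennreal_mult)
        moreover have "(X * K + B) * Y = K * (X * Y) + B * Y" for X Y :: ennreal
          by (simp only: distrib_right) (simp only: mult_ac)
        ultimately have "(ennreal (4 ^ ?d) * K + B) * ennreal (l ^ ?d)
            = K * (ennreal (2 ^ ?d) * ennreal ((2 * l) ^ ?d)) + B * (ennreal (1 / 2 ^ ?d) * ennreal ((2 * l) ^ ?d))"
          by (simp only:)
        then show ?thesis by (simp only: mult_ac)
      qed
      also have "\<dots> \<le> (B + B) * ennreal (l ^ ?d)"
        by (intro mult_right_mono add_right_mono) (auto simp: B_def)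
      also have "\<dots> = ennreal 2 * (B * ennreal (l ^ ?d))"
        by (simp add: mult_2[symmetric] mult.assoc)
      finally show ?thesis
        by (simp add: ennreal_mult_le_mult_iff)
    qed
  qed
  moreover obtain n where "L / l \<le> 2 ^ n"
    using real_arch_pow[of 2 "L / l"] by (auto intro: less_imp_le)
  then have "L / 2 ^ n \<le> l"
    using l(1) by (simp add: field_simps)
  ultimately show ?thesis
    using l unfolding B_def by blast
qed

section \<open>Families of derivatives and descent in the order of differentiation\<close>

definition multi_modulus :: "(('n::finite \<Rightarrow> nat) \<Rightarrow> real ^ 'n \<Rightarrow> real) \<Rightarrow> nat \<Rightarrow> real ^ 'n \<Rightarrow> real" where
  "multi_modulus W m x = sqrt (\<Sum>\<alpha> | sum \<alpha> UNIV = m. (W \<alpha> x)\<^sup>2)"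

abbreviation modulus_on :: "(real ^ 'n::finite) set \<Rightarrow> (('n \<Rightarrow> nat) \<Rightarrow> real ^ 'n \<Rightarrow> real) \<Rightarrow> nat \<Rightarrow> ennreal" where
  "modulus_on R W m \<equiv> \<integral>\<^sup>+y. indicator R y * ennreal (multi_modulus W m y) \<partial>lborel"

text \<open>The least such \<open>K\<close> is the value at \<open>x\<close> of the fractional
  maximal function of order \<open>m\<close>, taken over the cubes inside \<open>cube a L\<close>.
  The volume is multiplied out to avoid dividing extended numbers.\<close>

abbreviation fractional_bound where
  "fractional_bound (a :: real ^ 'n::finite) L x W m K \<equiv>
     (\<forall>c l. 0 < l \<longrightarrow> x \<in> cube c l \<longrightarrow> cube c l \<subseteq> cube a L \<longrightarrow>
       ennreal (l ^ m) * modulus_on (cube c l) W m \<le> K * ennreal (l ^ CARD('n)))"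

text \<open>Order \<open>k\<close> is governed by \<open>fractional_bound\<close>. Order 0 is absent
  because only the oscillation of the function itself is estimated, and that is insensitive to
  adding constants.\<close>

abbreviation lower_order_bound where
  "lower_order_bound (a :: real ^ 'n::finite) L W k N \<equiv>
     (\<forall>m\<in>{1..<k}. modulus_on (cube a L) W m \<le> N * ennreal (L ^ CARD('n)))"

lemma finite_multi_indices: "finite {\<alpha> :: 'n::finite \<Rightarrow> nat. sum \<alpha> UNIV = m}"
proof (rule finite_subset)
  show "{\<alpha> :: 'n \<Rightarrow> nat. sum \<alpha> UNIV = m} \<subseteq> PiE UNIV (\<lambda>_. {..m})"
    using member_le_sum[of _ "UNIV :: 'n set"] by fastforce
qed (auto intro: finite_PiE)

lemma abs_le_multi_modulus:
  assumes "sum \<alpha> UNIV = m"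
  shows "\<bar>W \<alpha> x\<bar> \<le> multi_modulus W m x"
  unfolding multi_modulus_def
  using finite_multi_indices[of m] assms
    member_le_sum[of \<alpha> "{\<alpha>. sum \<alpha> UNIV = m}" "\<lambda>\<alpha>. (W \<alpha> x)\<^sup>2"]
  by (intro real_le_rsqrt) auto

lemma multi_modulus_le: "multi_modulus W m x \<le> (\<Sum>\<alpha> | sum \<alpha> UNIV = m. \<bar>W \<alpha> x\<bar>)"
  using L2_set_le_sum_abs[of "\<lambda>\<alpha>. W \<alpha> x"] by (simp add: multi_modulus_def L2_set_def)

lemma multi_modulus_nonneg [simp]: "0 \<le> multi_modulus W m x"
  by (simp add: multi_modulus_def sum_nonneg)

lemma borel_measurable_multi_modulus:
  assumes "\<And>\<alpha>. sum \<alpha> UNIV = m \<Longrightarrow> W \<alpha> \<in> borel_measurable borel"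
  shows "multi_modulus W m \<in> borel_measurable borel"
proof -
  have "(\<lambda>x. \<Sum>\<alpha> | sum \<alpha> UNIV = m. (W \<alpha> x)\<^sup>2) \<in> borel_measurable borel"
    by (intro borel_measurable_sum borel_measurable_power) (use assms in auto)
  then show ?thesis
    unfolding multi_modulus_def[abs_def] by measurable
qed

text \<open>Abstracts from \<open>weak_deriv\<close>, whose values are determined only up to null
  sets of the open cube, so that Borel representatives on the whole space can be used.\<close>

definition deriv_family :: "(real ^ 'n::finite) set \<Rightarrow> nat \<Rightarrow> (('n \<Rightarrow> nat) \<Rightarrow> real ^ 'n \<Rightarrow> real) \<Rightarrow> bool" where
  "deriv_family \<Omega> k W \<longleftrightarrow>
     (\<forall>\<alpha>. sum \<alpha> UNIV \<le> k \<longrightarrow> integrable lborel (W \<alpha>)) \<and>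
     (\<forall>\<alpha> j. sum \<alpha> UNIV < k \<longrightarrow> weak_partial \<Omega> j (W \<alpha>) (W (\<alpha>(j := Suc (\<alpha> j)))))"

lemma sum_nn_integral_next_le:
  fixes W :: "('n::finite \<Rightarrow> nat) \<Rightarrow> real ^ 'n \<Rightarrow> real"
  assumes "sum \<alpha> UNIV = m"
  shows "(\<Sum>j\<in>UNIV. l1_on R (W (\<alpha>(j := Suc (\<alpha> j)))))
    \<le> ennreal (real CARD('n)) * modulus_on R W (Suc m)"
proof -
  have "(\<Sum>j\<in>UNIV. l1_on R (W (\<alpha>(j := Suc (\<alpha> j)))))
    \<le> (\<Sum>j\<in>(UNIV :: 'n set). modulus_on R W (Suc m))"
    by (intro sum_mono nn_integral_mono mult_left_mono ennreal_leI abs_le_multi_modulus)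
      (use assms in \<open>auto simp del: fun_upd_apply simp: sum_fun_upd_Suc\<close>)
  then show ?thesis by (simp add: ennreal_of_nat_eq_real_of_nat)
qed

text \<open>Downward induction from \<open>m = k\<close>, where \<open>C = 1\<close> works. In each
  step the bound known for order \<open>m + 1\<close> serves as the \<open>K\<close> of
  \<open>mean_bound_by_doubling\<close>, which is applied to every derivative of order
  \<open>m\<close> separately. The constant is quantified before \<open>W\<close>, \<open>K\<close>,
  \<open>N\<close> and \<open>x\<close>.\<close>

lemma deriv_family_modulus_bound:
  fixes a :: "real ^ 'n::finite"
  assumes "0 < L" "interior (cube a L) \<subseteq> \<Omega>" "1 \<le> m" "m \<le> k"
  shows "\<exists>C\<ge>0. \<forall>W K N x. deriv_family \<Omega> k W \<longrightarrow>
    fractional_bound a L x W k K \<longrightarrow>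
    lower_order_bound a L W k N \<longrightarrow>
    fractional_bound a L x W m (ennreal C * (K + N))"
  using assms(4,3)
proof (induction m rule: inc_induct)
  case base
  show ?case
  proof (intro exI[of _ 1] conjI allI impI)
    fix W K N x c and l :: real
    assume "fractional_bound a L x W k K"
      and l: "0 < l" "x \<in> cube c l" "cube c l \<subseteq> cube a L"
    then have "ennreal (l ^ k) * modulus_on (cube c l) W k \<le> K * ennreal (l ^ CARD('n))"
      by blast
    also have "\<dots> \<le> ennreal 1 * (K + N) * ennreal (l ^ CARD('n))"
      by (intro mult_right_mono) auto
    finally show "ennreal (l ^ k) * modulus_on (cube c l) W k \<le> ennreal 1 * (K + N) * ennreal (l ^ CARD('n))" .
  qed simp
next
  case (step m)
  then have mk: "1 \<le> m" "m < k" by auto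
  obtain C where C: "0 \<le> C" and CB: "\<forall>W K N x. deriv_family \<Omega> k W \<longrightarrow>
    fractional_bound a L x W k K \<longrightarrow>
    lower_order_bound a L W k N \<longrightarrow>
    fractional_bound a L x W (Suc m) (ennreal C * (K + N))"
    using step.IH by auto
  let ?d = "CARD('n)" and ?M = "{\<alpha> :: 'n \<Rightarrow> nat. sum \<alpha> UNIV = m}"
  \<comment> \<open>The constants of \<open>mean_bound_by_doubling\<close>, with
    \<open>d * C\<close> in front of \<open>4 ^ d\<close> because each of the \<open>d\<close> next
    derivatives is bounded by the modulus of order \<open>m + 1\<close>.\<close>
  define D where "D = 4 ^ ?d * (?d * C) + L ^ m * 2 ^ ?d"
  have D: "0 \<le> D" using C assms(1) by (simp add: D_def)
  show ?case
  \<comment> \<open>The modulus is at most the sum of the absolute values of its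
    \<open>card ?M\<close> components.\<close>
  proof (intro exI[of _ "real (card ?M) * D"] conjI allI impI)
    show "0 \<le> real (card ?M) * D" using D by simp
    fix W K N x c and l :: real
    assume W: "deriv_family \<Omega> k W"
      and K: "fractional_bound a L x W k K"
      and N: "lower_order_bound a L W k N"
      and l: "0 < l" "x \<in> cube c l" "cube c l \<subseteq> cube a L"
    have next_le: "ennreal (l ^ Suc m) * modulus_on (cube c l) W (Suc m) \<le> ennreal C * (K + N) * ennreal (l ^ CARD('n))"
      if "0 < l" "x \<in> cube c l" "cube c l \<subseteq> cube a L" for c l
      using CB W K N that by blast
    have one: "ennreal (l ^ m) * l1_on (cube c l) (W \<alpha>) \<le> ennreal D * (K + N) * ennreal (l ^ ?d)"
      if \<alpha>: "\<alpha> \<in> ?M" for \<alpha>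
    proof -
      have "ennreal (l ^ m) * l1_on (cube c l) (W \<alpha>)
         \<le> (ennreal (4 ^ ?d) * (ennreal (?d * C) * (K + N)) + ennreal (L ^ m * 2 ^ ?d) * N) * ennreal (l ^ ?d)"
      proof (rule mean_bound_by_doubling[where v = "\<lambda>j. W (\<alpha>(j := Suc (\<alpha> j)))" and x = x and a = a and \<Omega> = \<Omega>])
        show "integrable lborel (W \<alpha>)" "integrable lborel (W (\<alpha>(j := Suc (\<alpha> j))))"
          "weak_partial \<Omega> j (W \<alpha>) (W (\<alpha>(j := Suc (\<alpha> j))))" for j
          using W \<alpha> mk by (auto simp: deriv_family_def sum_fun_upd_Suc simp del: fun_upd_apply)
        show "l1_on (cube a L) (W \<alpha>) \<le> N * ennreal (L ^ ?d)"
        proof (rule order_trans[OF _ N[rule_format, of m]])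
          show "l1_on (cube a L) (W \<alpha>)
             \<le> modulus_on (cube a L) W m"
            using \<alpha> by (intro nn_integral_mono mult_left_mono ennreal_leI abs_le_multi_modulus) auto
        qed (use mk in auto)
        fix c l assume cl: "0 < l" "x \<in> cube c l" "cube c l \<subseteq> cube a L"
        have "ennreal (l ^ (m + 1)) * (\<Sum>j\<in>UNIV. l1_on (cube c l) (W (\<alpha>(j := Suc (\<alpha> j)))))
          \<le> ennreal (l ^ Suc m) * (ennreal (real ?d) * modulus_on (cube c l) W (Suc m))"
          using sum_nn_integral_next_le[of \<alpha> m "cube c l" W] \<alpha> by (intro mult_mono) auto
        also have "\<dots> = ennreal (real ?d) * (ennreal (l ^ Suc m) * modulus_on (cube c l) W (Suc m))"
          by (simp only: mult_ac)
        also have "\<dots> \<le> ennreal (real ?d) * (ennreal C * (K + N) * ennreal (l ^ CARD('n)))"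
          by (intro mult_left_mono next_le cl) auto
        also have "\<dots> = ennreal (?d * C) * (K + N) * ennreal (l ^ ?d)"
          using C by (simp add: ennreal_mult mult.assoc)
        finally show "ennreal (l ^ (m + 1)) * (\<Sum>j\<in>UNIV. l1_on (cube c l) (W (\<alpha>(j := Suc (\<alpha> j)))))
          \<le> ennreal (?d * C) * (K + N) * ennreal (l ^ ?d)" .
      qed (use assms mk l in auto)
      also have "\<dots> \<le> (ennreal (4 ^ ?d * (?d * C)) * (K + N) + ennreal (L ^ m * 2 ^ ?d) * (K + N)) * ennreal (l ^ ?d)"
        using C by (intro mult_right_mono add_mono mult_left_mono) (auto simp: ennreal_mult mult.assoc)
      also have "\<dots> = ennreal D * (K + N) * ennreal (l ^ ?d)"
        using C assms(1) by (simp add: D_def distrib_right)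
      finally show ?thesis .
    qed
    have Wm: "W \<alpha> \<in> borel_measurable borel" if "\<alpha> \<in> ?M" for \<alpha>
      using W mk that by (auto simp: deriv_family_def intro: borel_measurable_integrable[of lborel, simplified])
    have "ennreal (l ^ m) * modulus_on (cube c l) W m
      \<le> ennreal (l ^ m) * (\<integral>\<^sup>+y. (\<Sum>\<alpha>\<in>?M. indicator (cube c l) y * ennreal \<bar>W \<alpha> y\<bar>) \<partial>lborel)"
    proof (intro mult_left_mono nn_integral_mono)
      fix y
      have "ennreal (multi_modulus W m y) \<le> (\<Sum>\<alpha>\<in>?M. ennreal \<bar>W \<alpha> y\<bar>)"
        using multi_modulus_le[of W m y] by (simp add: ennreal_leI)
      then show "indicator (cube c l) y * ennreal (multi_modulus W m y) \<le> (\<Sum>\<alpha>\<in>?M. indicator (cube c l) y * ennreal \<bar>W \<alpha> y\<bar>)"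
        unfolding sum_distrib_left[symmetric] by (rule mult_left_mono) simp
    qed simp
    also have "(\<integral>\<^sup>+y. (\<Sum>\<alpha>\<in>?M. indicator (cube c l) y * ennreal \<bar>W \<alpha> y\<bar>) \<partial>lborel)
       = (\<Sum>\<alpha>\<in>?M. l1_on (cube c l) (W \<alpha>))"
    proof (rule nn_integral_sum)
      fix \<alpha> assume "\<alpha> \<in> ?M"
      from Wm[OF this] have [measurable]: "W \<alpha> \<in> borel_measurable borel" .
      show "(\<lambda>y. indicator (cube c l) y * ennreal \<bar>W \<alpha> y\<bar>) \<in> borel_measurable lborel" by measurable
    qed
    also have "ennreal (l ^ m) * \<dots> \<le> (\<Sum>\<alpha>\<in>?M. ennreal D * (K + N) * ennreal (l ^ ?d))"
      unfolding sum_distrib_left by (intro sum_mono one)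
    also have "\<dots> = ennreal (real (card ?M) * D) * (K + N) * ennreal (l ^ ?d)"
      using D by (simp add: ennreal_mult ennreal_of_nat_eq_real_of_nat mult.assoc)
    finally show "ennreal (l ^ m) * modulus_on (cube c l) W m
      \<le> ennreal (real (card ?M) * D) * (K + N) * ennreal (l ^ ?d)" .
  qed
qed

text \<open>The descent stops at order 1. One more use of Poincare's inequality, on the same cube,
  bounds the oscillation by \<open>l\<close> times the integral of the gradient, which is the
  fractional quantity of order 1.\<close>

theorem deriv_family_oscillation_bound:
  fixes a :: "real ^ 'n::finite"
  assumes L: "0 < L" and \<Omega>: "interior (cube a L) \<subseteq> \<Omega>" and k: "1 \<le> k"
  shows "\<exists>C\<ge>0. \<forall>W K N x. deriv_family \<Omega> k W \<longrightarrow>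
    fractional_bound a L x W k K \<longrightarrow>
    lower_order_bound a L W k N \<longrightarrow>
    (\<forall>c l. 0 < l \<longrightarrow> x \<in> cube c l \<longrightarrow> cube c l \<subseteq> cube a L \<longrightarrow>
       (\<integral>\<^sup>+y. indicator (cube c l) y * ennreal \<bar>W (\<lambda>_. 0) y - (\<integral>y. indicator (cube c l) y * W (\<lambda>_. 0) y \<partial>lborel) / l ^ CARD('n)\<bar> \<partial>lborel)
         \<le> ennreal C * (K + N) * ennreal (l ^ CARD('n)))"
proof -
  let ?d = "CARD('n)"
  obtain C where C: "0 \<le> C" and CB: "\<forall>W K N x. deriv_family \<Omega> k W \<longrightarrow>
    fractional_bound a L x W k K \<longrightarrow>
    lower_order_bound a L W k N \<longrightarrow>
    fractional_bound a L x W 1 (ennreal C * (K + N))"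
    using deriv_family_modulus_bound[OF L \<Omega> order_refl k] by (elim exE conjE) (rule that)
  show ?thesis
  proof (intro exI[of _ "2 ^ ?d * ?d * C"] conjI allI impI)
    show "0 \<le> 2 ^ ?d * ?d * C" using C by simp
    fix W K N x c and l :: real
    assume W: "deriv_family \<Omega> k W"
      and K: "fractional_bound a L x W k K"
      and N: "lower_order_bound a L W k N"
      and l: "0 < l" "x \<in> cube c l" "cube c l \<subseteq> cube a L"
    have one: "ennreal l * modulus_on (cube c l) W 1 \<le> ennreal C * (K + N) * ennreal (l ^ ?d)"
      using CB W K N l unfolding power_one_right by blast
    let ?W0 = "W (\<lambda>_. 0)" and ?W1 = "\<lambda>j. W ((\<lambda>_. 0)(j := Suc 0))"
    have "(\<integral>\<^sup>+y. indicator (cube c l) y * ennreal \<bar>?W0 y - (\<integral>y. indicator (cube c l) y * ?W0 y \<partial>lborel) / l ^ ?d\<bar> \<partial>lborel)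
       \<le> ennreal (2 ^ ?d * l) * (\<Sum>j\<in>UNIV. l1_on (cube c l) (?W1 j))"
    proof (rule Poincare_cube[where \<Omega> = \<Omega>])
      have "sum ((\<lambda>_. 0)(j := Suc 0)) UNIV = (1::nat)" for j :: 'n
        using sum_fun_upd_Suc[of "\<lambda>_. 0" j] by simp
      then show "integrable lborel ?W0" "integrable lborel (?W1 j)" for j
        using W k by (auto simp: deriv_family_def simp del: fun_upd_apply)
      have "\<forall>j. weak_partial \<Omega> j ?W0 (W ((\<lambda>_. 0)(j := Suc ((\<lambda>_. 0) j))))"
        using W k unfolding deriv_family_def by (intro allI) (elim conjE allE[of _ "\<lambda>_. 0"], simp)
      then show "weak_partial \<Omega> j ?W0 (?W1 j)" for j by simp
      show "interior (cube c l) \<subseteq> \<Omega>"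
        using interior_mono[OF l(3)] \<Omega> by blast
    qed (rule l)
    also have "\<dots> \<le> ennreal (2 ^ ?d * l) * (ennreal (real ?d) * modulus_on (cube c l) W 1)"
      using sum_nn_integral_next_le[of "\<lambda>_. 0" 0 "cube c l" W] by (intro mult_left_mono) auto
    also have "\<dots> = ennreal (2 ^ ?d * ?d) * (ennreal l * modulus_on (cube c l) W 1)"
      using l by (simp add: ennreal_mult mult_ac)
    also have "\<dots> \<le> ennreal (2 ^ ?d * ?d) * (ennreal C * (K + N) * ennreal (l ^ ?d))"
      by (intro mult_left_mono one) auto
    also have "\<dots> = ennreal (2 ^ ?d * ?d * C) * (K + N) * ennreal (l ^ ?d)"
      using C by (simp add: ennreal_mult mult.assoc)
    finally show "(\<integral>\<^sup>+y. indicator (cube c l) y * ennreal \<bar>?W0 y - (\<integral>y. indicator (cube c l) y * ?W0 y \<partial>lborel) / l ^ ?d\<bar> \<partial>lborel)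
       \<le> ennreal (2 ^ ?d * ?d * C) * (K + N) * ennreal (l ^ ?d)" .
  qed
qed

section \<open>Weak type inequality and rearrangements\<close>

text \<open>Needed for Fubini with the completed measure as one factor.\<close>

lemma sigma_finite_lebesgue: "sigma_finite_measure (lebesgue :: 'a::euclidean_space measure)"
proof
  obtain A :: "nat \<Rightarrow> 'a set" where "range A \<subseteq> sets lborel" "(\<Union>i. A i) = space lborel"
      "\<And>i. emeasure lborel (A i) \<noteq> \<infinity>"
    using lborel.sigma_finite by metis
  then show "\<exists>A::'a set set. countable A \<and> A \<subseteq> sets lebesgue \<and> \<Union>A = space lebesgue \<and> (\<forall>a\<in>A. emeasure lebesgue a \<noteq> \<infinity>)"
    by (intro exI[of _ "range A"]) (auto simp: image_subset_iff)
qed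

text \<open>Together with the reverse comparison in \<open>cube_subset_cball\<close>, this makes the
  covering lemma for balls usable for cubes, at the cost of a dimensional factor.\<close>

lemma cball_subset_cube: "cball x r \<subseteq> cube (x - (\<chi> i. r)) (2 * r)" for x :: "real ^ 'n::finite"
proof
  fix y assume "y \<in> cball x r"
  then have "\<bar>x $ i - y $ i\<bar> \<le> r" for i
    using component_le_norm_cart[of "x - y" i] by (simp add: dist_norm)
  then show "y \<in> cube (x - (\<chi> i. r)) (2 * r)"
    by (auto simp: cube_def mem_box_cart abs_le_iff algebra_simps)
qed

lemma cube_subset_cball:
  fixes x :: "real ^ 'n::finite"
  assumes "x \<in> cube a l"
  shows "cube a l \<subseteq> cball x (real CARD('n) * l)"
proof
  fix y assume "y \<in> cube a l"
  with assms have "\<bar>(x - y) $ i\<bar> \<le> l" for i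
    by (auto simp: cube_def mem_box_cart abs_le_iff dest!: spec[of _ i])
  then have "(\<Sum>i\<in>UNIV. \<bar>(x - y) $ i\<bar>) \<le> real CARD('n) * l"
    by (rule sum_bounded_above)
  then show "y \<in> cball x (real CARD('n) * l)"
    using norm_le_l1_cart[of "x - y"] by (simp add: dist_norm)
qed

text \<open>Each chosen cube sits in a ball of radius \<open>d * l\<close> around its point.
  Vitali's lemma selects countably many disjoint balls whose fivefold dilations cover
  \<open>A\<close>, and a dilated ball lies in a cube of side \<open>10 * d * l\<close>; hence the
  constant. Measurability of \<open>A\<close> is not at hand, so the estimate is given for the cover
  \<open>B\<close>.\<close>

theorem cube_maximal_weak_type:
  fixes g :: "real ^ 'n::finite \<Rightarrow> ennreal"
  assumes g [measurable]: "g \<in> borel_measurable lebesgue" and Q: "Q \<in> sets lebesgue"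
    and A: "\<And>x. x \<in> A \<Longrightarrow> \<exists>a l. 0 < l \<and> l \<le> L \<and> x \<in> cube a l \<and> cube a l \<subseteq> Q \<and>
        c * ennreal (l ^ CARD('n)) \<le> (\<integral>\<^sup>+y\<in>cube a l. g y \<partial>lebesgue)"
  shows "\<exists>B\<in>sets lebesgue. A \<subseteq> B \<and>
      c * emeasure lebesgue B \<le> ennreal ((10 * real CARD('n)) ^ CARD('n)) * (\<integral>\<^sup>+y\<in>Q. g y \<partial>lebesgue)"
proof -
  let ?d = "real CARD('n)"
  note [measurable] = Q
  have "\<forall>x\<in>A. \<exists>p. 0 < snd p \<and> snd p \<le> L \<and> x \<in> cube (fst p) (snd p) \<and> cube (fst p) (snd p) \<subseteq> Q \<and>
      c * ennreal (snd p ^ CARD('n)) \<le> (\<integral>\<^sup>+y\<in>cube (fst p) (snd p). g y \<partial>lebesgue)"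
  proof
    fix x assume "x \<in> A"
    then obtain a l where "0 < l \<and> l \<le> L \<and> x \<in> cube a l \<and> cube a l \<subseteq> Q \<and>
        c * ennreal (l ^ CARD('n)) \<le> (\<integral>\<^sup>+y\<in>cube a l. g y \<partial>lebesgue)"
      using A by blast
    then show "\<exists>p. 0 < snd p \<and> snd p \<le> L \<and> x \<in> cube (fst p) (snd p) \<and> cube (fst p) (snd p) \<subseteq> Q \<and>
      c * ennreal (snd p ^ CARD('n)) \<le> (\<integral>\<^sup>+y\<in>cube (fst p) (snd p). g y \<partial>lebesgue)"
      by (intro exI[of _ "(a, l)"]) simp
  qed
  then obtain p where p: "\<And>x. x \<in> A \<Longrightarrow> 0 < snd (p x) \<and> snd (p x) \<le> L \<and> x \<in> cube (fst (p x)) (snd (p x)) \<and>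
      cube (fst (p x)) (snd (p x)) \<subseteq> Q \<and>
      c * ennreal (snd (p x) ^ CARD('n)) \<le> (\<integral>\<^sup>+y\<in>cube (fst (p x)) (snd (p x)). g y \<partial>lebesgue)"
    unfolding bchoice_iff by blast
  define l where "l x = snd (p x)" for x
  define R where "R x = cube (fst (p x)) (l x)" for x
  have l: "0 < l x" "l x \<le> L" and R: "x \<in> R x" "R x \<subseteq> Q"
    and big: "c * ennreal (l x ^ CARD('n)) \<le> (\<integral>\<^sup>+y\<in>R x. g y \<partial>lebesgue)" if "x \<in> A" for x
    using p[OF that] by (auto simp: l_def R_def)
  define r where "r x = ?d * l x" for x
  have r: "0 < r x \<and> r x \<le> ?d * L" if "x \<in> A" for x
    using l[OF that] by (auto simp: r_def)
  have sub: "A \<subseteq> (\<Union>x\<in>A. cball x (r x))"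
    using r by force
  obtain C where C: "countable C" "C \<subseteq> A"
     "pairwise (\<lambda>i j. disjnt (cball i (r i)) (cball j (r j))) C"
     "A \<subseteq> (\<Union>x\<in>C. cball x (5 * r x))"
    by (rule Vitali_covering_lemma_cballs[OF sub r]) (auto intro: that)
  have Rsub: "R x \<subseteq> cball x (r x)" if "x \<in> A" for x
    using cube_subset_cball R(1)[OF that] by (auto simp: R_def r_def)
  have Rm [measurable]: "R x \<in> sets lebesgue" for x
    by (simp add: R_def)
  let ?B = "\<Union>x\<in>C. cball x (5 * r x)"
  let ?c = "(10 * ?d) ^ CARD('n)"
  have "emeasure lebesgue ?B = (\<integral>\<^sup>+y. indicator ?B y \<partial>lebesgue)"
    using C(1) by (intro nn_integral_indicator[symmetric] sets.countable_UN') auto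
  \<comment> \<open>Sums over the countable set \<open>C\<close> are written as integrals over
    \<open>count_space C\<close>, so that they can be exchanged with the Lebesgue integral.\<close>
  also have "\<dots> \<le> (\<integral>\<^sup>+y. (\<integral>\<^sup>+x. indicator (cball x (5 * r x)) y \<partial>count_space C) \<partial>lebesgue)"
  proof (rule nn_integral_mono)
    fix y
    show "indicator ?B y \<le> (\<integral>\<^sup>+x. indicator (cball x (5 * r x)) y \<partial>count_space C)"
    proof (cases "y \<in> ?B")
      case True
      then obtain x where x: "x \<in> C" "y \<in> cball x (5 * r x)" by blast
      then have "indicator ?B y = (indicator (cball x (5 * r x)) y :: ennreal)"
        by (auto simp: indicator_def)
      also have "\<dots> \<le> (\<integral>\<^sup>+x. indicator (cball x (5 * r x)) y \<partial>count_space C)"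
        using nn_integral_ge_point[OF x(1), of "\<lambda>x. indicator (cball x (5 * r x)) y"] .
      finally show ?thesis .
    qed simp
  qed
  also have "\<dots> = (\<integral>\<^sup>+x. emeasure lebesgue (cball x (5 * r x)) \<partial>count_space C)"
    by (subst nn_integral_count_space_nn_integral[OF C(1)]) (auto intro!: borel_measurable_indicator)
  also have "\<dots> \<le> (\<integral>\<^sup>+x. ennreal ?c * ennreal (l x ^ CARD('n)) \<partial>count_space C)"
  proof (rule nn_integral_mono)
    fix x assume "x \<in> space (count_space C)"
    then have lx: "0 < l x" using C(2) l by auto
    have "emeasure lebesgue (cball x (5 * r x)) \<le> emeasure lebesgue (cube (x - (\<chi> i. 5 * r x)) (2 * (5 * r x)))"
      by (intro emeasure_mono cball_subset_cube) auto
    also have "\<dots> = ennreal ((2 * (5 * r x)) ^ CARD('n))"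
      using lx by (simp add: emeasure_cube r_def)
    also have "(2 * (5 * r x)) ^ CARD('n) = ?c * l x ^ CARD('n)"
    proof -
      have "2 * (5 * r x) = 10 * ?d * l x" by (simp add: r_def)
      then show ?thesis by (simp only: power_mult_distrib)
    qed
    finally show "emeasure lebesgue (cball x (5 * r x)) \<le> ennreal ?c * ennreal (l x ^ CARD('n))"
      using lx by (simp add: ennreal_mult)
  qed
  also have "\<dots> = ennreal ?c * (\<integral>\<^sup>+x. ennreal (l x ^ CARD('n)) \<partial>count_space C)"
    by (rule nn_integral_cmult) auto
  finally have "c * emeasure lebesgue ?B \<le> c * (ennreal ?c * (\<integral>\<^sup>+x. ennreal (l x ^ CARD('n)) \<partial>count_space C))"
    by (rule mult_left_mono) simp
  also have "\<dots> = ennreal ?c * (\<integral>\<^sup>+x. c * ennreal (l x ^ CARD('n)) \<partial>count_space C)"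
    by (simp add: nn_integral_cmult mult.left_commute)
  also have "(\<integral>\<^sup>+x. c * ennreal (l x ^ CARD('n)) \<partial>count_space C)
      \<le> (\<integral>\<^sup>+x. (\<integral>\<^sup>+y. g y * indicator (R x) y \<partial>lebesgue) \<partial>count_space C)"
    using C(2) by (intro nn_integral_mono big) auto
  also have "\<dots> = (\<integral>\<^sup>+y. (\<integral>\<^sup>+x. g y * indicator (R x) y \<partial>count_space C) \<partial>lebesgue)"
    by (rule nn_integral_count_space_nn_integral[OF C(1), symmetric]) auto
  \<comment> \<open>The selected balls are disjoint, so each \<open>y\<close> lies in at most one of
    the selected cubes.\<close>
  also have "\<dots> \<le> (\<integral>\<^sup>+y. g y * indicator Q y \<partial>lebesgue)"
  proof (rule nn_integral_mono)
    fix y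
    show "(\<integral>\<^sup>+x. g y * indicator (R x) y \<partial>count_space C) \<le> g y * indicator Q y"
    proof (cases "\<exists>x\<in>C. y \<in> R x")
      case True
      then obtain x where x: "x \<in> C" "y \<in> R x" by blast
      have "y \<notin> R x'" if "x' \<in> C" "x' \<noteq> x" for x'
      proof
        assume "y \<in> R x'"
        then have "y \<in> cball x (r x) \<inter> cball x' (r x')"
          using Rsub x that C(2) by blast
        then show False
          using C(3) x(1) that unfolding pairwise_def disjnt_def by blast
      qed
      then have "(\<integral>\<^sup>+x. g y * indicator (R x) y \<partial>count_space C) = (\<Sum>x'\<in>{x}. g y * indicator (R x') y)"
        using x by (intro nn_integral_count_space') auto
      also have "\<dots> \<le> g y * indicator Q y"
        using x R(2) C(2) by (auto simp: indicator_def)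
      finally show ?thesis .
    next
      case False
      then have "(\<integral>\<^sup>+x. g y * indicator (R x) y \<partial>count_space C) = (\<integral>\<^sup>+x. 0 \<partial>count_space C)"
        by (intro nn_integral_cong) auto
      then show ?thesis by simp
    qed
  qed
  finally have "c * emeasure lebesgue ?B \<le> ennreal ?c * (\<integral>\<^sup>+y\<in>Q. g y \<partial>lebesgue)"
    by (simp add: mult_left_mono)
  moreover have "?B \<in> sets lebesgue"
    using C(1) by (intro sets.countable_UN') auto
  ultimately show ?thesis using C(4) by blast
qed

section \<open>Decreasing rearrangements\<close>

lemma rearr_antimono: "s \<le> t \<Longrightarrow> rearr Q g t \<le> rearr Q g s"
  unfolding rearr_def by (intro INF_superset_mono) (auto intro: order_trans[OF _ ennreal_leI])

lemma borel_measurable_antimono_ennreal: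
  fixes f :: "real \<Rightarrow> ennreal"
  assumes "\<And>s t. s \<le> t \<Longrightarrow> f t \<le> f s"
  shows "f \<in> borel_measurable borel"
proof (rule borel_measurableI_greater)
  fix c
  have "is_interval {x. c < f x}"
    unfolding is_interval_1 using assms by (auto intro: less_le_trans)
  then show "{x \<in> space borel. c < f x} \<in> sets borel"
    using real_interval_borel_measurable by auto
qed

lemma borel_measurable_rearr [measurable]: "rearr Q g \<in> borel_measurable borel"
  by (rule borel_measurable_antimono_ennreal) (rule rearr_antimono)

text \<open>Any level \<open>c + 1 / (n + 1)\<close> above the infimum \<open>c\<close> has a
  superlevel set of measure at most \<open>t\<close>. These sets increase to the superlevel set at
  \<open>c\<close>, and continuity of the measure transfers the bound.\<close>

lemma emeasure_superlevel_rearr: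
  fixes g :: "real ^ 'n::finite \<Rightarrow> ennreal"
  assumes [measurable]: "g \<in> borel_measurable lebesgue" "Q \<in> sets lebesgue"
  shows "emeasure lebesgue {x \<in> Q. rearr Q g t < g x} \<le> ennreal t"
proof (cases "rearr Q g t")
  case (real c)
  note c = real
  define S where "S n = {x \<in> Q. ennreal (c + 1 / real (Suc n)) < g x}" for n
  have [measurable]: "S n \<in> sets lebesgue" for n
    unfolding S_def using pred_sets2 by measurable
  have "{x \<in> Q. rearr Q g t < g x} = (\<Union>n. S n)"
  proof (intro equalityI subsetI)
    fix x assume x: "x \<in> {x \<in> Q. rearr Q g t < g x}"
    show "x \<in> (\<Union>n. S n)"
    proof (cases "g x")
      case (real y)
      with x \<open>rearr Q g t = ennreal c\<close> have "c < y" by (simp add: ennreal_less_iff \<open>0 \<le> c\<close>)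
      then obtain n where "1 / real (Suc n) < y - c"
        using nat_approx_posE[of "y - c"] by auto
      then have "c + 1 / real (Suc n) < y" by simp
      then have "x \<in> S n"
        using x real \<open>0 \<le> c\<close> by (simp add: S_def ennreal_less_iff del: of_nat_Suc ennreal_plus)
      then show ?thesis by blast
    next
      case top
      then show ?thesis using x by (auto simp: S_def)
    qed
  next
    fix x assume "x \<in> (\<Union>n. S n)"
    then obtain n where x: "x \<in> Q" "ennreal (c + 1 / real (Suc n)) < g x" by (auto simp: S_def)
    have "ennreal c \<le> ennreal (c + 1 / real (Suc n))"
      by (intro ennreal_leI) simp
    from le_less_trans[OF this x(2)] show "x \<in> {x \<in> Q. rearr Q g t < g x}"
      using c x(1) by simp
  qed
  moreover have "emeasure lebesgue (\<Union>n. S n) = (SUP n. emeasure lebesgue (S n))"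
  proof (rule SUP_emeasure_incseq[symmetric])
    show "range S \<subseteq> sets lebesgue" by auto
    show "incseq S"
    proof (rule incseq_SucI)
      fix n
      have "ennreal (c + 1 / real (Suc (Suc n))) \<le> ennreal (c + 1 / real (Suc n))"
        by (intro ennreal_leI add_left_mono divide_left_mono) auto
      then show "S n \<subseteq> S (Suc n)"
        by (auto simp: S_def intro: le_less_trans)
    qed
  qed
  moreover have "emeasure lebesgue (S n) \<le> ennreal t" for n
  proof -
    have "rearr Q g t < ennreal (c + 1 / real (Suc n))"
      using real by (simp add: ennreal_less_iff del: of_nat_Suc ennreal_plus)
    then obtain u where u: "0 \<le> u" "emeasure lebesgue {x \<in> Q. g x > ennreal u} \<le> ennreal t"
        "ennreal u < ennreal (c + 1 / real (Suc n))"
      unfolding rearr_def by (auto simp: INF_less_iff)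
    then have "S n \<subseteq> {x \<in> Q. g x > ennreal u}"
      by (auto simp: S_def)
    moreover have "{x \<in> Q. g x > ennreal u} \<in> sets lebesgue" by measurable
    ultimately show ?thesis
      using u(2) by (meson emeasure_mono order_trans)
  qed
  ultimately show ?thesis by (simp add: SUP_le_iff)
next
  case top
  then show ?thesis by simp
qed

text \<open>Layer cake on both sides. At height \<open>\<kappa>\<close> the part of \<open>E\<close>
  above the level has measure at most the minimum of \<open>t\<close> and
  \<open>\<mu> \<kappa>\<close>, and this minimum is the length of the set of those \<open>s\<close>
  in \<open>(0, t)\<close> with \<open>s < \<mu> \<kappa>\<close>. After exchanging the integrals,
  \<open>s < \<mu> \<kappa>\<close> forces \<open>\<kappa> \<le> rearr Q g s\<close>.\<close>

theorem nn_integral_le_rearr: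
  fixes g :: "real ^ 'n::finite \<Rightarrow> ennreal"
  assumes [measurable]: "g \<in> borel_measurable lebesgue" "E \<in> sets lebesgue" "Q \<in> sets lebesgue"
    and E: "E \<subseteq> Q" "emeasure lebesgue E \<le> ennreal t"
  shows "(\<integral>\<^sup>+x\<in>E. g x \<partial>lebesgue) \<le> (\<integral>\<^sup>+s\<in>{0<..<t}. rearr Q g s \<partial>lborel)"
proof -
  interpret L: sigma_finite_measure "lebesgue :: (real ^ 'n) measure" by (rule sigma_finite_lebesgue)
  interpret P: pair_sigma_finite "lebesgue :: (real ^ 'n) measure" "lborel :: real measure" ..
  define \<mu> where "\<mu> \<kappa> = emeasure lebesgue {x \<in> Q. g x > ennreal \<kappa>}" for \<kappa>
  have [measurable]: "\<mu> \<in> borel_measurable borel"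
  proof (rule borel_measurable_antimono_ennreal)
    fix s t :: real assume "s \<le> t"
    then have "{x \<in> Q. g x > ennreal t} \<subseteq> {x \<in> Q. g x > ennreal s}"
      by (auto intro: le_less_trans[OF ennreal_leI])
    moreover have "{x \<in> Q. g x > ennreal s} \<in> sets lebesgue" by measurable
    ultimately show "\<mu> t \<le> \<mu> s"
      unfolding \<mu>_def by (rule emeasure_mono)
  qed
  \<comment> \<open>An extended number is the length of the interval of levels below it. This is
    used for the values of \<open>g\<close> and again for measures.\<close>
  have level: "y = (\<integral>\<^sup>+\<kappa>. (if 0 \<le> \<kappa> \<and> ennreal \<kappa> < y then 1 else 0) \<partial>lborel)" for y :: ennreal
  proof (cases y)
    case (real c)
    have "(\<integral>\<^sup>+\<kappa>. (if 0 \<le> \<kappa> \<and> ennreal \<kappa> < y then 1 else 0) \<partial>lborel) = (\<integral>\<^sup>+\<kappa>. indicator {0..<c} \<kappa> \<partial>lborel)"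
      using real by (intro nn_integral_cong) (auto simp: indicator_def ennreal_less_iff)
    then show ?thesis using real by simp
  next
    case top
    have "(\<integral>\<^sup>+\<kappa>. (if 0 \<le> \<kappa> \<and> ennreal \<kappa> < y then 1 else 0) \<partial>lborel) = (\<integral>\<^sup>+\<kappa>. indicator {0::real..} \<kappa> \<partial>lborel)"
      using top by (intro nn_integral_cong) (auto simp: indicator_def)
    also have "\<dots> = \<infinity>"
    proof -
      have "emeasure lborel {0::real..} = \<infinity>"
      proof (rule ccontr)
        assume "emeasure lborel {0::real..} \<noteq> \<infinity>"
        then obtain r where r: "0 \<le> r" "emeasure lborel {0::real..} = ennreal r"
          by (cases "emeasure lborel {0::real..}") auto
        have "emeasure lborel {0..r + 1} \<le> emeasure lborel {0::real..}"
          by (intro emeasure_mono) auto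
        with r show False by (simp del: ennreal_plus)
      qed
      then show ?thesis by simp
    qed
    finally show ?thesis using top by simp
  qed
  have "(\<integral>\<^sup>+x\<in>E. g x \<partial>lebesgue) = (\<integral>\<^sup>+x. (\<integral>\<^sup>+\<kappa>. (if 0 \<le> \<kappa> \<and> ennreal \<kappa> < g x then 1 else 0) * indicator E x \<partial>lborel) \<partial>lebesgue)"
    by (subst nn_integral_multc) (auto simp: level[symmetric])
  also have "\<dots> = (\<integral>\<^sup>+\<kappa>. (\<integral>\<^sup>+x. (if 0 \<le> \<kappa> \<and> ennreal \<kappa> < g x then 1 else 0) * indicator E x \<partial>lebesgue) \<partial>lborel)"
    by (subst P.Fubini') auto
  also have "\<dots> \<le> (\<integral>\<^sup>+\<kappa>. (\<integral>\<^sup>+s. (if 0 \<le> \<kappa> \<and> 0 < s \<and> s < t \<and> ennreal s < \<mu> \<kappa> then 1 else 0) \<partial>lborel) \<partial>lborel)"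
  proof (rule nn_integral_mono)
    fix \<kappa> :: real
    show "(\<integral>\<^sup>+x. (if 0 \<le> \<kappa> \<and> ennreal \<kappa> < g x then 1 else 0) * indicator E x \<partial>lebesgue)
      \<le> (\<integral>\<^sup>+s. (if 0 \<le> \<kappa> \<and> 0 < s \<and> s < t \<and> ennreal s < \<mu> \<kappa> then 1 else 0) \<partial>lborel)"
    proof (cases "0 \<le> \<kappa>")
      case True
      let ?G = "E \<inter> {x \<in> Q. g x > ennreal \<kappa>}"
      have [measurable]: "{x \<in> Q. g x > ennreal \<kappa>} \<in> sets lebesgue" by measurable
      have "(\<integral>\<^sup>+x. (if 0 \<le> \<kappa> \<and> ennreal \<kappa> < g x then 1 else 0) * indicator E x \<partial>lebesgue) = emeasure lebesgue ?G"
      proof -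
        have "(\<lambda>x. (if 0 \<le> \<kappa> \<and> ennreal \<kappa> < g x then 1 else 0) * indicator E x) = (indicator ?G :: _ \<Rightarrow> ennreal)"
          using True E(1) by (intro ext) (auto simp: indicator_def)
        then show ?thesis
          using nn_integral_indicator[of ?G lebesgue] by simp
      qed
      also have "\<dots> \<le> min (ennreal t) (\<mu> \<kappa>)"
      proof (rule min.boundedI)
        show "emeasure lebesgue ?G \<le> ennreal t"
          by (rule order_trans[OF emeasure_mono E(2)]) auto
        show "emeasure lebesgue ?G \<le> \<mu> \<kappa>"
          unfolding \<mu>_def by (rule emeasure_mono) auto
      qed
      also have "\<dots> = (\<integral>\<^sup>+s. (if 0 \<le> s \<and> ennreal s < min (ennreal t) (\<mu> \<kappa>) then 1 else 0) \<partial>lborel)"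
        by (rule level)
      also have "\<dots> \<le> (\<integral>\<^sup>+s. (if 0 \<le> \<kappa> \<and> 0 < s \<and> s < t \<and> ennreal s < \<mu> \<kappa> then 1 else 0) \<partial>lborel)"
      proof (rule nn_integral_mono_AE)
        show "AE s in lborel. (if 0 \<le> s \<and> ennreal s < min (ennreal t) (\<mu> \<kappa>) then 1 else 0)
            \<le> (if 0 \<le> \<kappa> \<and> 0 < s \<and> s < t \<and> ennreal s < \<mu> \<kappa> then 1 else (0::ennreal))"
          using AE_lborel_singleton[of "0::real"]
        proof eventually_elim
          case (elim s)
          have "s < t" if "0 \<le> s" "ennreal s < ennreal t"
            using that by (simp add: ennreal_less_iff)
          then show ?case using True elim by simp
        qed
      qed
      finally show ?thesis .
    qed simp
  qed
  also have "\<dots> = (\<integral>\<^sup>+s. (\<integral>\<^sup>+\<kappa>. (if 0 \<le> \<kappa> \<and> 0 < s \<and> s < t \<and> ennreal s < \<mu> \<kappa> then 1 else 0) \<partial>lborel) \<partial>lborel)"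
    by (subst lborel_pair.Fubini') auto
  also have "\<dots> \<le> (\<integral>\<^sup>+s\<in>{0<..<t}. rearr Q g s \<partial>lborel)"
  proof (rule nn_integral_mono)
    fix s :: real
    show "(\<integral>\<^sup>+\<kappa>. (if 0 \<le> \<kappa> \<and> 0 < s \<and> s < t \<and> ennreal s < \<mu> \<kappa> then 1 else 0) \<partial>lborel)
      \<le> rearr Q g s * indicator {0<..<t} s"
    proof (cases "0 < s \<and> s < t")
      case True
      have "ennreal \<kappa> \<le> rearr Q g s" if "0 \<le> \<kappa>" "ennreal s < \<mu> \<kappa>" for \<kappa>
        unfolding rearr_def
      proof (rule INF_greatest, clarify)
        fix u :: real assume u: "0 \<le> u" "emeasure lebesgue {x \<in> Q. ennreal u < g x} \<le> ennreal s"
        show "ennreal \<kappa> \<le> ennreal u"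
        proof (rule ccontr)
          assume "\<not> ennreal \<kappa> \<le> ennreal u"
          then have "{x \<in> Q. ennreal \<kappa> < g x} \<subseteq> {x \<in> Q. ennreal u < g x}" by auto
          moreover have "{x \<in> Q. ennreal u < g x} \<in> sets lebesgue" by measurable
          ultimately have "\<mu> \<kappa> \<le> ennreal s"
            unfolding \<mu>_def using u(2) by (meson emeasure_mono order_trans)
          with that(2) show False by simp
        qed
      qed
      then have "(\<integral>\<^sup>+\<kappa>. (if 0 \<le> \<kappa> \<and> 0 < s \<and> s < t \<and> ennreal s < \<mu> \<kappa> then 1 else 0) \<partial>lborel)
         \<le> (\<integral>\<^sup>+\<kappa>. indicator {\<kappa>. 0 \<le> \<kappa> \<and> ennreal \<kappa> \<le> rearr Q g s} \<kappa> \<partial>lborel)"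
        by (intro nn_integral_mono) (auto simp: indicator_def)
      also have "\<dots> \<le> rearr Q g s"
      proof (cases "rearr Q g s")
        case (real c)
        have "{\<kappa>. 0 \<le> \<kappa> \<and> ennreal \<kappa> \<le> ennreal c} = {0..c}"
          using real by (auto simp: ennreal_le_iff)
        then show ?thesis using real by simp
      qed simp
      finally show ?thesis using True by simp
    next
      case False
      then have "(\<lambda>\<kappa>. if 0 \<le> \<kappa> \<and> 0 < s \<and> s < t \<and> ennreal s < \<mu> \<kappa> then 1 else 0) = (\<lambda>_. 0 :: ennreal)"
        by auto
      then show ?thesis by simp
    qed
  qed
  finally show ?thesis .
qed

section \<open>Hardy inequalities with logarithmic weights\<close>

lemma enn_powr_ennreal: "0 \<le> x \<Longrightarrow> enn_powr (ennreal x) a = ennreal (x powr a)"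
  by (simp add: enn_powr_def)

lemma enn_powr_top [simp]: "enn_powr \<infinity> a = \<infinity>" "enn_powr top a = top"
  by (simp_all add: enn_powr_def)

lemma enn_powr_0 [simp]: "enn_powr 0 a = 0"
  by (simp add: enn_powr_def)

lemma enn_powr_mono: "x \<le> y \<Longrightarrow> 0 \<le> a \<Longrightarrow> enn_powr x a \<le> enn_powr y a"
  by (cases x; cases y) (auto simp: enn_powr_ennreal powr_mono2 top_unique)

lemma enn_powr_mult:
  assumes "0 < a" shows "enn_powr (ennreal c * x) a = enn_powr (ennreal c) a * enn_powr x a"
proof (cases "c \<le> 0")
  case True
  then show ?thesis by (simp add: ennreal_neg)
next
  case False
  then show ?thesis
    using assms
    by (cases x) (auto simp: enn_powr_ennreal powr_mult ennreal_mult_top simp flip: ennreal_mult)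
qed

lemma enn_powr_powr: "0 < a \<Longrightarrow> enn_powr (enn_powr x a) (1 / a) = x"
  by (cases x) (auto simp: enn_powr_ennreal powr_powr)

lemma enn_powr_powr': "0 < a \<Longrightarrow> enn_powr (enn_powr x (1 / a)) a = x"
  by (cases x) (auto simp: enn_powr_ennreal powr_powr)

lemma borel_measurable_enn_powr [measurable]:
  assumes [measurable]: "f \<in> borel_measurable M"
  shows "(\<lambda>x. enn_powr (f x) a) \<in> borel_measurable M"
  unfolding enn_powr_def by measurable

text \<open>The bound is pulled back to each \<open>f i\<close> through the inverse power
  \<open>1 / a\<close>, where passing to the supremum is immediate.\<close>

lemma enn_powr_SUP_le:
  assumes "0 < a" "\<And>i. i \<in> I \<Longrightarrow> enn_powr (f i) a \<le> y"
  shows "enn_powr (SUP i\<in>I. f i) a \<le> y"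
proof -
  have "f i \<le> enn_powr y (1 / a)" if "i \<in> I" for i
    using enn_powr_mono[OF assms(2)[OF that], of "1 / a"] assms(1) by (simp add: enn_powr_powr)
  then have "(SUP i\<in>I. f i) \<le> enn_powr y (1 / a)"
    by (rule SUP_least)
  from enn_powr_mono[OF this, of a] assms(1) show ?thesis
    by (simp add: enn_powr_powr')
qed

text \<open>The tangent of the convex function \<open>x powr r\<close> at \<open>c\<close>, obtained
  from Young's inequality with weights \<open>1 / r\<close> and \<open>1 - 1 / r\<close>, which
  includes \<open>r = 1\<close>.\<close>

lemma powr_tangent_le:
  fixes x c r :: real
  assumes "1 \<le> r" "0 \<le> x" "0 < c"
  shows "r * c powr (r - 1) * x \<le> x powr r + (r - 1) * c powr r"
proof (cases "x = 0")
  case True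
  then show ?thesis using assms by simp
next
  case False
  have "(x powr r) powr (1 / r) * (c powr r) powr (1 - 1 / r) \<le> (1 / r) * x powr r + (1 - 1 / r) * c powr r"
    using assms False by (intro Youngs_inequality_0) (auto simp: field_simps)
  also have "(x powr r) powr (1 / r) * (c powr r) powr (1 - 1 / r) = x * c powr (r - 1)"
  proof -
    have "r * (1 - 1 / r) = r - 1" using assms by (simp add: field_simps)
    then show ?thesis using assms False by (simp add: powr_powr del: mult_eq_0_iff)
  qed
  finally have "r * (x * c powr (r - 1)) \<le> r * ((1 / r) * x powr r + (1 - 1 / r) * c powr r)"
    using assms by (intro mult_left_mono) auto
  also have "\<dots> = (r * (1 / r)) * x powr r + (r * (1 - 1 / r)) * c powr r"
    by (simp only: distrib_left mult.assoc)
  also have "r * (1 / r) = 1" using assms by simp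
  also have "r * (1 - 1 / r) = r - 1" using assms by (simp add: field_simps)
  finally show ?thesis by (simp add: mult_ac)
qed

text \<open>The tangent inequality at \<open>c\<close> is integrated, and then \<open>c\<close> is
  taken to be the integral of \<open>F\<close>. Total mass below 1 is allowed because the constant
  term \<open>(r - 1) * c powr r\<close> is nonnegative.\<close>

lemma nn_integral_Jensen_powr:
  assumes M: "emeasure M (space M) \<le> 1" and [measurable]: "F \<in> borel_measurable M" and r: "1 \<le> r"
  shows "enn_powr (\<integral>\<^sup>+x. F x \<partial>M) r \<le> (\<integral>\<^sup>+x. enn_powr (F x) r \<partial>M)"
proof -
  have key: "ennreal (r * c powr (r - 1)) * (\<integral>\<^sup>+x. F x \<partial>M) \<le> (\<integral>\<^sup>+x. enn_powr (F x) r \<partial>M) + ennreal ((r - 1) * c powr r)"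
    if "0 < c" for c
  proof -
    have "ennreal (r * c powr (r - 1)) * (\<integral>\<^sup>+x. F x \<partial>M) = (\<integral>\<^sup>+x. ennreal (r * c powr (r - 1)) * F x \<partial>M)"
      by (simp add: nn_integral_cmult)
    also have "\<dots> \<le> (\<integral>\<^sup>+x. enn_powr (F x) r + ennreal ((r - 1) * c powr r) \<partial>M)"
    proof (rule nn_integral_mono)
      fix x
      show "ennreal (r * c powr (r - 1)) * F x \<le> enn_powr (F x) r + ennreal ((r - 1) * c powr r)"
      proof (cases "F x")
        case (real y)
        then show ?thesis
          using powr_tangent_le[OF r, of y c] that r
          by (simp add: enn_powr_ennreal ennreal_leI flip: ennreal_mult ennreal_plus)
      qed simp
    qed
    also have "\<dots> = (\<integral>\<^sup>+x. enn_powr (F x) r \<partial>M) + ennreal ((r - 1) * c powr r) * emeasure M (space M)"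
      by (simp add: nn_integral_add)
    also have "\<dots> \<le> (\<integral>\<^sup>+x. enn_powr (F x) r \<partial>M) + ennreal ((r - 1) * c powr r) * 1"
      using M by (intro add_left_mono mult_left_mono) auto
    finally show ?thesis by simp
  qed
  show ?thesis
  proof (cases "\<integral>\<^sup>+x. enn_powr (F x) r \<partial>M")
    case (real B)
    \<comment> \<open>The choice \<open>c = 1\<close> shows that the integral of \<open>F\<close> is
      finite, so that it is itself a legitimate choice of \<open>c\<close>.\<close>
    have "ennreal r * (\<integral>\<^sup>+x. F x \<partial>M) \<le> ennreal (B + (r - 1))"
      using key[of 1] real r by simp
    then have "(\<integral>\<^sup>+x. F x \<partial>M) \<noteq> \<infinity>"
      using r by (auto simp: ennreal_mult_top top_unique)
    then obtain A where A: "0 \<le> A" "(\<integral>\<^sup>+x. F x \<partial>M) = ennreal A"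
      by (cases "\<integral>\<^sup>+x. F x \<partial>M") auto
    show ?thesis
    proof (cases "A = 0")
      case False
      with A have "0 < A" by simp
      from key[OF this] have "r * A powr (r - 1) * A \<le> B + (r - 1) * A powr r"
        using A real r by (simp add: ennreal_le_iff flip: ennreal_mult ennreal_plus)
      moreover have "A powr (r - 1) * A = A powr r"
        using \<open>0 < A\<close> by (simp add: powr_diff)
      ultimately have "r * A powr r \<le> B + (r - 1) * A powr r" by (simp only: mult.assoc)
      then have "A powr r \<le> B" by (simp add: algebra_simps)
      then show ?thesis using A real by (simp add: enn_powr_ennreal ennreal_leI)
    qed (use A in simp)
  qed simp
qed

text \<open>The integrand may blow up at 0. The interval is exhausted by those starting at
  \<open>s / (n + 1)\<close>, and the lower boundary term is dropped because \<open>F\<close> is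
  nonnegative.\<close>

lemma nn_integral_open_le_antiderivative:
  fixes f F :: "real \<Rightarrow> real"
  assumes s: "0 < s" and [measurable]: "f \<in> borel_measurable borel"
    and F: "\<And>u. 0 < u \<Longrightarrow> u \<le> s \<Longrightarrow> (F has_real_derivative f u) (at u)"
    and f: "\<And>u. 0 < u \<Longrightarrow> u \<le> s \<Longrightarrow> 0 \<le> f u" and F0: "\<And>u. 0 < u \<Longrightarrow> u \<le> s \<Longrightarrow> 0 \<le> F u"
  shows "(\<integral>\<^sup>+u. indicator {0<..<s} u * ennreal (f u) \<partial>lborel) \<le> ennreal (F s)"
proof -
  have "indicator {0<..<s} u * ennreal (f u) \<le> (SUP n. ennreal (f u) * indicator {s / real (Suc n)..s} u)" for u
  proof (cases "u \<in> {0<..<s}")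
    case True
    then obtain n where "1 / real (Suc n) < u / s"
      using nat_approx_posE[of "u / s"] s by auto
    then have "s / real (Suc n) \<le> u" using s by (simp add: field_simps del: of_nat_Suc)
    then show ?thesis
      using True by (intro SUP_upper2[of n]) auto
  qed simp
  then have "(\<integral>\<^sup>+u. indicator {0<..<s} u * ennreal (f u) \<partial>lborel)
     \<le> (\<integral>\<^sup>+u. (SUP n. ennreal (f u) * indicator {s / real (Suc n)..s} u) \<partial>lborel)"
    by (intro nn_integral_mono)
  also have "\<dots> = (SUP n. \<integral>\<^sup>+u. ennreal (f u) * indicator {s / real (Suc n)..s} u \<partial>lborel)"
  proof (rule nn_integral_monotone_convergence_SUP)
    have "s / real (Suc (Suc n)) \<le> s / real (Suc n)" for n
      using s by (intro divide_left_mono) auto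
    then show "incseq (\<lambda>n u. ennreal (f u) * indicator {s / real (Suc n)..s} u)"
      by (intro incseq_SucI le_funI mult_left_mono) (force simp: indicator_def dest: order_trans)+
  qed auto
  also have "\<dots> \<le> ennreal (F s)"
  proof (rule SUP_least)
    fix n
    have p: "0 < s / real (Suc n)" "s / real (Suc n) \<le> s"
      using s by (auto simp: field_simps)
    then have "(\<integral>\<^sup>+u. ennreal (f u) * indicator {s / real (Suc n)..s} u \<partial>lborel) = ennreal (F s - F (s / real (Suc n)))"
      by (intro nn_integral_FTC_Icc) (auto intro!: F f)
    also have "\<dots> \<le> ennreal (F s)"
      using F0[of "s / real (Suc n)"] p by (intro ennreal_leI) simp
    finally show "(\<integral>\<^sup>+u. ennreal (f u) * indicator {s / real (Suc n)..s} u \<partial>lborel) \<le> ennreal (F s)" .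
  qed
  finally show ?thesis .
qed

lemma nn_integral_powr_le:
  assumes "0 < s" "0 < (\<epsilon>::real)"
  shows "(\<integral>\<^sup>+u. indicator {0<..<s} u * ennreal (u powr (\<epsilon> - 1)) \<partial>lborel) \<le> ennreal (s powr \<epsilon> / \<epsilon>)"
  using assms by (intro nn_integral_open_le_antiderivative[where F = "\<lambda>u. u powr \<epsilon> / \<epsilon>"])
    (auto intro!: derivative_eq_intros)

section \<open>Logarithmic weights\<close>

definition logw :: "real \<Rightarrow> real" where "logw t = 1 + \<bar>ln t\<bar>"

lemma logw_ge_1: "1 \<le> logw t" by (simp add: logw_def)

lemma logw_pos [simp]: "0 < logw t" using logw_ge_1[of t] by linarith

lemma borel_measurable_logw [measurable]: "logw \<in> borel_measurable borel"
  unfolding logw_def[abs_def] by measurable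

lemma logw_antimono: "0 < u \<Longrightarrow> u \<le> s \<Longrightarrow> s \<le> 1 \<Longrightarrow> logw s \<le> logw u"
  by (simp add: logw_def)

text \<open>Logarithms grow more slowly than any power: with \<open>y = ln (s / u)\<close> one has
  \<open>logw u = logw s + y \<le> logw s * (1 + y)\<close>, and a multiple of
  \<open>exp (\<epsilon> / \<gamma> * y)\<close> absorbs the last factor.\<close>

lemma logw_slowly_varying:
  assumes g: "0 \<le> \<gamma>" and e: "0 < \<epsilon>"
  shows "\<exists>C>0. \<forall>u s. 0 < u \<longrightarrow> u \<le> s \<longrightarrow> s \<le> 1 \<longrightarrow> logw u powr \<gamma> \<le> C * (s / u) powr \<epsilon> * logw s powr \<gamma>"
proof -
  \<comment> \<open>Large enough for
    \<open>1 + y \<le> m * (1 + \<epsilon> / \<gamma> * y)\<close>.\<close>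
  define m where "m = max 1 (\<gamma> / \<epsilon>)"
  have m: "1 \<le> m" "\<gamma> / \<epsilon> \<le> m" by (auto simp: m_def)
  have "logw u powr \<gamma> \<le> m powr \<gamma> * (s / u) powr \<epsilon> * logw s powr \<gamma>" if "0 < u" "u \<le> s" "s \<le> 1" for u s
  proof (cases "\<gamma> = 0")
    case True
    have "1 \<le> s / u" using that by simp
    then have "1 \<le> (s / u) powr \<epsilon>" using e by (simp add: ge_one_powr_ge_zero)
    moreover have "logw u \<noteq> 0" "logw s \<noteq> 0" using logw_pos[of u] logw_pos[of s] by linarith+
    ultimately show ?thesis using True m by simp
  next
    case False
    define y where "y = ln (s / u)"
    have y: "0 \<le> y" using that by (simp add: y_def)
    have ge: "0 < \<gamma>" using False g by simp
    have "logw u = logw s + y"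
      using that by (simp add: logw_def y_def ln_div)
    also have "\<dots> \<le> logw s * (1 + y)"
      using mult_left_mono[OF logw_ge_1[of s] y] by (simp add: algebra_simps)
    finally have 1: "logw u \<le> logw s * (1 + y)" .
    have "1 + y \<le> m + m * (\<epsilon> / \<gamma> * y)"
    proof -
      have "1 * y \<le> m * (\<epsilon> / \<gamma>) * y"
        using m(2) e ge y by (intro mult_right_mono) (auto simp: field_simps)
      then show ?thesis using m(1) by simp
    qed
    also have "\<dots> \<le> m * exp (\<epsilon> / \<gamma> * y)"
      using exp_ge_add_one_self[of "\<epsilon> / \<gamma> * y"] m(1) mult_left_mono[of "1 + \<epsilon> / \<gamma> * y" _ m]
      by (simp add: distrib_left)
    finally have 2: "1 + y \<le> m * exp (\<epsilon> / \<gamma> * y)" .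
    have "logw u powr \<gamma> \<le> (logw s * (m * exp (\<epsilon> / \<gamma> * y))) powr \<gamma>"
      using 1 2 g logw_pos[of s] by (intro powr_mono2) (auto intro: order_trans mult_left_mono less_imp_le)
    also have "\<dots> = logw s powr \<gamma> * (m powr \<gamma> * exp (\<epsilon> * y))"
      using m(1) ge by (simp add: powr_mult exp_powr_real less_imp_le)
    also have "exp (\<epsilon> * y) = (s / u) powr \<epsilon>"
      using that by (simp add: powr_def y_def)
    finally show ?thesis by (simp add: mult_ac)
  qed
  moreover have "0 < m powr \<gamma>" using m by simp
  ultimately show ?thesis by blast
qed

text \<open>With \<open>\<beta> = b * r\<close> this is where \<open>b < -1/r\<close> acts as
  integrability at 0. On \<open>(0, 1]\<close> the weight is a power of \<open>1 - ln t\<close>, so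
  the antiderivative is explicit and the exponent rises by one.\<close>

lemma nn_integral_logw_small:
  assumes b: "\<beta> < - 1" and u: "0 < u" "u \<le> 1"
  shows "(\<integral>\<^sup>+t. indicator {0<..<u} t * ennreal (logw t powr \<beta> / t) \<partial>lborel) \<le> ennreal (logw u powr (\<beta> + 1) / (- \<beta> - 1))"
proof -
  have eq: "logw t = 1 - ln t" if "0 < t" "t \<le> u" for t
    using that u by (simp add: logw_def)
  have "(\<integral>\<^sup>+t. indicator {0<..<u} t * ennreal (logw t powr \<beta> / t) \<partial>lborel)
      = (\<integral>\<^sup>+t. indicator {0<..<u} t * ennreal ((1 - ln t) powr \<beta> / t) \<partial>lborel)"
    by (intro nn_integral_cong) (auto simp: indicator_def eq)
  also have "\<dots> \<le> ennreal ((1 - ln u) powr (\<beta> + 1) / (- \<beta> - 1))"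
  proof (rule nn_integral_open_le_antiderivative[OF u(1)])
    fix t assume t: "0 < t" "t \<le> u"
    then have p: "0 < 1 - ln t" using u ln_le_zero_iff[of t] by linarith
    have "((\<lambda>t. (1 - ln t) powr (\<beta> + 1)) has_real_derivative (\<beta> + 1) * (1 - ln t) powr \<beta> * (- 1 / t)) (at t)"
      using t p by (auto intro!: derivative_eq_intros)
    from DERIV_cdivide[OF this, of "- \<beta> - 1"]
    have "((\<lambda>t. (1 - ln t) powr (\<beta> + 1) / (- \<beta> - 1)) has_real_derivative
        (\<beta> + 1) * (1 - ln t) powr \<beta> * (- 1 / t) / (- \<beta> - 1)) (at t)" .
    moreover have "k * X * (- 1 / t) / (- k) = X / t" if "k \<noteq> 0" for k X :: real
      using that t by (simp add: field_simps)
    from this[of "\<beta> + 1" "(1 - ln t) powr \<beta>"] b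
    have "(\<beta> + 1) * (1 - ln t) powr \<beta> * (- 1 / t) / (- \<beta> - 1) = (1 - ln t) powr \<beta> / t"
      by (simp only: minus_add_distrib) simp
    ultimately show "((\<lambda>t. (1 - ln t) powr (\<beta> + 1) / (- \<beta> - 1)) has_real_derivative (1 - ln t) powr \<beta> / t) (at t)"
      by (simp only:)
  qed (use b in \<open>auto\<close>)
  finally show ?thesis using eq[of u] u by simp
qed

text \<open>For positive arguments this is the supremum of \<open>(u / s) powr \<delta>\<close> over
  \<open>s \<ge> max t u\<close>.\<close>

definition hardy_kernel :: "real \<Rightarrow> real \<Rightarrow> real \<Rightarrow> real" where
  "hardy_kernel \<delta> t u = min 1 ((u / t) powr \<delta>)"

lemma borel_measurable_hardy_kernel [measurable]:
  "(\<lambda>(t, u). hardy_kernel \<delta> t u) \<in> borel_measurable (borel \<Otimes>\<^sub>M borel)"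
  unfolding hardy_kernel_def by measurable

lemma hardy_kernel_nonneg [simp]: "0 \<le> hardy_kernel \<delta> t u"
  by (simp add: hardy_kernel_def)

text \<open>The integral is split at \<open>t = u\<close>. Below \<open>u\<close> the kernel is at
  most 1 and \<open>nn_integral_logw_small\<close> applies. Above \<open>u\<close> one half of the
  decay, \<open>(u / t) powr (\<delta> / 2)\<close>, compensates the variation of the logarithmic
  weight, and the other half is integrated against \<open>dt / t\<close>, which gives
  \<open>2 / \<delta>\<close>.\<close>

lemma hardy_kernel_weight:
  assumes d: "0 < \<delta>" and b: "\<beta> < - 1"
  shows "\<exists>C>0. \<forall>u\<in>{0<..<1}. (\<integral>\<^sup>+t. indicator {0<..<1} t * ennreal (logw t powr \<beta> * hardy_kernel \<delta> t u / t) \<partial>lborel)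
     \<le> ennreal (C * logw u powr (\<beta> + 1))"
proof -
  obtain C where C: "C > 0" "\<And>u s. 0 < u \<Longrightarrow> u \<le> s \<Longrightarrow> s \<le> 1 \<Longrightarrow>
      logw u powr (- \<beta>) \<le> C * (s / u) powr (\<delta> / 2) * logw s powr (- \<beta>)"
    using logw_slowly_varying[of "- \<beta>" "\<delta> / 2"] assms by auto
  let ?c = "1 / (- \<beta> - 1) + C * (2 / \<delta>)"
  have "(\<integral>\<^sup>+t. indicator {0<..<1} t * ennreal (logw t powr \<beta> * hardy_kernel \<delta> t u / t) \<partial>lborel)
     \<le> ennreal (?c * logw u powr (\<beta> + 1))" if u: "u \<in> {0<..<1}" for u
  proof -
    let ?f = "\<lambda>t. C * logw u powr (\<beta> + 1) * ((u / t) powr (\<delta> / 2) / t)"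
    have pt: "indicator {0<..<1} t * ennreal (logw t powr \<beta> * hardy_kernel \<delta> t u / t)
       \<le> indicator {0<..<u} t * ennreal (logw t powr \<beta> / t) + ennreal (?f t) * indicator {u..1} t" for t
    proof (cases "t \<in> {0<..<1}")
      case t: True
      show ?thesis
      proof (cases "t < u")
        case True
        have "logw t powr \<beta> * hardy_kernel \<delta> t u / t \<le> logw t powr \<beta> / t"
          using t by (intro divide_right_mono mult_left_le) (auto simp: hardy_kernel_def)
        then show ?thesis using t True by (simp add: ennreal_leI)
      next
        case False
        have "logw t powr \<beta> * (u / t) powr (\<delta> / 2) \<le> C * logw u powr \<beta>"
        proof -
          have "logw u powr (- \<beta>) \<le> C * (t / u) powr (\<delta> / 2) * logw t powr (- \<beta>)"
            using C(2)[of u t] t u False by auto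
          then have "(logw u powr \<beta> * logw t powr \<beta> * (u / t) powr (\<delta> / 2)) * logw u powr (- \<beta>)
              \<le> (logw u powr \<beta> * logw t powr \<beta> * (u / t) powr (\<delta> / 2)) * (C * (t / u) powr (\<delta> / 2) * logw t powr (- \<beta>))"
            by (rule mult_left_mono) auto
          also have "(logw u powr \<beta> * logw t powr \<beta> * (u / t) powr (\<delta> / 2)) * logw u powr (- \<beta>)
              = (logw u powr \<beta> * logw u powr (- \<beta>)) * (logw t powr \<beta> * (u / t) powr (\<delta> / 2))"
            by (simp only: mult_ac)
          also have "(logw u powr \<beta> * logw t powr \<beta> * (u / t) powr (\<delta> / 2)) * (C * (t / u) powr (\<delta> / 2) * logw t powr (- \<beta>))
              = (logw t powr \<beta> * logw t powr (- \<beta>)) * ((u / t) powr (\<delta> / 2) * (t / u) powr (\<delta> / 2)) * (C * logw u powr \<beta>)"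
            by (simp only: mult_ac)
          also have "(u / t) powr (\<delta> / 2) * (t / u) powr (\<delta> / 2) = 1"
            using t u by (simp flip: powr_mult)
          also have "logw u powr \<beta> * logw u powr (- \<beta>) = 1"
            using logw_pos[of u] by (simp del: logw_pos flip: powr_add)
          also have "logw t powr \<beta> * logw t powr (- \<beta>) = 1"
            using logw_pos[of t] by (simp del: logw_pos flip: powr_add)
          finally show ?thesis by simp
        qed
        moreover have "logw u powr \<beta> \<le> logw u powr (\<beta> + 1)"
          using logw_ge_1 by (intro powr_mono) auto
        ultimately have 1: "logw t powr \<beta> * (u / t) powr (\<delta> / 2) \<le> C * logw u powr (\<beta> + 1)"
          using C(1) by (meson less_imp_le mult_left_mono order_trans)
        have "logw t powr \<beta> * hardy_kernel \<delta> t u \<le> logw t powr \<beta> * (u / t) powr (\<delta> / 2 + \<delta> / 2)"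
          by (intro mult_left_mono) (auto simp: hardy_kernel_def)
        also have "\<dots> = logw t powr \<beta> * (u / t) powr (\<delta> / 2) * (u / t) powr (\<delta> / 2)"
          by (simp only: powr_add mult.assoc)
        also have "\<dots> \<le> C * logw u powr (\<beta> + 1) * (u / t) powr (\<delta> / 2)"
          by (intro mult_right_mono 1) auto
        finally have "logw t powr \<beta> * hardy_kernel \<delta> t u / t \<le> ?f t"
          using t by (simp add: divide_right_mono)
        then show ?thesis using t False by (simp add: ennreal_leI)
      qed
    qed simp
    have "(\<integral>\<^sup>+t. indicator {0<..<1} t * ennreal (logw t powr \<beta> * hardy_kernel \<delta> t u / t) \<partial>lborel)
       \<le> (\<integral>\<^sup>+t. indicator {0<..<u} t * ennreal (logw t powr \<beta> / t) + ennreal (?f t) * indicator {u..1} t \<partial>lborel)"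
      by (intro nn_integral_mono pt)
    also have "\<dots> = (\<integral>\<^sup>+t. indicator {0<..<u} t * ennreal (logw t powr \<beta> / t) \<partial>lborel) + (\<integral>\<^sup>+t. ennreal (?f t) * indicator {u..1} t \<partial>lborel)"
      by (intro nn_integral_add) auto
    also have "(\<integral>\<^sup>+t. ennreal (?f t) * indicator {u..1} t \<partial>lborel)
        = ennreal (- (C * logw u powr (\<beta> + 1) * ((2 / \<delta>) * (u / 1) powr (\<delta> / 2))) - - (C * logw u powr (\<beta> + 1) * ((2 / \<delta>) * (u / u) powr (\<delta> / 2))))"
    proof (rule nn_integral_FTC_Icc[where F = "\<lambda>t. - (C * logw u powr (\<beta> + 1) * ((2 / \<delta>) * (u / t) powr (\<delta> / 2)))"])
      fix t assume "t \<in> {u..1}"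
      then have "0 < t" using u by simp
      then show "((\<lambda>t. - (C * logw u powr (\<beta> + 1) * ((2 / \<delta>) * (u / t) powr (\<delta> / 2)))) has_real_derivative ?f t) (at t)"
      proof -
        have "((\<lambda>t. u / t) has_real_derivative - u / t\<^sup>2) (at t)"
          using \<open>0 < t\<close> by (auto intro!: derivative_eq_intros simp: power2_eq_square)
        from DERIV_powr[OF this _ DERIV_const, of "\<delta> / 2"]
        have "((\<lambda>t. (u / t) powr (\<delta> / 2)) has_real_derivative (u / t) powr (\<delta> / 2) * ((- u / t\<^sup>2) * (\<delta> / 2) / (u / t))) (at t)"
          using u \<open>0 < t\<close> by simp
        also have "(- u / t\<^sup>2) * (\<delta> / 2) / (u / t) = - (\<delta> / 2) / t"
          using u \<open>0 < t\<close> by (simp add: field_simps power2_eq_square)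
        finally have "((\<lambda>t. (u / t) powr (\<delta> / 2)) has_real_derivative (u / t) powr (\<delta> / 2) * (- (\<delta> / 2) / t)) (at t)" .
        from DERIV_cmult[OF this, of "- (C * logw u powr (\<beta> + 1) * (2 / \<delta>))"]
        show ?thesis using d by (simp add: mult.assoc)
      qed
      show "0 \<le> ?f t" using \<open>0 < t\<close> C(1) by simp
    qed (use u C(1) in auto)
    also have "\<dots> \<le> ennreal (C * (2 / \<delta>) * logw u powr (\<beta> + 1))"
      using C(1) d u by (intro ennreal_leI) (auto simp: algebra_simps)
    also have "(\<integral>\<^sup>+t. indicator {0<..<u} t * ennreal (logw t powr \<beta> / t) \<partial>lborel) \<le> ennreal (logw u powr (\<beta> + 1) / (- \<beta> - 1))"
      using u by (intro nn_integral_logw_small b) auto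
    finally have "(\<integral>\<^sup>+t. indicator {0<..<1} t * ennreal (logw t powr \<beta> * hardy_kernel \<delta> t u / t) \<partial>lborel)
      \<le> ennreal (logw u powr (\<beta> + 1) / (- \<beta> - 1)) + ennreal (C * (2 / \<delta>) * logw u powr (\<beta> + 1))"
      by (simp add: add_mono)
    also have "\<dots> = ennreal (?c * logw u powr (\<beta> + 1))"
      using C(1) d b by (subst ennreal_plus[symmetric]) (auto simp: algebra_simps)
    finally show ?thesis .
  qed
  moreover have "?c > 0" using C(1) d b by (intro add_pos_pos) auto
  ultimately show ?thesis by blast
qed

text \<open>For \<open>a = k / d\<close> and \<open>s = l ^ d\<close> the factor in front is
  \<open>l ^ k / l ^ d\<close>, that of a fractional average of order \<open>k\<close> over a cube
  of side \<open>l\<close>.\<close>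

definition hardy_avg :: "real \<Rightarrow> (real \<Rightarrow> ennreal) \<Rightarrow> real \<Rightarrow> ennreal" where
  "hardy_avg a G s = ennreal (s powr (a - 1)) * (\<integral>\<^sup>+u\<in>{0<..<s}. G u \<partial>lborel)"

text \<open>The supremum ends at 1 because the quasi-norms only see parameters in
  \<open>(0, 1)\<close>.\<close>

definition hardy_sup :: "real \<Rightarrow> (real \<Rightarrow> ennreal) \<Rightarrow> real \<Rightarrow> ennreal" where
  "hardy_sup a G t = (SUP s\<in>{t..1}. hardy_avg a G s)"

text \<open>\<open>hardy_avg a G s\<close> is the integral of
  \<open>(1 / \<delta>) * u powr a * G u\<close> for the density
  \<open>\<delta> * s powr (- \<delta>) * u powr (\<delta> - 1)\<close> on \<open>(0, s)\<close>,
  whose mass is at most 1. Jensen's inequality then moves the power inside.\<close>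

lemma hardy_avg_powr_le:
  assumes a: "a < 1" and r: "1 \<le> r" and [measurable]: "G \<in> borel_measurable borel"
    and s: "0 < s"
  defines "\<delta> \<equiv> 1 - a"
  shows "enn_powr (hardy_avg a G s) r \<le> ennreal ((1 / \<delta>) powr r * \<delta>) *
    (\<integral>\<^sup>+u. ennreal ((u / s) powr \<delta> / u) * indicator {0<..<s} u * enn_powr (ennreal (u powr a) * G u) r \<partial>lborel)"
proof -
  have d: "0 < \<delta>" using a by (simp add: \<delta>_def)
  define w where "w u = ennreal (\<delta> * s powr (- \<delta>)) * (indicator {0<..<s} u * ennreal (u powr (\<delta> - 1)))" for u
  have [measurable]: "w \<in> borel_measurable borel" unfolding w_def by measurable
  let ?M = "density lborel w"
  have "emeasure ?M (space ?M) = (\<integral>\<^sup>+u. w u \<partial>lborel)"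
    by (simp add: emeasure_density)
  also have "\<dots> = ennreal (\<delta> * s powr (- \<delta>)) * (\<integral>\<^sup>+u. indicator {0<..<s} u * ennreal (u powr (\<delta> - 1)) \<partial>lborel)"
    unfolding w_def by (intro nn_integral_cmult) measurable
  also have "\<dots> \<le> ennreal (\<delta> * s powr (- \<delta>)) * ennreal (s powr \<delta> / \<delta>)"
    by (intro mult_left_mono nn_integral_powr_le s d) auto
  also have "\<dots> = 1"
    using d s by (simp add: powr_minus flip: ennreal_mult)
  finally have M: "emeasure ?M (space ?M) \<le> 1" .
  let ?F = "\<lambda>u. ennreal (1 / \<delta>) * (ennreal (u powr a) * G u)"
  have "hardy_avg a G s = (\<integral>\<^sup>+u. ennreal (s powr (a - 1)) * (G u * indicator {0<..<s} u) \<partial>lborel)"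
    unfolding hardy_avg_def by (intro nn_integral_cmult[symmetric]) measurable
  also have "\<dots> = (\<integral>\<^sup>+u. w u * ?F u \<partial>lborel)"
  proof (intro nn_integral_cong)
    fix u :: real
    show "ennreal (s powr (a - 1)) * (G u * indicator {0<..<s} u) = w u * ?F u"
    proof (cases "u \<in> {0<..<s}")
      case True
      have "s powr (a - 1) = (\<delta> * s powr (- \<delta>)) * u powr (\<delta> - 1) * (1 / \<delta>) * u powr a"
        using d True by (simp add: \<delta>_def flip: powr_add)
      then have e: "ennreal (s powr (a - 1)) = ennreal (\<delta> * s powr (- \<delta>)) * ennreal (u powr (\<delta> - 1)) * ennreal (1 / \<delta>) * ennreal (u powr a)"
        using d by (simp flip: ennreal_mult)
      show ?thesis using True by (simp only: w_def e indicator_simps) (simp only: mult_ac mult_1)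
    qed (simp add: w_def)
  qed
  also have "\<dots> = (\<integral>\<^sup>+u. ?F u \<partial>?M)"
    by (subst nn_integral_density) auto
  finally have "enn_powr (hardy_avg a G s) r = enn_powr (\<integral>\<^sup>+u. ?F u \<partial>?M) r" by simp
  also have "\<dots> \<le> (\<integral>\<^sup>+u. enn_powr (?F u) r \<partial>?M)"
    by (intro nn_integral_Jensen_powr M r) measurable
  also have "\<dots> = (\<integral>\<^sup>+u. w u * enn_powr (?F u) r \<partial>lborel)"
    by (subst nn_integral_density) auto
  also have "\<dots> = (\<integral>\<^sup>+u. ennreal ((1 / \<delta>) powr r * \<delta>) * (ennreal ((u / s) powr \<delta> / u) * indicator {0<..<s} u * enn_powr (ennreal (u powr a) * G u) r) \<partial>lborel)"
  proof (intro nn_integral_cong)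
    fix u :: real
    show "w u * enn_powr (?F u) r = ennreal ((1 / \<delta>) powr r * \<delta>) * (ennreal ((u / s) powr \<delta> / u) * indicator {0<..<s} u * enn_powr (ennreal (u powr a) * G u) r)"
    proof (cases "u \<in> {0<..<s}")
      case True
      have "(\<delta> * s powr (- \<delta>)) * u powr (\<delta> - 1) = \<delta> * ((u / s) powr \<delta> / u)"
        using d True by (simp add: powr_divide powr_minus powr_diff field_simps)
      then have "(\<delta> * s powr (- \<delta>)) * u powr (\<delta> - 1) * (1 / \<delta>) powr r = (1 / \<delta>) powr r * \<delta> * ((u / s) powr \<delta> / u)"
        by simp
      then have "w u * ennreal ((1 / \<delta>) powr r) = ennreal ((1 / \<delta>) powr r * \<delta>) * ennreal ((u / s) powr \<delta> / u)"
        using True d by (simp add: w_def del: times_divide_eq_right flip: ennreal_mult)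
      moreover have "enn_powr (?F u) r = ennreal ((1 / \<delta>) powr r) * enn_powr (ennreal (u powr a) * G u) r"
        using d r enn_powr_mult[of r "1 / \<delta>" "ennreal (u powr a) * G u"] by (simp add: enn_powr_ennreal)
      ultimately show ?thesis using True by (simp add: mult.assoc[symmetric])
    qed (simp add: w_def)
  qed
  also have "\<dots> = ennreal ((1 / \<delta>) powr r * \<delta>) *
    (\<integral>\<^sup>+u. ennreal ((u / s) powr \<delta> / u) * indicator {0<..<s} u * enn_powr (ennreal (u powr a) * G u) r \<partial>lborel)"
    by (intro nn_integral_cmult) measurable
  finally show ?thesis .
qed

text \<open>The bound for a single \<open>s\<close> has the kernel
  \<open>(u / s) powr \<delta>\<close> on \<open>(0, s)\<close>. For \<open>s \<ge> t\<close> all of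
  these lie below \<open>hardy_kernel \<delta> t u\<close>, so the supremum costs nothing
  further.\<close>

lemma hardy_sup_powr_le:
  assumes a: "a < 1" and r: "1 \<le> r" and [measurable]: "G \<in> borel_measurable borel"
    and t: "0 < t"
  defines "\<delta> \<equiv> 1 - a"
  shows "enn_powr (hardy_sup a G t) r \<le> ennreal ((1 / \<delta>) powr r * \<delta>) *
    (\<integral>\<^sup>+u. ennreal (hardy_kernel \<delta> t u / u) * indicator {0<..<1} u * enn_powr (ennreal (u powr a) * G u) r \<partial>lborel)"
  unfolding hardy_sup_def
proof (rule enn_powr_SUP_le)
  show "0 < r" using r by simp
  have d: "0 < \<delta>" using a by (simp add: \<delta>_def)
  fix s assume "s \<in> {t..1}"
  then have s: "0 < s" "t \<le> s" "s \<le> 1" using t by auto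
  show "enn_powr (hardy_avg a G s) r \<le> ennreal ((1 / \<delta>) powr r * \<delta>) *
    (\<integral>\<^sup>+u. ennreal (hardy_kernel \<delta> t u / u) * indicator {0<..<1} u * enn_powr (ennreal (u powr a) * G u) r \<partial>lborel)"
  proof (rule order_trans[OF hardy_avg_powr_le[OF a r assms(3) s(1), folded \<delta>_def]],
      intro mult_left_mono nn_integral_mono mult_right_mono)
    fix u
    show "ennreal ((u / s) powr \<delta> / u) * indicator {0<..<s} u \<le> ennreal (hardy_kernel \<delta> t u / u) * indicator {0<..<1} u"
    proof (cases "u \<in> {0<..<s}")
      case True
      have "(u / s) powr \<delta> \<le> 1"
        using True s d by (intro powr_le1) auto
      moreover have "(u / s) powr \<delta> \<le> (u / t) powr \<delta>"
        using True s t d by (intro powr_mono2 divide_left_mono) auto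
      ultimately show ?thesis
        using True s by (auto simp: hardy_kernel_def intro!: ennreal_leI divide_right_mono)
    qed simp
  qed auto
qed

text \<open>Fubini leaves for each \<open>u\<close> the integral of
  \<open>hardy_kernel_weight\<close> with \<open>\<beta> = b * r\<close>. Its exponent
  \<open>b * r + 1\<close> is \<open>r * (b + 1 / r)\<close>, which produces the logarithmic
  exponent on the right-hand side.\<close>

theorem hardy_weighted:
  assumes a: "a < 1" and r: "1 \<le> r" and b: "b < - (1 / r)"
  shows "\<exists>C>0. \<forall>G\<in>borel_measurable borel.
    (\<integral>\<^sup>+t\<in>{0<..<1}. enn_powr (ennreal (logw t powr b) * hardy_sup a G t) r * ennreal (1 / t) \<partial>lborel)
    \<le> ennreal C * (\<integral>\<^sup>+u\<in>{0<..<1}. enn_powr (ennreal (u powr a * logw u powr (b + 1 / r)) * G u) r * ennreal (1 / u) \<partial>lborel)"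
proof -
  define \<delta> where "\<delta> = 1 - a"
  have d: "0 < \<delta>" using a by (simp add: \<delta>_def)
  have br: "b * r < - 1" using b r by (simp add: field_simps)
  obtain C where C: "0 < C" "\<And>u. u \<in> {0<..<1} \<Longrightarrow>
      (\<integral>\<^sup>+t. indicator {0<..<1} t * ennreal (logw t powr (b * r) * hardy_kernel \<delta> t u / t) \<partial>lborel) \<le> ennreal (C * logw u powr (b * r + 1))"
    using hardy_kernel_weight[OF d br] by blast
  define K where "K = (1 / \<delta>) powr r * \<delta>"
  have K: "0 < K" using d by (simp add: K_def)
  have "(\<integral>\<^sup>+t\<in>{0<..<1}. enn_powr (ennreal (logw t powr b) * hardy_sup a G t) r * ennreal (1 / t) \<partial>lborel)
    \<le> ennreal (K * C) * (\<integral>\<^sup>+u\<in>{0<..<1}. enn_powr (ennreal (u powr a * logw u powr (b + 1 / r)) * G u) r * ennreal (1 / u) \<partial>lborel)"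
    if [measurable]: "G \<in> borel_measurable borel" for G
  proof -
    define H where "H u = enn_powr (ennreal (u powr a) * G u) r" for u
    have [measurable]: "H \<in> borel_measurable borel" unfolding H_def by measurable
    have "(\<integral>\<^sup>+t\<in>{0<..<1}. enn_powr (ennreal (logw t powr b) * hardy_sup a G t) r * ennreal (1 / t) \<partial>lborel)
      \<le> (\<integral>\<^sup>+t. (\<integral>\<^sup>+u. ennreal K * (indicator {0<..<1} t * ennreal (logw t powr (b * r) * hardy_kernel \<delta> t u / t) * (ennreal (1 / u) * indicator {0<..<1} u * H u)) \<partial>lborel) \<partial>lborel)"
    proof (rule nn_integral_mono)
      fix t :: real
      show "enn_powr (ennreal (logw t powr b) * hardy_sup a G t) r * ennreal (1 / t) * indicator {0<..<1} t
        \<le> (\<integral>\<^sup>+u. ennreal K * (indicator {0<..<1} t * ennreal (logw t powr (b * r) * hardy_kernel \<delta> t u / t) * (ennreal (1 / u) * indicator {0<..<1} u * H u)) \<partial>lborel)"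
      proof (cases "t \<in> {0<..<1}")
        case True
        then have "0 < t" by simp
        have "enn_powr (ennreal (logw t powr b) * hardy_sup a G t) r = ennreal (logw t powr (b * r)) * enn_powr (hardy_sup a G t) r"
          using r by (simp add: enn_powr_mult enn_powr_ennreal powr_powr)
        also have "\<dots> \<le> ennreal (logw t powr (b * r)) * (ennreal K *
            (\<integral>\<^sup>+u. ennreal (hardy_kernel \<delta> t u / u) * indicator {0<..<1} u * H u \<partial>lborel))"
          unfolding K_def H_def \<delta>_def
          by (intro mult_left_mono hardy_sup_powr_le a r that \<open>0 < t\<close>) auto
        finally have "enn_powr (ennreal (logw t powr b) * hardy_sup a G t) r * ennreal (1 / t)
          \<le> ennreal (logw t powr (b * r)) * (ennreal K *
            (\<integral>\<^sup>+u. ennreal (hardy_kernel \<delta> t u / u) * indicator {0<..<1} u * H u \<partial>lborel)) * ennreal (1 / t)"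
          by (rule mult_right_mono) simp
        also have "\<dots> = ennreal (K * (logw t powr (b * r) / t)) * (\<integral>\<^sup>+u. ennreal (hardy_kernel \<delta> t u / u) * indicator {0<..<1} u * H u \<partial>lborel)"
        proof -
          have "ennreal (K * (logw t powr (b * r) / t)) = ennreal (logw t powr (b * r)) * ennreal K * ennreal (1 / t)"
            using K True by (simp flip: ennreal_mult)
          then show ?thesis by (simp only: mult_ac)
        qed
        also have "\<dots> = (\<integral>\<^sup>+u. ennreal (K * (logw t powr (b * r) / t)) * (ennreal (hardy_kernel \<delta> t u / u) * indicator {0<..<1} u * H u) \<partial>lborel)"
          by (intro nn_integral_cmult[symmetric]) measurable
        also have "\<dots> = (\<integral>\<^sup>+u. ennreal K * (indicator {0<..<1} t * ennreal (logw t powr (b * r) * hardy_kernel \<delta> t u / t) * (ennreal (1 / u) * indicator {0<..<1} u * H u)) \<partial>lborel)"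
        proof (intro nn_integral_cong)
          fix u :: real
          have "ennreal (K * (logw t powr (b * r) / t)) * ennreal (hardy_kernel \<delta> t u / u)
             = ennreal K * ennreal (logw t powr (b * r) * hardy_kernel \<delta> t u / t) * ennreal (1 / u)" if "0 < u"
            using K True that by (simp flip: ennreal_mult)
          then show "ennreal (K * (logw t powr (b * r) / t)) * (ennreal (hardy_kernel \<delta> t u / u) * indicator {0<..<1} u * H u)
            = ennreal K * (indicator {0<..<1} t * ennreal (logw t powr (b * r) * hardy_kernel \<delta> t u / t) * (ennreal (1 / u) * indicator {0<..<1} u * H u))"
            using True by (cases "u \<in> {0<..<1}") (simp_all add: mult.assoc[symmetric])
        qed
        finally show ?thesis using True by simp
      qed simp
    qed
    also have "\<dots> = (\<integral>\<^sup>+u. (\<integral>\<^sup>+t. ennreal K * (indicator {0<..<1} t * ennreal (logw t powr (b * r) * hardy_kernel \<delta> t u / t) * (ennreal (1 / u) * indicator {0<..<1} u * H u)) \<partial>lborel) \<partial>lborel)"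
      by (subst lborel_pair.Fubini') auto
    also have "\<dots> = (\<integral>\<^sup>+u. ennreal K * ((\<integral>\<^sup>+t. indicator {0<..<1} t * ennreal (logw t powr (b * r) * hardy_kernel \<delta> t u / t) \<partial>lborel) * (ennreal (1 / u) * indicator {0<..<1} u * H u)) \<partial>lborel)"
      by (subst nn_integral_cmult, measurable, subst nn_integral_multc, measurable)
    also have "\<dots> \<le> (\<integral>\<^sup>+u. ennreal (K * C) * (enn_powr (ennreal (u powr a * logw u powr (b + 1 / r)) * G u) r * ennreal (1 / u) * indicator {0<..<1} u) \<partial>lborel)"
    proof (rule nn_integral_mono)
      fix u :: real
      show "ennreal K * ((\<integral>\<^sup>+t. indicator {0<..<1} t * ennreal (logw t powr (b * r) * hardy_kernel \<delta> t u / t) \<partial>lborel) * (ennreal (1 / u) * indicator {0<..<1} u * H u))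
        \<le> ennreal (K * C) * (enn_powr (ennreal (u powr a * logw u powr (b + 1 / r)) * G u) r * ennreal (1 / u) * indicator {0<..<1} u)"
      proof (cases "u \<in> {0<..<1}")
        case True
        have "enn_powr (ennreal (u powr a * logw u powr (b + 1 / r)) * G u) r
            = enn_powr (ennreal (logw u powr (b + 1 / r)) * (ennreal (u powr a) * G u)) r"
          by (simp add: ennreal_mult mult_ac)
        also have "\<dots> = ennreal (logw u powr (b * r + 1)) * H u"
          using r by (simp add: enn_powr_mult enn_powr_ennreal powr_powr H_def distrib_right)
        finally have eq: "enn_powr (ennreal (u powr a * logw u powr (b + 1 / r)) * G u) r = ennreal (logw u powr (b * r + 1)) * H u" .
        have "ennreal K * ((\<integral>\<^sup>+t. indicator {0<..<1} t * ennreal (logw t powr (b * r) * hardy_kernel \<delta> t u / t) \<partial>lborel) * (ennreal (1 / u) * indicator {0<..<1} u * H u))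
          \<le> ennreal K * (ennreal (C * logw u powr (b * r + 1)) * (ennreal (1 / u) * indicator {0<..<1} u * H u))"
          by (intro mult_left_mono mult_right_mono C(2) True) auto
        also have "\<dots> = ennreal (K * C) * (enn_powr (ennreal (u powr a * logw u powr (b + 1 / r)) * G u) r * ennreal (1 / u) * indicator {0<..<1} u)"
          unfolding eq using K C(1) by (simp add: ennreal_mult mult_ac)
        finally show ?thesis .
      qed simp
    qed
    also have "\<dots> = ennreal (K * C) * (\<integral>\<^sup>+u\<in>{0<..<1}. enn_powr (ennreal (u powr a * logw u powr (b + 1 / r)) * G u) r * ennreal (1 / u) \<partial>lborel)"
      by (intro nn_integral_cmult) measurable
    finally show ?thesis .
  qed
  moreover have "K * C > 0" using K C(1) by simp
  ultimately show ?thesis by blast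
qed

text \<open>The supremum \<open>N\<close> on the right bounds \<open>G u\<close> by
  \<open>N * u powr (- a) * logw u powr (- b)\<close>. The logarithm is evaluated at
  \<open>s\<close> instead of \<open>u\<close> at the price of
  \<open>(s / u) powr (\<delta> / 2)\<close>, and the remaining power
  \<open>u powr (\<delta> / 2 - 1)\<close> is integrable. Finally \<open>b < 0\<close> and the
  monotonicity of \<open>logw\<close> on \<open>(0, 1]\<close> replace \<open>logw t\<close> by
  \<open>logw s\<close>.\<close>

theorem hardy_weighted_sup:
  assumes a: "a < 1" and b: "b < 0"
  shows "\<exists>C>0. \<forall>G\<in>borel_measurable borel.
    (SUP t\<in>{0<..<1}. ennreal (logw t powr b) * hardy_sup a G t)
    \<le> ennreal C * (SUP u\<in>{0<..<1}. ennreal (u powr a * logw u powr b) * G u)"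
proof -
  define \<delta> where "\<delta> = 1 - a"
  have d: "0 < \<delta>" using a by (simp add: \<delta>_def)
  obtain C where C: "C > 0" "\<And>u s. 0 < u \<Longrightarrow> u \<le> s \<Longrightarrow> s \<le> 1 \<Longrightarrow>
      logw u powr (- b) \<le> C * (s / u) powr (\<delta> / 2) * logw s powr (- b)"
    using logw_slowly_varying[of "- b" "\<delta> / 2"] b d by auto
  define K where "K = C * (2 / \<delta>)"
  have K: "0 < K" using C(1) d by (simp add: K_def)
  have "ennreal (logw t powr b) * hardy_avg a G s \<le> ennreal K * N"
    if [measurable]: "G \<in> borel_measurable borel" and t: "0 < t" "t \<le> s" "s \<le> 1"
      and N: "N = (SUP u\<in>{0<..<1}. ennreal (u powr a * logw u powr b) * G u)" for G t s N
  proof -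
    have s: "0 < s" using t by simp
    let ?c = "C * s powr (\<delta> / 2) * logw s powr (- b)"
    have pt: "G u * indicator {0<..<s} u \<le> (ennreal ?c * N) * (indicator {0<..<s} u * ennreal (u powr (\<delta> / 2 - 1)))" for u
    proof (cases "u \<in> {0<..<s}")
      case True
      then have u: "0 < u" "u < 1" "u \<le> s" using t by auto
      have w0: "logw u \<noteq> 0" using logw_pos[of u] by linarith
      have "(u powr - a * logw u powr - b) * (u powr a * logw u powr b) = 1"
        using u w0 by (simp add: powr_minus field_simps)
      then have "G u = ennreal (u powr - a * logw u powr - b) * (ennreal (u powr a * logw u powr b) * G u)"
        by (simp add: mult.assoc[symmetric] flip: ennreal_mult)
      also have "\<dots> \<le> ennreal (u powr - a * logw u powr - b) * N"
        unfolding N using u by (intro mult_left_mono SUP_upper) auto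
      also have "\<dots> \<le> ennreal (?c * u powr (\<delta> / 2 - 1)) * N"
      proof (intro mult_right_mono ennreal_leI)
        have "u powr - a * logw u powr - b \<le> u powr - a * (C * (s / u) powr (\<delta> / 2) * logw s powr (- b))"
          using C(2)[of u s] u t by (intro mult_left_mono) auto
        also have "\<dots> = ?c * (u powr - a * u powr (- (\<delta> / 2)))"
          using u s by (simp add: powr_divide powr_minus field_simps)
        also have "u powr - a * u powr (- (\<delta> / 2)) = u powr (\<delta> / 2 - 1)"
        proof -
          have "- a + - (\<delta> / 2) = \<delta> / 2 - 1" by (simp add: \<delta>_def field_simps)
          then show ?thesis by (simp only: powr_add[symmetric])
        qed
        finally show "u powr - a * logw u powr - b \<le> ?c * u powr (\<delta> / 2 - 1)" .
      qed simp
      finally show ?thesis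
        using True C(1) by (simp add: ennreal_mult mult_ac)
    qed simp
    have "(\<integral>\<^sup>+u\<in>{0<..<s}. G u \<partial>lborel)
        \<le> (\<integral>\<^sup>+u. (ennreal ?c * N) * (indicator {0<..<s} u * ennreal (u powr (\<delta> / 2 - 1))) \<partial>lborel)"
      by (intro nn_integral_mono pt)
    also have "\<dots> = (ennreal ?c * N) * (\<integral>\<^sup>+u. indicator {0<..<s} u * ennreal (u powr (\<delta> / 2 - 1)) \<partial>lborel)"
      by (intro nn_integral_cmult) measurable
    also have "\<dots> \<le> (ennreal ?c * N) * ennreal (s powr (\<delta> / 2) / (\<delta> / 2))"
      using s d by (intro mult_left_mono nn_integral_powr_le) auto
    finally have "ennreal (logw t powr b) * hardy_avg a G s
       \<le> ennreal (logw t powr b) * (ennreal (s powr (a - 1)) * ((ennreal ?c * N) * ennreal (s powr (\<delta> / 2) / (\<delta> / 2))))"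
      unfolding hardy_avg_def by (intro mult_left_mono) auto
    also have "\<dots> = ennreal (logw t powr b * (s powr (a - 1) * ?c * (s powr (\<delta> / 2) / (\<delta> / 2)))) * N"
    proof -
      have "ennreal (logw t powr b * (s powr (a - 1) * ?c * (s powr (\<delta> / 2) / (\<delta> / 2))))
          = ennreal (logw t powr b) * (ennreal (s powr (a - 1)) * ennreal ?c * ennreal (s powr (\<delta> / 2) / (\<delta> / 2)))"
        using C(1) d by (simp add: zero_le_mult_iff flip: ennreal_mult)
      then show ?thesis by (simp only: mult_ac)
    qed
    also have "\<dots> \<le> ennreal K * N"
    proof (intro mult_right_mono ennreal_leI)
      have w0: "logw s \<noteq> 0" using logw_pos[of s] by linarith
      have "s powr (a - 1) * ?c * (s powr (\<delta> / 2) / (\<delta> / 2))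
          = K * logw s powr (- b) * (s powr (a - 1) * (s powr (\<delta> / 2) * s powr (\<delta> / 2)))"
        using d by (simp add: K_def field_simps)
      also have "s powr (a - 1) * (s powr (\<delta> / 2) * s powr (\<delta> / 2)) = 1"
        using s by (simp add: \<delta>_def flip: powr_add)
      finally have eq: "s powr (a - 1) * ?c * (s powr (\<delta> / 2) / (\<delta> / 2)) = K * logw s powr (- b)" by simp
      have "logw t powr b * (K * logw s powr (- b)) \<le> logw s powr b * (K * logw s powr (- b))"
        using K b logw_antimono[OF t] by (intro mult_right_mono powr_mono2') auto
      also have "\<dots> = K * (logw s powr b * logw s powr (- b))" by (simp only: mult_ac)
      also have "logw s powr b * logw s powr (- b) = 1" using w0 by (simp flip: powr_add)
      finally show "logw t powr b * (s powr (a - 1) * ?c * (s powr (\<delta> / 2) / (\<delta> / 2))) \<le> K"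
        unfolding eq by simp
    qed simp
    finally show ?thesis .
  qed
  then have "(SUP t\<in>{0<..<1}. ennreal (logw t powr b) * hardy_sup a G t)
    \<le> ennreal K * (SUP u\<in>{0<..<1}. ennreal (u powr a * logw u powr b) * G u)"
    if "G \<in> borel_measurable borel" for G
    using that unfolding hardy_sup_def by (auto simp: SUP_mult_left_ennreal intro!: SUP_least)
  with K show ?thesis by blast
qed

section \<open>Rearrangement of the fractional maximal function\<close>

lemma rearr_le_average:
  assumes "0 \<le> t"
  shows "ennreal t * rearr Q g t \<le> (\<integral>\<^sup>+s\<in>{0<..<t}. rearr Q g s \<partial>lborel)"
proof -
  have "ennreal t * rearr Q g t = (\<integral>\<^sup>+s. rearr Q g t * indicator {0<..<t} s \<partial>lborel)"
    using assms by (subst nn_integral_cmult_indicator) (auto simp: mult.commute)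
  also have "\<dots> \<le> (\<integral>\<^sup>+s\<in>{0<..<t}. rearr Q g s \<partial>lborel)"
    by (intro nn_integral_mono) (auto simp: indicator_def intro: rearr_antimono)
  finally show ?thesis .
qed

text \<open>A cube may have volume above 1, while the quasi-norms stop at 1. Beyond 1 the
  rearrangement is at most \<open>rearr Q g 1\<close>, which is at most its average over
  \<open>(0, 1)\<close>.\<close>

lemma nn_integral_rearr_le_unit:
  assumes "0 \<le> V"
  shows "(\<integral>\<^sup>+s\<in>{0<..<V}. rearr Q g s \<partial>lborel) \<le> ennreal (1 + V) * (\<integral>\<^sup>+s\<in>{0<..<1}. rearr Q g s \<partial>lborel)"
proof -
  let ?I = "\<integral>\<^sup>+s\<in>{0<..<1}. rearr Q g s \<partial>lborel"
  have "(\<integral>\<^sup>+s\<in>{0<..<V}. rearr Q g s \<partial>lborel)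
    \<le> (\<integral>\<^sup>+s. rearr Q g s * indicator {0<..<1} s + rearr Q g 1 * indicator {0<..<V} s \<partial>lborel)"
  proof (rule nn_integral_mono)
    fix s :: real
    show "rearr Q g s * indicator {0<..<V} s \<le> rearr Q g s * indicator {0<..<1} s + rearr Q g 1 * indicator {0<..<V} s"
      by (cases "s < 1") (auto simp: indicator_def intro: rearr_antimono)
  qed
  also have "\<dots> = ?I + rearr Q g 1 * ennreal V"
    using assms by (subst nn_integral_add) (auto simp: nn_integral_cmult_indicator)
  also have "\<dots> \<le> ?I + ?I * ennreal V"
    using rearr_le_average[of 1 Q g] by (intro add_left_mono mult_right_mono) auto
  also have "\<dots> = ennreal (1 + V) * ?I"
    using assms by (simp add: distrib_right mult.commute[of _ "ennreal V"])
  finally show ?thesis .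
qed

lemma hardy_avg_le_sup: "t \<le> s \<Longrightarrow> s \<le> 1 \<Longrightarrow> hardy_avg a G s \<le> hardy_sup a G t"
  unfolding hardy_sup_def by (intro SUP_upper) auto

lemma hardy_avg_1: "hardy_avg a G 1 = (\<integral>\<^sup>+s\<in>{0<..<1}. G s \<partial>lborel)"
  by (simp add: hardy_avg_def)

lemma emeasure_lebesgue_cube:
  "0 \<le> l \<Longrightarrow> emeasure lebesgue (cube a l) = ennreal (l ^ CARD('n))" for a :: "real ^ 'n::finite"
  by (simp add: emeasure_cube)

text \<open>The integral over the whole cube is governed by \<open>hardy_avg\<close> at
  \<open>s = 1\<close>, where the power factor is 1 for every exponent \<open>p\<close>.\<close>

lemma nn_integral_cube_le_hardy:
  fixes g :: "real ^ 'n::finite \<Rightarrow> ennreal" and a :: "real ^ 'n"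
  assumes [measurable]: "g \<in> borel_measurable lebesgue" and L: "0 < L" and t: "t \<le> 1"
  shows "(\<integral>\<^sup>+y\<in>cube a L. g y \<partial>lebesgue) \<le> ennreal (1 + L ^ CARD('n)) * hardy_sup p (rearr (cube a L) g) t"
proof -
  have "(\<integral>\<^sup>+y\<in>cube a L. g y \<partial>lebesgue) \<le> (\<integral>\<^sup>+s\<in>{0<..<L ^ CARD('n)}. rearr (cube a L) g s \<partial>lborel)"
    using L by (intro nn_integral_le_rearr) (auto simp del: emeasure_completion simp: emeasure_lebesgue_cube)
  also have "\<dots> \<le> ennreal (1 + L ^ CARD('n)) * hardy_avg p (rearr (cube a L) g) 1"
    using L by (simp add: hardy_avg_1 nn_integral_rearr_le_unit del: ennreal_plus)
  also have "\<dots> \<le> ennreal (1 + L ^ CARD('n)) * hardy_sup p (rearr (cube a L) g) t"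
    using t by (intro mult_left_mono hardy_avg_le_sup) auto
  finally show ?thesis .
qed

text \<open>Outside a set of measure \<open>t\<close> the fractional averages over all cubes through a point are
  controlled: large cubes by the rearrangement directly, small cubes by splitting \<open>g\<close> at the
  height \<open>g\<^sup>*(t)\<close> and applying the weak type inequality to the upper part.\<close>

theorem fractional_maximal_rearr:
  fixes g :: "real ^ 'n::finite \<Rightarrow> ennreal" and a :: "real ^ 'n"
  assumes [measurable]: "g \<in> borel_measurable lebesgue" and L: "0 < L" and t: "0 < t" "t < 1"
    and k: "k < CARD('n)"
  defines "T \<equiv> hardy_sup (real k / real CARD('n)) (rearr (cube a L) g) t"
  shows "\<exists>B\<in>sets lebesgue. emeasure lebesgue B \<le> ennreal t \<and>
    (\<forall>x c l. x \<notin> B \<longrightarrow> 0 < l \<longrightarrow> x \<in> cube c l \<longrightarrow> cube c l \<subseteq> cube a L \<longrightarrow>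
      ennreal (l ^ k) * (\<integral>\<^sup>+y\<in>cube c l. g y \<partial>lebesgue)
        \<le> ennreal ((10 * real CARD('n)) ^ CARD('n) + 1 + L ^ CARD('n)) * T * ennreal (l ^ CARD('n)))"
proof -
  let ?d = "CARD('n)" and ?Q = "cube a L"
  let ?p = "real k / real ?d"
  \<comment> \<open>The weak type constant. In the final constant it accounts for the part of
    \<open>g\<close> above the height \<open>G t\<close>, the 1 for the height itself, and
    \<open>1 + L ^ d\<close> for the cubes of volume at least 1.\<close>
  let ?c = "(10 * real ?d) ^ ?d"
  define G where "G = rearr ?Q g"
  define \<Phi> where "\<Phi> s = (\<integral>\<^sup>+u\<in>{0<..<s}. G u \<partial>lborel)" for s
  define g1 where "g1 x = (if x \<in> ?Q \<and> G t < g x then g x else 0)" for x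
  have [measurable]: "?Q \<in> sets lebesgue" by simp
  have S [measurable]: "{x \<in> ?Q. G t < g x} \<in> sets lebesgue" by measurable
  have [measurable]: "g1 \<in> borel_measurable lebesgue" unfolding g1_def by measurable
  have g1: "(\<integral>\<^sup>+y\<in>?Q. g1 y \<partial>lebesgue) \<le> \<Phi> t"
  proof -
    have "(\<integral>\<^sup>+y\<in>?Q. g1 y \<partial>lebesgue) = (\<integral>\<^sup>+y\<in>{x \<in> ?Q. G t < g x}. g y \<partial>lebesgue)"
      by (intro nn_integral_cong) (auto simp: g1_def indicator_def)
    also have "\<dots> \<le> \<Phi> t"
      unfolding \<Phi>_def G_def
      by (rule nn_integral_le_rearr)
        (use S[unfolded G_def] emeasure_superlevel_rearr[of g ?Q t] in auto)
    finally show ?thesis .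
  qed
  have T1: "\<Phi> 1 \<le> T"
    using hardy_avg_le_sup[of t 1 ?p G] t by (simp add: T_def G_def[symmetric] hardy_avg_1 \<Phi>_def)
  have Ts: "ennreal (s powr (?p - 1)) * \<Phi> s \<le> T" if "t \<le> s" "s \<le> 1" for s
    using hardy_avg_le_sup[OF that, of ?p G] by (simp add: T_def G_def[symmetric] hardy_avg_def \<Phi>_def)
  \<comment> \<open>The threshold at which the weak type inequality, with \<open>\<Phi> t\<close>
    bounding the total mass of \<open>g1\<close>, yields an exceptional set of measure at most
    \<open>t\<close>.\<close>
  define \<mu> where "\<mu> = ennreal (?c / t) * \<Phi> t"
  define A where "A = {x. \<exists>c l. 0 < l \<and> x \<in> cube c l \<and> cube c l \<subseteq> ?Q \<and>
      \<mu> * ennreal (l ^ ?d) < (\<integral>\<^sup>+y\<in>cube c l. g1 y \<partial>lebesgue)}"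
  have "\<exists>B\<in>sets lebesgue. A \<subseteq> B \<and> \<mu> * emeasure lebesgue B \<le> ennreal ?c * (\<integral>\<^sup>+y\<in>?Q. g1 y \<partial>lebesgue)"
  proof (rule cube_maximal_weak_type[where L = L])
    fix x assume "x \<in> A"
    then obtain c l where cl: "0 < l" "x \<in> cube c l" "cube c l \<subseteq> ?Q"
        "\<mu> * ennreal (l ^ ?d) < (\<integral>\<^sup>+y\<in>cube c l. g1 y \<partial>lebesgue)"
      unfolding A_def by blast
    have "l \<le> L"
      using cl(1,3) by (auto simp: cube_def subset_interval_cart dest!: spec[of _ "undefined"])
    then show "\<exists>c l. 0 < l \<and> l \<le> L \<and> x \<in> cube c l \<and> cube c l \<subseteq> ?Q \<and>
        \<mu> * ennreal (l ^ ?d) \<le> (\<integral>\<^sup>+y\<in>cube c l. g1 y \<partial>lebesgue)"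
      using cl less_imp_le by blast
  qed auto
  then obtain B where B: "B \<in> sets lebesgue" "A \<subseteq> B"
      "\<mu> * emeasure lebesgue B \<le> ennreal ?c * (\<integral>\<^sup>+y\<in>?Q. g1 y \<partial>lebesgue)"
    by blast
  have "\<exists>B\<in>sets lebesgue. A \<subseteq> B \<and> emeasure lebesgue B \<le> ennreal t"
  \<comment> \<open>In these two cases \<open>\<mu>\<close> cannot be cancelled, but
    \<open>A\<close> is empty: nothing exceeds an infinite threshold, and \<open>g1\<close> has
    integral 0 if \<open>\<Phi> t\<close> vanishes.\<close>
  proof (cases "\<Phi> t = 0 \<or> \<Phi> t = \<infinity>")
    case True
    have "A = {}"
    proof (rule ccontr)
      assume "A \<noteq> {}"
      then obtain x c l where cl: "0 < l" "x \<in> cube c l" "cube c l \<subseteq> ?Q"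
          "\<mu> * ennreal (l ^ ?d) < (\<integral>\<^sup>+y\<in>cube c l. g1 y \<partial>lebesgue)"
        unfolding A_def by blast
      from True show False
      proof
        assume "\<Phi> t = 0"
        have "(\<integral>\<^sup>+y\<in>cube c l. g1 y \<partial>lebesgue) \<le> (\<integral>\<^sup>+y\<in>?Q. g1 y \<partial>lebesgue)"
          using cl(3) by (intro nn_integral_mono mult_left_mono) (auto simp: indicator_def)
        with g1 \<open>\<Phi> t = 0\<close> cl(4) show False by simp
      next
        assume "\<Phi> t = \<infinity>"
        moreover have "0 < ?c / t" using t by simp
        ultimately have "\<mu> = \<infinity>"
          using t by (simp add: \<mu>_def ennreal_mult_top)
        then show False using cl by (simp add: ennreal_top_mult)
      qed
    qed
    then show ?thesis by (intro bexI[of _ "{}"]) auto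
  next
    case False
    then obtain \<phi> where \<phi>: "0 < \<phi>" "\<Phi> t = ennreal \<phi>"
      by (cases "\<Phi> t") (auto simp: less_le)
    have "\<mu> * emeasure lebesgue B \<le> ennreal ?c * \<Phi> t"
      using B(3) g1 by (meson mult_left_mono order_trans zero_le)
    also have "\<dots> = \<mu> * ennreal t"
      using t \<phi> by (simp add: \<mu>_def flip: ennreal_mult)
    finally have "\<mu> * emeasure lebesgue B \<le> \<mu> * ennreal t" .
    moreover have "\<mu> = ennreal (?c / t * \<phi>)" "0 < ?c / t * \<phi>"
      using t \<phi> by (auto simp: \<mu>_def simp flip: ennreal_mult)
    then have "\<mu> \<noteq> 0" "\<mu> \<noteq> top"
      by (metis ennreal_eq_0_iff not_le, simp)
    ultimately have "emeasure lebesgue B \<le> ennreal t"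
      using ennreal_mult_le_mult_iff by blast
    with B show ?thesis by blast
  qed
  then obtain B where B: "B \<in> sets lebesgue" "A \<subseteq> B" "emeasure lebesgue B \<le> ennreal t" by blast
  have "ennreal (l ^ k) * (\<integral>\<^sup>+y\<in>cube c l. g y \<partial>lebesgue) \<le> ennreal (?c + 1 + L ^ ?d) * T * ennreal (l ^ ?d)"
    if x: "x \<notin> B" and l: "0 < l" "x \<in> cube c l" "cube c l \<subseteq> ?Q" for x c l
  proof -
    have cl_le: "(\<integral>\<^sup>+y\<in>cube c l. g y \<partial>lebesgue) \<le> (\<integral>\<^sup>+y\<in>?Q. g y \<partial>lebesgue)"
      using l by (intro nn_integral_mono mult_left_mono) (auto simp: indicator_def)
    \<comment> \<open>For volume at least 1, \<open>l ^ k \<le> l ^ d\<close> and the integral over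
      all of \<open>?Q\<close> suffices. For volume between \<open>t\<close> and 1 the volume is an
      admissible \<open>s\<close> in the supremum \<open>T\<close>. For volume below
      \<open>t\<close>, \<open>g\<close> is split at the height \<open>G t\<close> and
      \<open>l ^ k \<le> t powr ?p\<close>.\<close>
    consider "1 \<le> l ^ ?d" | "t \<le> l ^ ?d" "l ^ ?d < 1" | "l ^ ?d < t" by linarith
    then show ?thesis
    proof cases
      case 1
      then have "1 \<le> l"
        using l(1) power_less_one_iff[of l ?d] by (metis less_imp_le not_le zero_less_card_finite)
      then have "l ^ k \<le> l ^ ?d" using k by (intro power_increasing) auto
      then have "ennreal (l ^ k) * (\<integral>\<^sup>+y\<in>cube c l. g y \<partial>lebesgue)
         \<le> ennreal (l ^ ?d) * (ennreal (1 + L ^ ?d) * T)"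
        unfolding T_def using cl_le t L
        by (intro mult_mono ennreal_leI order_trans[OF cl_le nn_integral_cube_le_hardy]) auto
      also have "\<dots> \<le> ennreal (l ^ ?d) * (ennreal (?c + 1 + L ^ ?d) * T)"
        by (intro mult_left_mono mult_right_mono ennreal_leI) auto
      finally show ?thesis by (simp only: mult_ac)
    next
      case 2
      have "(\<integral>\<^sup>+y\<in>cube c l. g y \<partial>lebesgue) \<le> \<Phi> (l ^ ?d)"
        unfolding \<Phi>_def G_def using l
        by (intro nn_integral_le_rearr) (auto simp del: emeasure_completion simp: emeasure_lebesgue_cube)
      then have "ennreal (l ^ k) * (\<integral>\<^sup>+y\<in>cube c l. g y \<partial>lebesgue) \<le> ennreal (l ^ k) * \<Phi> (l ^ ?d)"
        by (rule mult_left_mono) simp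
      also have "\<dots> = ennreal ((l ^ ?d) powr (?p - 1)) * \<Phi> (l ^ ?d) * ennreal (l ^ ?d)"
      proof -
        have "(l ^ ?d) powr (?p - 1) * l ^ ?d = (l ^ ?d) powr ((?p - 1) + 1)"
          using l by (simp only: powr_add) simp
        also have "\<dots> = l ^ k"
          using l by (simp add: powr_realpow[symmetric] powr_powr)
        finally have "ennreal (l ^ k) = ennreal ((l ^ ?d) powr (?p - 1)) * ennreal (l ^ ?d)"
          using l by (simp flip: ennreal_mult)
        then show ?thesis by (simp only: mult_ac)
      qed
      also have "\<dots> \<le> T * ennreal (l ^ ?d)"
        using 2 by (intro mult_right_mono Ts) auto
      also have "\<dots> \<le> ennreal (?c + 1 + L ^ ?d) * T * ennreal (l ^ ?d)"
      proof (intro mult_right_mono)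
        have "ennreal 1 * T \<le> ennreal (?c + 1 + L ^ ?d) * T"
          using L by (intro mult_right_mono ennreal_leI) auto
        then show "T \<le> ennreal (?c + 1 + L ^ ?d) * T" by simp
      qed simp
      finally show ?thesis .
    next
      case 3
      have "x \<notin> A" using x B(2) by blast
      then have small: "(\<integral>\<^sup>+y\<in>cube c l. g1 y \<partial>lebesgue) \<le> \<mu> * ennreal (l ^ ?d)"
      proof (rule contrapos_np)
        assume "\<not> (\<integral>\<^sup>+y\<in>cube c l. g1 y \<partial>lebesgue) \<le> \<mu> * ennreal (l ^ ?d)"
        then show "x \<in> A"
          unfolding A_def using l by (intro CollectI exI[of _ c] exI[of _ l]) (simp add: not_le)
      qed
      have "(\<integral>\<^sup>+y\<in>cube c l. g y \<partial>lebesgue) \<le> (\<integral>\<^sup>+y. g1 y * indicator (cube c l) y + G t * indicator (cube c l) y \<partial>lebesgue)"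
        using l(3) by (intro nn_integral_mono) (auto simp: g1_def indicator_def not_less)
      also have "\<dots> = (\<integral>\<^sup>+y\<in>cube c l. g1 y \<partial>lebesgue) + G t * ennreal (l ^ ?d)"
        using l by (subst nn_integral_add)
          (auto intro!: borel_measurable_times_ennreal borel_measurable_indicator simp: nn_integral_cmult_indicator emeasure_lebesgue_cube simp del: emeasure_completion)
      also have "\<dots> \<le> \<mu> * ennreal (l ^ ?d) + G t * ennreal (l ^ ?d)"
        by (intro add_right_mono small)
      also have "\<dots> = (\<mu> + G t) * ennreal (l ^ ?d)" by (simp add: distrib_right)
      finally have split: "(\<integral>\<^sup>+y\<in>cube c l. g y \<partial>lebesgue) \<le> (\<mu> + G t) * ennreal (l ^ ?d)" .
      have "\<mu> + G t \<le> \<mu> + ennreal (1 / t) * \<Phi> t"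
      proof -
        have "ennreal (1 / t) * (ennreal t * G t) \<le> ennreal (1 / t) * \<Phi> t"
          unfolding \<Phi>_def G_def using t by (intro mult_left_mono rearr_le_average) auto
        moreover have "ennreal (1 / t) * (ennreal t * G t) = G t"
          using t by (simp add: mult.assoc[symmetric] flip: ennreal_mult)
        ultimately show ?thesis by (simp add: add_left_mono)
      qed
      also have "\<dots> = ennreal ((?c + 1) / t) * \<Phi> t"
        using t by (simp add: \<mu>_def add_divide_distrib distrib_right)
      finally have "(\<mu> + G t) * ennreal (l ^ ?d) \<le> ennreal ((?c + 1) / t) * \<Phi> t * ennreal (l ^ ?d)"
        by (rule mult_right_mono) simp
      with split have avg: "(\<integral>\<^sup>+y\<in>cube c l. g y \<partial>lebesgue) \<le> ennreal ((?c + 1) / t) * \<Phi> t * ennreal (l ^ ?d)"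
        by (rule order_trans)
      have "ennreal (l ^ k) * (\<integral>\<^sup>+y\<in>cube c l. g y \<partial>lebesgue)
          \<le> ennreal (t powr ?p) * (ennreal ((?c + 1) / t) * \<Phi> t * ennreal (l ^ ?d))"
      proof (intro mult_mono ennreal_leI avg)
        have "l ^ k = (l ^ ?d) powr ?p"
          using l by (simp add: powr_realpow[symmetric] powr_powr)
        also have "\<dots> \<le> t powr ?p"
          using 3 l by (intro powr_mono2) auto
        finally show "l ^ k \<le> t powr ?p" .
      qed auto
      also have "\<dots> = ennreal (?c + 1) * (ennreal (t powr (?p - 1)) * \<Phi> t) * ennreal (l ^ ?d)"
      proof -
        have "ennreal (t powr ?p) * ennreal ((?c + 1) / t) = ennreal (?c + 1) * ennreal (t powr (?p - 1))"
          using t by (simp add: powr_diff mult.commute del: ennreal_plus flip: ennreal_mult)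
        then show ?thesis by (metis mult.assoc)
      qed
      also have "\<dots> \<le> ennreal (?c + 1) * T * ennreal (l ^ ?d)"
        using t by (intro mult_right_mono mult_left_mono Ts) auto
      also have "\<dots> \<le> ennreal (?c + 1 + L ^ ?d) * T * ennreal (l ^ ?d)"
        using L by (intro mult_right_mono ennreal_leI) auto
      finally show ?thesis .
    qed
  qed
  with B(1,3) show ?thesis by blast
qed

section \<open>Weighted quasi-norms\<close>

text \<open>The quasi-norm of \<open>F\<close> in \<open>L\<^sup>r((0, 1), dt / t)\<close> with weight \<open>\<omega>\<close>; for rearrangements \<open>F\<close> and
  \<open>\<omega> t = t powr (1/p) * (1 + \<bar>ln t\<bar>) powr b\<close> it is the Lorentz--Zygmund quasi-norm.\<close>

definition weighted_norm :: "ennreal \<Rightarrow> (real \<Rightarrow> real) \<Rightarrow> (real \<Rightarrow> ennreal) \<Rightarrow> ennreal" where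
  "weighted_norm r \<omega> F =
     (if r = \<infinity> then (SUP t \<in> {0<..<1}. ennreal (\<omega> t) * F t)
      else enn_powr
        (\<integral>\<^sup>+t\<in>{0<..<1}. enn_powr (ennreal (\<omega> t) * F t) (enn2real r) * ennreal (1 / t) \<partial>lborel)
        (recip r))"

lemma lz_norm_eq_weighted_norm:
  "lz_norm p r b Q g = weighted_norm r (\<lambda>t. t powr recip p * logw t powr b) (rearr Q g)"
  by (simp add: lz_norm_def weighted_norm_def lz_weighted_def logw_def)

lemma recip_eq: "1 \<le> r \<Longrightarrow> r \<noteq> \<infinity> \<Longrightarrow> recip r = 1 / enn2real r \<and> 1 \<le> enn2real r"
  by (cases r) (auto simp: recip_def inverse_ennreal divide_inverse)

lemma recip_nonneg [simp]: "0 \<le> recip r"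
  by (simp add: recip_def)

lemma weighted_norm_mono:
  assumes "\<And>t. t \<in> {0<..<1} \<Longrightarrow> ennreal (\<omega> t) * F t \<le> ennreal (\<omega>' t) * G t"
  shows "weighted_norm r \<omega> F \<le> weighted_norm r \<omega>' G"
proof (cases "r = \<infinity>")
  case True
  then show ?thesis
    unfolding weighted_norm_def if_P[OF True] using assms by (intro SUP_mono) blast
next
  case False
  have "enn_powr (ennreal (\<omega> t) * F t) (enn2real r) * ennreal (1 / t) * indicator {0<..<1} t
      \<le> enn_powr (ennreal (\<omega>' t) * G t) (enn2real r) * ennreal (1 / t) * indicator {0<..<1} t" for t
    using assms[of t] by (cases "t \<in> {0<..<1}") (auto intro!: mult_right_mono enn_powr_mono)
  then show ?thesis
    using False by (simp add: weighted_norm_def enn_powr_mono nn_integral_mono)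
qed

lemma weighted_norm_cmult:
  assumes r: "1 \<le> r" and c: "0 \<le> c" and [measurable]: "F \<in> borel_measurable borel" "\<omega> \<in> borel_measurable borel"
  shows "weighted_norm r \<omega> (\<lambda>t. ennreal c * F t) = ennreal c * weighted_norm r \<omega> F"
proof (cases "r = \<infinity>")
  case True
  then show ?thesis
    by (simp add: weighted_norm_def SUP_mult_left_ennreal mult.left_commute)
next
  case False
  define q where "q = enn2real r"
  have q: "1 \<le> q" "recip r = 1 / q" using recip_eq[OF r False] by (auto simp: q_def)
  have "enn_powr (ennreal (\<omega> t) * (ennreal c * F t)) q * ennreal (1 / t) * indicator {0<..<1} t
      = enn_powr (ennreal c) q * (enn_powr (ennreal (\<omega> t) * F t) q * ennreal (1 / t) * indicator {0<..<1} t)" for t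
    using q enn_powr_mult[of q c "ennreal (\<omega> t) * F t"] by (simp add: mult_ac)
  then have "weighted_norm r \<omega> (\<lambda>t. ennreal c * F t) = enn_powr (enn_powr (ennreal c) q *
      (\<integral>\<^sup>+t\<in>{0<..<1}. enn_powr (ennreal (\<omega> t) * F t) q * ennreal (1 / t) \<partial>lborel)) (1 / q)"
    using False q by (simp add: weighted_norm_def q_def[symmetric] nn_integral_cmult)
  also have "\<dots> = enn_powr (enn_powr (ennreal c) q) (1 / q) *
      enn_powr (\<integral>\<^sup>+t\<in>{0<..<1}. enn_powr (ennreal (\<omega> t) * F t) q * ennreal (1 / t) \<partial>lborel) (1 / q)"
    unfolding enn_powr_ennreal[OF c] using q by (intro enn_powr_mult) auto
  finally show ?thesis
    using False q by (simp add: weighted_norm_def q_def[symmetric] enn_powr_powr)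
qed

text \<open>The sum is at most \<open>card A\<close> times its largest term. This argument works for
  every \<open>a > 0\<close>, hence for the power \<open>q\<close> inside the integral as well as
  for \<open>1 / q\<close> outside.\<close>

lemma enn_powr_sum_le:
  assumes "finite A" "0 < a"
  shows "enn_powr (sum x A) a \<le> ennreal (real (card A) powr a) * (\<Sum>i\<in>A. enn_powr (x i) a)"
proof (cases "A = {}")
  case False
  define M where "M = Max (x ` A)"
  have "M \<in> x ` A" unfolding M_def using assms False by (intro Max_in) auto
  then obtain i where i: "i \<in> A" "M = x i" by blast
  have "sum x A \<le> of_nat (card A) * M"
    by (rule sum_bounded_above) (use assms in \<open>auto simp: M_def\<close>)
  then have "enn_powr (sum x A) a \<le> enn_powr (ennreal (real (card A)) * x i) a"
    using assms i by (intro enn_powr_mono) (auto simp: ennreal_of_nat_eq_real_of_nat)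
  also have "\<dots> = ennreal (real (card A) powr a) * enn_powr (x i) a"
    using assms by (simp add: enn_powr_mult enn_powr_ennreal)
  also have "\<dots> \<le> ennreal (real (card A) powr a) * (\<Sum>i\<in>A. enn_powr (x i) a)"
    using assms i by (intro mult_left_mono member_le_sum) auto
  finally show ?thesis .
qed simp

lemma weighted_norm_sum:
  assumes r: "1 \<le> r" and A: "finite A" and F: "\<And>i. i \<in> A \<Longrightarrow> F i \<in> borel_measurable borel"
    and [measurable]: "\<omega> \<in> borel_measurable borel"
  shows "weighted_norm r \<omega> (\<lambda>t. \<Sum>i\<in>A. F i t) \<le> ennreal (real (card A) * (real (card A) + 1)) * (\<Sum>i\<in>A. weighted_norm r \<omega> (F i))"
proof (cases "A = {}")
  case True
  then show ?thesis by (simp add: weighted_norm_def enn_powr_def)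
next
  case ne: False
  let ?n = "real (card A)"
  have n: "1 \<le> ?n" using ne A by (simp add: Suc_leI card_gt_0_iff)
  show ?thesis
  proof (cases "r = \<infinity>")
    case True
    have "weighted_norm r \<omega> (\<lambda>t. \<Sum>i\<in>A. F i t) \<le> (\<Sum>i\<in>A. weighted_norm r \<omega> (F i))"
      using True unfolding weighted_norm_def
      by (auto simp: sum_distrib_left intro!: SUP_least sum_mono SUP_upper)
    also have "\<dots> \<le> ennreal (?n * (?n + 1)) * (\<Sum>i\<in>A. weighted_norm r \<omega> (F i))"
    proof -
      have "1 * 1 \<le> ?n * (?n + 1)" using n by (intro mult_mono) auto
      then have "ennreal 1 \<le> ennreal (?n * (?n + 1))" by (intro ennreal_leI) simp
      from mult_right_mono[OF this, of "\<Sum>i\<in>A. weighted_norm r \<omega> (F i)"] show ?thesis by simp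
    qed
    finally show ?thesis .
  next
    case False
    define q where "q = enn2real r"
    have q: "1 \<le> q" "recip r = 1 / q" using recip_eq[OF r False] by (auto simp: q_def)
    define I where "I f = (\<integral>\<^sup>+t\<in>{0<..<1}. enn_powr (ennreal (\<omega> t) * f t) q * ennreal (1 / t) \<partial>lborel)" for f
    have w: "weighted_norm r \<omega> f = enn_powr (I f) (1 / q)" for f
      using False q by (simp add: weighted_norm_def I_def q_def[symmetric])
    have "I (\<lambda>t. \<Sum>i\<in>A. F i t) \<le> (\<integral>\<^sup>+t. (\<Sum>i\<in>A. ennreal (?n powr q) * (enn_powr (ennreal (\<omega> t) * F i t) q * ennreal (1 / t) * indicator {0<..<1} t)) \<partial>lborel)"
      unfolding I_def
    proof (rule nn_integral_mono)
      fix t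
      have "enn_powr (ennreal (\<omega> t) * (\<Sum>i\<in>A. F i t)) q * (ennreal (1 / t) * indicator {0<..<1} t)
         \<le> (ennreal (?n powr q) * (\<Sum>i\<in>A. enn_powr (ennreal (\<omega> t) * F i t) q)) * (ennreal (1 / t) * indicator {0<..<1} t)"
        unfolding sum_distrib_left[of "ennreal (\<omega> t)"] using A q by (intro mult_right_mono enn_powr_sum_le) auto
      then show "enn_powr (ennreal (\<omega> t) * (\<Sum>i\<in>A. F i t)) q * ennreal (1 / t) * indicator {0<..<1} t
         \<le> (\<Sum>i\<in>A. ennreal (?n powr q) * (enn_powr (ennreal (\<omega> t) * F i t) q * ennreal (1 / t) * indicator {0<..<1} t))"
        by (simp add: sum_distrib_left sum_distrib_right mult.assoc)
    qed
    also have "\<dots> = (\<Sum>i\<in>A. ennreal (?n powr q) * I (F i))"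
    proof (subst nn_integral_sum)
      show "(\<lambda>t. ennreal (?n powr q) * (enn_powr (ennreal (\<omega> t) * F i t) q * ennreal (1 / t) * indicator {0<..<1} t)) \<in> borel_measurable lborel"
        if "i \<in> A" for i
      proof -
        have [measurable]: "F i \<in> borel_measurable borel" using F that .
        show ?thesis by measurable
      qed
      show "(\<Sum>i\<in>A. \<integral>\<^sup>+t. ennreal (?n powr q) * (enn_powr (ennreal (\<omega> t) * F i t) q * ennreal (1 / t) * indicator {0<..<1} t) \<partial>lborel)
         = (\<Sum>i\<in>A. ennreal (?n powr q) * I (F i))"
      proof (rule sum.cong)
        fix i assume "i \<in> A"
        then have [measurable]: "F i \<in> borel_measurable borel" using F by simp
        show "(\<integral>\<^sup>+t. ennreal (?n powr q) * (enn_powr (ennreal (\<omega> t) * F i t) q * ennreal (1 / t) * indicator {0<..<1} t) \<partial>lborel)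
          = ennreal (?n powr q) * I (F i)"
          unfolding I_def by (rule nn_integral_cmult) measurable
      qed simp
    qed
    finally have "I (\<lambda>t. \<Sum>i\<in>A. F i t) \<le> ennreal (?n powr q) * (\<Sum>i\<in>A. I (F i))"
      by (simp add: sum_distrib_left)
    then have "weighted_norm r \<omega> (\<lambda>t. \<Sum>i\<in>A. F i t) \<le> enn_powr (ennreal (?n powr q) * (\<Sum>i\<in>A. I (F i))) (1 / q)"
      unfolding w using q by (intro enn_powr_mono) auto
    also have "\<dots> = ennreal ?n * enn_powr (\<Sum>i\<in>A. I (F i)) (1 / q)"
      using q by (simp add: enn_powr_mult enn_powr_ennreal powr_powr)
    also have "\<dots> \<le> ennreal ?n * (ennreal (?n powr (1 / q)) * (\<Sum>i\<in>A. enn_powr (I (F i)) (1 / q)))"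
      using q A by (intro mult_left_mono enn_powr_sum_le) auto
    \<comment> \<open>Makes the constant independent of \<open>q\<close>.\<close>
    also have "\<dots> \<le> ennreal ?n * (ennreal (?n + 1) * (\<Sum>i\<in>A. enn_powr (I (F i)) (1 / q)))"
    proof (intro mult_left_mono mult_right_mono ennreal_leI)
      have "?n powr (1 / q) \<le> ?n powr 1" using n q by (intro powr_mono) auto
      then show "?n powr (1 / q) \<le> ?n + 1" using n by simp
    qed auto
    also have "\<dots> = ennreal (?n * (?n + 1)) * (\<Sum>i\<in>A. weighted_norm r \<omega> (F i))"
      by (simp add: w ennreal_mult mult.assoc del: ennreal_plus)
    finally show ?thesis .
  qed
qed

text \<open>Used in the contrapositive: together with the Hardy inequality it excludes an infinite
  \<open>hardy_sup\<close> for functions of finite quasi-norm.\<close>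

lemma weighted_norm_top:
  assumes r: "1 \<le> r" and \<omega>: "\<And>t. t \<in> {0<..<1} \<Longrightarrow> 0 < \<omega> t"
  shows "weighted_norm r \<omega> (\<lambda>_. \<infinity>) = \<infinity>"
proof -
  have *: "ennreal (\<omega> t) * \<infinity> = \<infinity>" if "t \<in> {0<..<1}" for t
    using \<omega>[OF that] by (simp add: ennreal_mult_top)
  show ?thesis
  proof (cases "r = \<infinity>")
    case True
    have "ennreal (\<omega> (1 / 2)) * \<infinity> \<le> weighted_norm r \<omega> (\<lambda>_. \<infinity>)"
      using True unfolding weighted_norm_def by (auto intro: SUP_upper)
    then show ?thesis using *[of "1 / 2"] by (simp add: top_unique)
  next
    case False
    have "(\<integral>\<^sup>+t\<in>{0<..<1}. enn_powr (ennreal (\<omega> t) * \<infinity>) (enn2real r) * ennreal (1 / t) \<partial>lborel)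
       = (\<integral>\<^sup>+t. \<infinity> * indicator {0<..<1::real} t \<partial>lborel)"
    proof (rule nn_integral_cong)
      fix t :: real
      show "enn_powr (ennreal (\<omega> t) * \<infinity>) (enn2real r) * ennreal (1 / t) * indicator {0<..<1} t = \<infinity> * indicator {0<..<1} t"
        using *[of t] by (cases "t \<in> {0<..<1}") (auto simp: ennreal_top_mult)
    qed
    also have "\<dots> = \<infinity>" by (subst nn_integral_cmult_indicator) (auto simp: ennreal_top_mult)
    finally show ?thesis using False by (simp add: weighted_norm_def)
  qed
qed

lemma hardy_sup_antimono: "s \<le> t \<Longrightarrow> hardy_sup a G t \<le> hardy_sup a G s"
  unfolding hardy_sup_def by (intro SUP_subset_mono) auto

lemma weighted_norm_hardy:
  assumes a: "a < 1" and r: "1 \<le> r" and b: "b < - recip r"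
  shows "\<exists>C>0. \<forall>G\<in>borel_measurable borel.
    weighted_norm r (\<lambda>t. logw t powr b) (hardy_sup a G)
    \<le> ennreal C * weighted_norm r (\<lambda>u. u powr a * logw u powr (b + recip r)) G"
proof (cases "r = \<infinity>")
  case True
  then have "recip r = 0" by (simp add: recip_def)
  then show ?thesis
    using True hardy_weighted_sup[OF a, of b] b by (simp add: weighted_norm_def)
next
  case False
  define q where "q = enn2real r"
  have q: "1 \<le> q" "recip r = 1 / q" using recip_eq[OF r False] by (auto simp: q_def)
  obtain C where C: "C > 0" "\<And>G. G \<in> borel_measurable borel \<Longrightarrow>
    (\<integral>\<^sup>+t\<in>{0<..<1}. enn_powr (ennreal (logw t powr b) * hardy_sup a G t) q * ennreal (1 / t) \<partial>lborel)
    \<le> ennreal C * (\<integral>\<^sup>+u\<in>{0<..<1}. enn_powr (ennreal (u powr a * logw u powr (b + 1 / q)) * G u) q * ennreal (1 / u) \<partial>lborel)"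
    using hardy_weighted[OF a q(1), of b] b q(2) by auto
  have "weighted_norm r (\<lambda>t. logw t powr b) (hardy_sup a G)
    \<le> ennreal (C powr (1 / q)) * weighted_norm r (\<lambda>u. u powr a * logw u powr (b + recip r)) G"
    if "G \<in> borel_measurable borel" for G
  proof -
    have "weighted_norm r (\<lambda>t. logw t powr b) (hardy_sup a G)
       = enn_powr (\<integral>\<^sup>+t\<in>{0<..<1}. enn_powr (ennreal (logw t powr b) * hardy_sup a G t) q * ennreal (1 / t) \<partial>lborel) (1 / q)"
      using False by (simp add: weighted_norm_def q_def[symmetric] q(2))
    also have "\<dots> \<le> enn_powr (ennreal C * (\<integral>\<^sup>+u\<in>{0<..<1}. enn_powr (ennreal (u powr a * logw u powr (b + 1 / q)) * G u) q * ennreal (1 / u) \<partial>lborel)) (1 / q)"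
      using q by (intro enn_powr_mono C(2) that) auto
    also have "\<dots> = ennreal (C powr (1 / q)) * enn_powr (\<integral>\<^sup>+u\<in>{0<..<1}. enn_powr (ennreal (u powr a * logw u powr (b + 1 / q)) * G u) q * ennreal (1 / u) \<partial>lborel) (1 / q)"
      using q C(1) by (simp only: enn_powr_mult enn_powr_ennreal) (simp add: enn_powr_mult enn_powr_ennreal)
    finally show ?thesis
      using False by (simp add: weighted_norm_def q_def[symmetric] q(2))
  qed
  with C(1) show ?thesis by (intro exI[of _ "C powr (1 / q)"]) auto
qed

section \<open>The rearrangement of the sharp maximal function\<close>

text \<open>\<open>emeasure\<close> is 0 on non-measurable sets, so it also has to be seen that
  either both sets are measurable or neither is. This follows from the completeness of Lebesgue
  measure.\<close>

lemma emeasure_lebesgue_cong_null: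
  assumes N: "N \<in> null_sets lebesgue" and AB: "A - N = B - N"
  shows "emeasure lebesgue A = emeasure lebesgue B"
proof -
  have S: "B \<in> sets lebesgue" if A: "A \<in> sets lebesgue" and AB: "A - N = B - N" for A B :: "'a set"
  proof -
    have "B \<inter> N \<in> sets lebesgue"
      using null_sets_completion_subset[of "B \<inter> N" N lborel] N by auto
    moreover have "A - N \<in> sets lebesgue" using A N by auto
    ultimately have "(A - N) \<union> (B \<inter> N) \<in> sets lebesgue" by (rule sets.Un[rotated])
    also have "(A - N) \<union> (B \<inter> N) = B" using AB by auto
    finally show ?thesis .
  qed
  show ?thesis
  proof (cases "A \<in> sets lebesgue")
    case True
    with S AB have "B \<in> sets lebesgue" by blast
    with True show ?thesis
      using emeasure_Diff_null_set[OF N True] emeasure_Diff_null_set[OF N, of B] AB by metis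
  next
    case False
    with S[of B A] AB have "B \<notin> sets lebesgue" by auto
    with False show ?thesis by (simp add: emeasure_notin_sets del: emeasure_completion)
  qed
qed

lemma rearr_cong_AE:
  assumes "AE x in lebesgue. x \<in> Q \<longrightarrow> g x = g' x"
  shows "rearr Q g = rearr Q g'"
proof -
  obtain N where N: "N \<in> null_sets lebesgue" "{x. \<not> (x \<in> Q \<longrightarrow> g x = g' x)} \<subseteq> N"
    using assms by (auto simp: eventually_ae_filter)
  have "emeasure lebesgue {x \<in> Q. g x > ennreal u} = emeasure lebesgue {x \<in> Q. g' x > ennreal u}" for u
    using N by (intro emeasure_lebesgue_cong_null) auto
  then show ?thesis by (simp add: rearr_def[abs_def])
qed

section \<open>Borel representatives of weak derivatives\<close>

lemma locally_integrable_measurable: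
  fixes u :: "real ^ 'n::finite \<Rightarrow> real"
  assumes u: "locally_integrable \<Omega> u" and \<Omega>: "open \<Omega>"
  shows "(\<lambda>x. indicator \<Omega> x * u x) \<in> borel_measurable lebesgue"
proof -
  obtain C :: "nat \<Rightarrow> (real ^ 'n) set" where C: "\<And>n. compact (C n)" "\<And>n. C n \<subseteq> \<Omega>"
      "\<And>n. C n \<subseteq> interior (C (Suc n))" "\<Union>(range C) = \<Omega>"
    using open_Union_compact_subsets[OF \<Omega>] by metis
  have meas: "(\<lambda>x. indicator (C n) x * u x) \<in> borel_measurable lebesgue" for n
  proof -
    have "u absolutely_integrable_on C n"
      using u C(1,2) by (auto simp: locally_integrable_def)
    then show ?thesis
      unfolding set_integrable_def by (auto dest: borel_measurable_integrable)
  qed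
  have "incseq C"
    using C(3) interior_subset by (intro incseq_SucI) blast
  have lim: "(\<lambda>n. indicator (C n) x * u x) \<longlonglongrightarrow> indicator \<Omega> x * u x" for x
  proof (rule tendsto_eventually)
    show "\<forall>\<^sub>F n in sequentially. indicator (C n) x * u x = indicator \<Omega> x * u x"
    proof (cases "x \<in> \<Omega>")
      case True
      then obtain m where m: "x \<in> C m" using C(4) by blast
      have "x \<in> C n" if "m \<le> n" for n
        using incseqD[OF \<open>incseq C\<close> that] m by blast
      then show ?thesis
        using True by (intro eventually_sequentiallyI[of m]) simp
    next
      case False
      then show ?thesis using C(2) by (intro always_eventually allI) (auto simp: indicator_def)
    qed
  qed
  show ?thesis
    by (rule borel_measurable_LIMSEQ_real[OF lim meas])
qed

lemma locally_integrable_representative: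
  fixes u :: "real ^ 'n::finite \<Rightarrow> real"
  assumes "locally_integrable \<Omega> u" "open \<Omega>"
  obtains w where "w \<in> borel_measurable borel" "AE x in lebesgue. w x = indicator \<Omega> x * u x"
proof -
  obtain w where "w \<in> borel_measurable lborel" "AE x in lborel. indicator \<Omega> x * u x = w x"
    using completion_ex_borel_measurable_real[OF locally_integrable_measurable[OF assms]] by blast
  then show ?thesis
    by (intro that[of w]) (auto intro!: AE_completion)
qed

lemma LINT_representative:
  fixes u w \<phi> :: "real ^ 'n::finite \<Rightarrow> real"
  assumes w: "w \<in> borel_measurable borel" "AE x in lebesgue. w x = indicator \<Omega> x * u x"
    and \<phi>: "\<phi> \<in> borel_measurable borel"
  shows "(LINT x:\<Omega>|lebesgue. u x * \<phi> x) = (\<integral>x. w x * \<phi> x \<partial>lborel)"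
proof -
  have m: "(\<lambda>x. w x * \<phi> x) \<in> borel_measurable lborel" using w \<phi> by simp
  have "AE x in lebesgue. w x * \<phi> x = indicator \<Omega> x *\<^sub>R (u x * \<phi> x)"
    using w(2) by eventually_elim simp
  then have "(\<integral>x. w x * \<phi> x \<partial>lebesgue) = (LINT x:\<Omega>|lebesgue. u x * \<phi> x)"
    unfolding set_lebesgue_integral_def
    by (intro integral_cong_AE borel_measurable_AE[OF measurable_completion[OF m]] measurable_completion[OF m])
  then show ?thesis using integral_completion[OF m] by simp
qed

lemma weak_partial_representative:
  fixes u v U V :: "real ^ 'n::finite \<Rightarrow> real"
  assumes u: "has_weak_deriv \<Omega> \<alpha> f u" and v: "has_weak_deriv \<Omega> (\<alpha>(j := Suc (\<alpha> j))) f v"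
    and U: "U \<in> borel_measurable borel" "AE x in lebesgue. U x = indicator \<Omega> x * u x"
    and V: "V \<in> borel_measurable borel" "AE x in lebesgue. V x = indicator \<Omega> x * v x"
  shows "weak_partial \<Omega> j U V"
  unfolding weak_partial_def
proof (intro allI impI)
  fix D and a b :: "real ^ 'n"
  assume D: "\<forall>i. bump_tower (a $ i) (b $ i) (D i)" and ab: "cbox a b \<subseteq> \<Omega>"
  have T: "\<And>i. deriv_tower (D i)" using D by (simp add: bump_tower_def)
  show "(\<integral>x. U x * tensor D ((\<lambda>_. 0)(j := 1)) x \<partial>lborel) = - (\<integral>x. V x * tensor D (\<lambda>_. 0) x \<partial>lborel)"
    using weak_deriv_step[OF u v D[rule_format] ab]
    by (simp only: LINT_representative[OF U borel_measurable_tensor[OF T]] LINT_representative[OF V borel_measurable_tensor[OF T]])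
qed

text \<open>\<open>weak_deriv\<close> returns \<open>f\<close> itself at order 0, so
  \<open>f\<close> has to be its own weak derivative. The list chosen in
  \<open>multi_partial\<close> is then \<open>[]\<close>, and the hypothesis supplies the local
  integrability of \<open>f\<close>.\<close>

lemma has_weak_deriv_0:
  assumes "has_weak_deriv \<Omega> (\<lambda>_. 0) f g"
  shows "has_weak_deriv \<Omega> (\<lambda>_. 0) f f"
proof -
  have "\<exists>is :: 'a list. \<forall>i. count_list is i = 0" by (intro exI[of _ "[]"]) simp
  from someI_ex[OF this] have "(SOME is :: 'a list. \<forall>i. count_list is i = 0) = []"
    by (metis count_list_0_iff last_in_set)
  then show ?thesis
    using assms by (simp add: has_weak_deriv_def multi_partial_def iter_partial_def)
qed

lemma has_weak_deriv_weak_deriv: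
  assumes "weakly_differentiable k \<Omega> f" "sum \<alpha> UNIV \<le> k"
  shows "has_weak_deriv \<Omega> \<alpha> f (weak_deriv \<Omega> \<alpha> f)"
proof (cases "\<alpha> = (\<lambda>_. 0)")
  case True
  obtain g where "has_weak_deriv \<Omega> \<alpha> f g"
    using assms by (auto simp: weakly_differentiable_def)
  with True has_weak_deriv_0[of \<Omega> f g] show ?thesis
    by (simp add: weak_deriv_def)
next
  case False
  then show ?thesis
    using assms someI_ex[of "has_weak_deriv \<Omega> \<alpha> f"] by (auto simp: weakly_differentiable_def weak_deriv_def)
qed

lemma mean_osc_representative:
  fixes f w :: "real ^ 'n::finite \<Rightarrow> real"
  assumes w: "w \<in> borel_measurable borel" and ae: "AE x in lebesgue. x \<in> cube c l \<longrightarrow> w x = f x" and l: "0 < l"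
  shows "mean_osc (cube c l) f =
    (\<integral>\<^sup>+y. indicator (cube c l) y * ennreal \<bar>w y - (\<integral>y. indicator (cube c l) y * w y \<partial>lborel) / l ^ CARD('n)\<bar> \<partial>lborel)
      / ennreal (l ^ CARD('n))"
proof -
  let ?R = "cube c l"
  have m: "(\<lambda>x. indicator ?R x * w x) \<in> borel_measurable lborel" using w by simp
  have "AE x in lebesgue. indicator ?R x * w x = indicator ?R x *\<^sub>R f x"
    using ae by eventually_elim (auto simp: indicator_def)
  then have "(LINT x:?R|lebesgue. f x) = (\<integral>x. indicator ?R x * w x \<partial>lebesgue)"
    unfolding set_lebesgue_integral_def
    by (intro integral_cong_AE[symmetric] borel_measurable_AE[OF measurable_completion[OF m]] measurable_completion[OF m])
  then have mean: "cube_mean ?R f = (\<integral>y. indicator ?R y * w y \<partial>lborel) / l ^ CARD('n)"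
    using l integral_completion[OF m] by (simp add: cube_mean_def measure_cube)
  have "(\<integral>\<^sup>+x\<in>?R. ennreal \<bar>f x - cube_mean ?R f\<bar> \<partial>lebesgue) = (\<integral>\<^sup>+x. indicator ?R x * ennreal \<bar>w x - cube_mean ?R f\<bar> \<partial>lebesgue)"
    using ae by (intro nn_integral_cong_AE, eventually_elim) (auto simp: indicator_def)
  then show ?thesis
    using l by (simp add: mean_osc_def mean[symmetric] nn_integral_completion emeasure_cube)
qed

text \<open>Outside the exceptional set \<open>B\<close> of \<open>fractional_maximal_rearr\<close>,
  whose measure is at most \<open>t\<close>, every mean oscillation is at most
  \<open>C' * S\<close>. So this level, if finite, is admissible in the infimum that defines the
  rearrangement at \<open>t\<close>. The superlevel set is only compared with the measurable set
  \<open>B\<close>.\<close>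

theorem sharp_max_rearr_le:
  fixes a :: "real ^ 'n::finite"
  assumes L: "0 < L" and k: "1 \<le> k" "k < CARD('n)"
  shows "\<exists>C\<ge>0. \<forall>W f t. deriv_family (interior (cube a L)) k W \<longrightarrow>
     (AE x in lebesgue. x \<in> cube a L \<longrightarrow> W (\<lambda>_. 0) x = f x) \<longrightarrow> 0 < t \<longrightarrow> t < 1 \<longrightarrow>
     rearr (cube a L) (sharp_max (cube a L) f) t
       \<le> ennreal C * (\<Sum>m\<in>{1..k}. hardy_sup (real k / real CARD('n)) (rearr (cube a L) (\<lambda>x. ennreal (multi_modulus W m x))) t)"
proof -
  let ?Q = "cube a L" and ?d = "CARD('n)"
  let ?\<Omega> = "interior ?Q" and ?p = "real k / real ?d"
  obtain C where C: "0 \<le> C" and CB: "\<forall>W K N x. deriv_family ?\<Omega> k W \<longrightarrow>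
    fractional_bound a L x W k K \<longrightarrow>
    lower_order_bound a L W k N \<longrightarrow>
    (\<forall>c l. 0 < l \<longrightarrow> x \<in> cube c l \<longrightarrow> cube c l \<subseteq> cube a L \<longrightarrow>
       (\<integral>\<^sup>+y. indicator (cube c l) y * ennreal \<bar>W (\<lambda>_. 0) y - (\<integral>y. indicator (cube c l) y * W (\<lambda>_. 0) y \<partial>lborel) / l ^ CARD('n)\<bar> \<partial>lborel)
         \<le> ennreal C * (K + N) * ennreal (l ^ CARD('n)))"
    using deriv_family_oscillation_bound[OF L order_refl k(1), of a] by (elim exE conjE) (rule that)
  define c0 where "c0 = (10 * real ?d) ^ ?d + 1 + L ^ ?d"
  \<comment> \<open>Normalises the integral over \<open>cube a L\<close> by its volume
    \<open>L ^ d\<close>, the form in which \<open>lower_order_bound\<close> expects it.\<close>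
  define c1 where "c1 = (1 + L ^ ?d) / L ^ ?d"
  have c: "0 \<le> c0" "0 \<le> c1" using L by (auto simp: c0_def c1_def)
  define C' where "C' = C * (c0 + c1) + 1"
  have C': "0 < C'" using C c by (simp add: C'_def add_nonneg_pos)
  show ?thesis
  proof (intro exI[of _ C'] conjI allI impI)
    show "0 \<le> C'" using C' by simp
    fix W f t
    assume W: "deriv_family ?\<Omega> k W" and f: "AE x in lebesgue. x \<in> ?Q \<longrightarrow> W (\<lambda>_. 0) x = f x"
      and t: "0 < t" "t < (1::real)"
    define T where "T m = hardy_sup ?p (rearr ?Q (\<lambda>x. ennreal (multi_modulus W m x))) t" for m
    define S where "S = (\<Sum>m\<in>{1..k}. T m)"
    have TS: "T m \<le> S" if "m \<in> {1..k}" for m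
      unfolding S_def using that by (intro member_le_sum) auto
    have Wb: "W \<alpha> \<in> borel_measurable borel" if "sum \<alpha> UNIV \<le> k" for \<alpha>
      using W that by (auto simp: deriv_family_def intro: borel_measurable_integrable[of lborel, simplified])
    have W0b: "W (\<lambda>_. 0) \<in> borel_measurable borel" by (rule Wb) simp
    have G: "(\<lambda>x. ennreal (multi_modulus W m x)) \<in> borel_measurable lebesgue" if "m \<le> k" for m
    proof -
      have [measurable]: "multi_modulus W m \<in> borel_measurable lborel"
        using borel_measurable_multi_modulus[of m W] Wb that by auto
      show ?thesis by (rule measurable_completion) measurable
    qed
    obtain B where B: "B \<in> sets lebesgue" "emeasure lebesgue B \<le> ennreal t"
      and good: "\<And>x c l. x \<notin> B \<Longrightarrow> 0 < l \<Longrightarrow> x \<in> cube c l \<Longrightarrow> cube c l \<subseteq> ?Q \<Longrightarrow>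
        ennreal (l ^ k) * (\<integral>\<^sup>+y\<in>cube c l. ennreal (multi_modulus W k y) \<partial>lebesgue) \<le> ennreal c0 * T k * ennreal (l ^ ?d)"
      using fractional_maximal_rearr[OF G[OF order_refl] L t k(2), of a] unfolding T_def c0_def by blast
    have N: "modulus_on ?Q W m \<le> (ennreal c1 * S) * ennreal (L ^ ?d)"
      if m: "m \<in> {1..<k}" for m
    proof -
      have "modulus_on ?Q W m = (\<integral>\<^sup>+y\<in>?Q. ennreal (multi_modulus W m y) \<partial>lebesgue)"
        by (simp add: nn_integral_completion mult.commute)
      also have "\<dots> \<le> ennreal (1 + L ^ ?d) * T m"
        unfolding T_def using m t L by (intro nn_integral_cube_le_hardy G) auto
      also have "\<dots> \<le> ennreal (1 + L ^ ?d) * S"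
        using m by (intro mult_left_mono TS) auto
      also have "1 + L ^ ?d = c1 * L ^ ?d" using L by (simp add: c1_def)
      finally show ?thesis using L c by (simp add: ennreal_mult mult_ac)
    qed
    have osc: "mean_osc R f \<le> ennreal C' * S" if x: "x \<notin> B" and R: "is_cube R" "x \<in> R" "R \<subseteq> ?Q" for x R
    proof -
      obtain c l where l: "0 < l" "R = cube c l"
        using R(1) unfolding is_cube_def cube_def by blast
      have aeR: "AE y in lebesgue. y \<in> cube c l \<longrightarrow> W (\<lambda>_. 0) y = f y"
        using f R(3) l(2) by (auto elim: eventually_mono)
      have "\<forall>c l. 0 < l \<longrightarrow> x \<in> cube c l \<longrightarrow> cube c l \<subseteq> cube a L \<longrightarrow>
         ennreal (l ^ k) * modulus_on (cube c l) W k \<le> (ennreal c0 * T k) * ennreal (l ^ ?d)"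
        using good[OF x] by (simp add: nn_integral_completion mult.commute[of "indicator _ _"])
      then have "(\<integral>\<^sup>+y. indicator (cube c l) y * ennreal \<bar>W (\<lambda>_. 0) y - (\<integral>y. indicator (cube c l) y * W (\<lambda>_. 0) y \<partial>lborel) / l ^ ?d\<bar> \<partial>lborel)
         \<le> ennreal C * (ennreal c0 * T k + ennreal c1 * S) * ennreal (l ^ ?d)"
        using N by (intro CB[rule_format, of W x _ _ l c]) (use W l R in auto)
      then have "mean_osc R f \<le> (ennreal C * (ennreal c0 * T k + ennreal c1 * S) * ennreal (l ^ ?d)) / ennreal (l ^ ?d)"
        unfolding l(2) mean_osc_representative[OF W0b aeR l(1)] by (intro divide_right_mono_ennreal)
      also have "\<dots> = ennreal C * (ennreal c0 * T k + ennreal c1 * S)"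
        using l(1) by (simp add: ennreal_times_divide[symmetric])
      also have "\<dots> \<le> ennreal C * (ennreal c0 * S + ennreal c1 * S)"
        using k by (intro mult_left_mono add_mono TS) auto
      also have "\<dots> = ennreal (C * (c0 + c1)) * S"
        using C c by (simp add: ennreal_mult distrib_right mult.assoc)
      also have "\<dots> \<le> ennreal C' * S"
        by (intro mult_right_mono ennreal_leI) (auto simp: C'_def)
      finally show ?thesis .
    qed
    have sharp: "sharp_max ?Q f x \<le> ennreal C' * S" if "x \<notin> B" for x
      unfolding sharp_max_def using osc[OF that] by (intro SUP_least) auto
    show "rearr ?Q (sharp_max ?Q f) t \<le> ennreal C' * (\<Sum>m\<in>{1..k}. hardy_sup ?p (rearr ?Q (\<lambda>x. ennreal (multi_modulus W m x))) t)"
    proof (cases "ennreal C' * S")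
      case (real y)
      have "{x \<in> ?Q. sharp_max ?Q f x > ennreal y} \<subseteq> B"
        using sharp real by (auto simp: not_le[symmetric])
      then have "emeasure lebesgue {x \<in> ?Q. sharp_max ?Q f x > ennreal y} \<le> emeasure lebesgue B"
        using B(1) by (rule emeasure_mono)
      then have "rearr ?Q (sharp_max ?Q f) t \<le> ennreal y"
        unfolding rearr_def using B(2) real by (intro INF_lower) auto
      then show ?thesis using real by (simp add: S_def T_def)
    next
      case top
      then show ?thesis by (simp add: S_def T_def)
    qed
  qed
qed

theorem corollary3p5:
  fixes Q0 :: "(real ^ 'n::finite) set"
    and k :: nat and r :: ennreal and b :: real
  assumes "is_cube Q0"
    and "1 \<le> r"
    and "1 \<le> k" and "k < CARD('n)"
    and "b < - recip r"
  shows "\<exists>C::real. C > 0 \<and>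
    (\<forall>f \<in> lz_sobolev k (ennreal (real CARD('n) / real k)) r (b + recip r) Q0.
       lz_norm \<infinity> r b Q0 (sharp_max Q0 f)
         \<le> ennreal C * lz_sobolev_norm k (ennreal (real CARD('n) / real k)) r (b + recip r) Q0 f)"
proof -
  let ?d = "CARD('n)"
  let ?p = "real k / real ?d" and ?\<Omega> = "interior Q0"
  let ?P = "ennreal (real ?d / real k)"
  obtain a L where L: "0 < L" "Q0 = cube a L"
    using assms(1) unfolding is_cube_def cube_def by blast
  have p: "?p < 1" "recip ?P = ?p"
    using assms(3,4) by (simp_all add: recip_def inverse_ennreal)
  obtain C1 where C1: "0 \<le> C1" and sharp: "\<And>W f t. deriv_family ?\<Omega> k W \<Longrightarrow>
     (AE x in lebesgue. x \<in> Q0 \<longrightarrow> W (\<lambda>_. 0) x = f x) \<Longrightarrow> 0 < t \<Longrightarrow> t < 1 \<Longrightarrow>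
     rearr Q0 (sharp_max Q0 f) t \<le> ennreal C1 * (\<Sum>m\<in>{1..k}. hardy_sup ?p (rearr Q0 (\<lambda>x. ennreal (multi_modulus W m x))) t)"
    using sharp_max_rearr_le[OF L(1) assms(3,4), of a] unfolding L(2) by blast
  obtain C2 where C2: "0 < C2" and hardy: "\<And>G. G \<in> borel_measurable borel \<Longrightarrow>
    weighted_norm r (\<lambda>t. logw t powr b) (hardy_sup ?p G)
    \<le> ennreal C2 * weighted_norm r (\<lambda>u. u powr ?p * logw u powr (b + recip r)) G"
    using weighted_norm_hardy[OF p(1) assms(2,5)] by blast
  \<comment> \<open>\<open>C1\<close> comes from the pointwise estimate, \<open>k * (k + 1)\<close>
    from the quasi-triangle inequality for \<open>k\<close> summands, \<open>C2\<close> from the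
    Hardy inequality. The added 1 secures strict positivity, as \<open>C1\<close> may be 0.\<close>
  define C where "C = C1 * (real k * (real k + 1)) * C2 + 1"
  have "lz_norm \<infinity> r b Q0 (sharp_max Q0 f) \<le> ennreal C * lz_sobolev_norm k ?P r (b + recip r) Q0 f"
    if f: "f \<in> lz_sobolev k ?P r (b + recip r) Q0" for f
  proof -
    have wd: "weakly_differentiable k ?\<Omega> f" and fin: "lz_sobolev_norm k ?P r (b + recip r) Q0 f < \<infinity>"
      using f by (auto simp: lz_sobolev_def)
    have wdv: "has_weak_deriv ?\<Omega> \<alpha> f (weak_deriv ?\<Omega> \<alpha> f)" if "sum \<alpha> UNIV \<le> k" for \<alpha>
      using has_weak_deriv_weak_deriv[OF wd that] .
    \<comment> \<open>Borel representatives that vanish almost everywhere outside the open cube: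
      they are defined on the whole space, as \<open>deriv_family\<close> requires.\<close>
    have "\<forall>\<alpha>. \<exists>w. sum \<alpha> UNIV \<le> k \<longrightarrow> w \<in> borel_measurable borel \<and>
        (AE x in lebesgue. w x = indicator ?\<Omega> x * weak_deriv ?\<Omega> \<alpha> f x)"
    proof
      fix \<alpha>
      show "\<exists>w. sum \<alpha> UNIV \<le> k \<longrightarrow> w \<in> borel_measurable borel \<and>
          (AE x in lebesgue. w x = indicator ?\<Omega> x * weak_deriv ?\<Omega> \<alpha> f x)"
      proof (cases "sum \<alpha> UNIV \<le> k")
        case True
        then have "locally_integrable ?\<Omega> (weak_deriv ?\<Omega> \<alpha> f)"
          using wdv unfolding has_weak_deriv_def by blast
        from locally_integrable_representative[OF this open_interior] show ?thesis by blast
      qed simp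
    qed
    then obtain W where W: "\<And>\<alpha>. sum \<alpha> UNIV \<le> k \<Longrightarrow> W \<alpha> \<in> borel_measurable borel"
        "\<And>\<alpha>. sum \<alpha> UNIV \<le> k \<Longrightarrow> AE x in lebesgue. W \<alpha> x = indicator ?\<Omega> x * weak_deriv ?\<Omega> \<alpha> f x"
      unfolding choice_iff by blast
    have "AE x in lborel. x \<in> Q0 \<longrightarrow> x \<in> ?\<Omega>"
      using AE_box_eq_cbox[of a "\<chi> i. a $ i + L"] by (simp add: L(2) cube_def interior_cbox)
    then have int: "AE x in lebesgue. x \<in> Q0 \<longrightarrow> x \<in> ?\<Omega>"
      by (rule AE_completion)
    define G where "G m x = ennreal (multi_modulus W m x)" for m x
    have GW: "rearr Q0 (\<lambda>x. ennreal (grad_modulus ?\<Omega> m f x)) = rearr Q0 (G m)" if "m \<le> k" for m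
    proof (rule rearr_cong_AE)
      have "AE x in lebesgue. \<forall>\<alpha>\<in>{\<alpha>. sum \<alpha> UNIV = m}. W \<alpha> x = indicator ?\<Omega> x * weak_deriv ?\<Omega> \<alpha> f x"
        using W(2) that by (intro AE_finite_allI finite_multi_indices) auto
      with int show "AE x in lebesgue. x \<in> Q0 \<longrightarrow> ennreal (grad_modulus ?\<Omega> m f x) = G m x"
        by eventually_elim (auto simp: G_def grad_modulus_def multi_modulus_def intro!: arg_cong[where f = ennreal] arg_cong[where f = sqrt] sum.cong)
    qed
    define n where "n m = weighted_norm r (\<lambda>u. u powr ?p * logw u powr (b + recip r)) (rearr Q0 (G m))" for m
    have norm: "lz_sobolev_norm k ?P r (b + recip r) Q0 f = (\<Sum>m\<le>k. n m)"
      unfolding lz_sobolev_norm_def n_def lz_norm_eq_weighted_norm p(2) by (intro sum.cong) (auto simp: GW)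
    have nfin: "n m < \<infinity>" if "m \<le> k" for m
    proof -
      have "n m \<le> (\<Sum>m\<le>k. n m)" using that by (intro member_le_sum) auto
      then show ?thesis using fin unfolding norm by (rule le_less_trans)
    qed
    have Gm: "G m \<in> borel_measurable borel" if "m \<le> k" for m
    proof -
      have [measurable]: "multi_modulus W m \<in> borel_measurable borel"
        using borel_measurable_multi_modulus[of m W] W(1) that by auto
      show ?thesis unfolding G_def[abs_def] by measurable
    qed
    \<comment> \<open>The source of all integrability. The suprema grow as \<open>t\<close>
      decreases, so an infinite value at 1 would make them infinite on all of \<open>(0, 1)\<close>,
      and the Hardy inequality would contradict the finiteness of \<open>n m\<close>.\<close>
    have Tfin: "hardy_sup ?p (rearr Q0 (G m)) 1 < \<infinity>" if m: "m \<le> k" for m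
    proof (rule ccontr)
      assume "\<not> hardy_sup ?p (rearr Q0 (G m)) 1 < \<infinity>"
      then have "hardy_sup ?p (rearr Q0 (G m)) 1 = top"
        by (simp add: less_top[symmetric])
      then have top: "hardy_sup ?p (rearr Q0 (G m)) t = \<infinity>" if "t \<in> {0<..<1}" for t
        using that hardy_sup_antimono[of t 1 ?p "rearr Q0 (G m)"] by (simp add: top_unique)
      have "\<infinity> = weighted_norm r (\<lambda>t. logw t powr b) (\<lambda>_. \<infinity>)"
        using assms(2) by (intro weighted_norm_top[symmetric]) (auto simp: less_imp_neq[OF logw_pos, symmetric])
      also have "\<dots> \<le> weighted_norm r (\<lambda>t. logw t powr b) (hardy_sup ?p (rearr Q0 (G m)))"
        by (intro weighted_norm_mono) (simp add: top)
      also have "\<dots> \<le> ennreal C2 * n m"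
        unfolding n_def by (rule hardy) simp
      finally show False
        using nfin[OF m] by (simp add: ennreal_mult_eq_top_iff top_unique)
    qed
    have Gint: "(\<integral>\<^sup>+y\<in>Q0. G m y \<partial>lebesgue) < \<infinity>" if m: "m \<le> k" for m
    proof -
      have "G m \<in> borel_measurable lebesgue"
        using Gm[OF m] by (intro measurable_completion) simp
      then have "(\<integral>\<^sup>+y\<in>Q0. G m y \<partial>lebesgue) \<le> ennreal (1 + L ^ ?d) * hardy_sup ?p (rearr Q0 (G m)) 1"
        unfolding L(2) by (intro nn_integral_cube_le_hardy L(1)) auto
      also have "\<dots> < \<infinity>"
        using Tfin[OF m] by (simp add: ennreal_mult_less_top del: ennreal_plus)
      finally show ?thesis .
    qed
    have Wint: "integrable lborel (W \<alpha>)" if \<alpha>: "sum \<alpha> UNIV \<le> k" for \<alpha>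
    proof (rule integrableI_bounded)
      show "W \<alpha> \<in> borel_measurable lborel" using W(1)[OF \<alpha>] by simp
      have "(\<integral>\<^sup>+x. ennreal (norm (W \<alpha> x)) \<partial>lborel) = (\<integral>\<^sup>+x. ennreal (norm (W \<alpha> x)) \<partial>lebesgue)"
        by (simp add: nn_integral_completion)
      also have "\<dots> \<le> (\<integral>\<^sup>+y\<in>Q0. G (sum \<alpha> UNIV) y \<partial>lebesgue)"
        using W(2)[OF \<alpha>]
      proof (intro nn_integral_mono_AE, eventually_elim)
        case (elim x)
        show ?case
        proof (cases "x \<in> ?\<Omega>")
          case True
          then have "x \<in> Q0" using interior_subset by blast
          then show ?thesis
            using abs_le_multi_modulus[of \<alpha> "sum \<alpha> UNIV" W x] by (simp add: G_def ennreal_leI)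
        qed (use elim in simp)
      qed
      also have "\<dots> < \<infinity>" by (rule Gint[OF \<alpha>])
      finally show "(\<integral>\<^sup>+x. ennreal (norm (W \<alpha> x)) \<partial>lborel) < \<infinity>" .
    qed
    have fam: "deriv_family ?\<Omega> k W"
      unfolding deriv_family_def
    proof (intro conjI allI impI Wint)
      fix \<alpha> :: "'n \<Rightarrow> nat" and j assume \<alpha>: "sum \<alpha> UNIV < k"
      then have \<beta>: "sum (\<alpha>(j := Suc (\<alpha> j))) UNIV \<le> k" by (simp only: sum_fun_upd_Suc)
      show "weak_partial ?\<Omega> j (W \<alpha>) (W (\<alpha>(j := Suc (\<alpha> j))))"
        using \<alpha> by (intro weak_partial_representative[OF wdv wdv[OF \<beta>] W(1) W(2) W(1)[OF \<beta>] W(2)[OF \<beta>]]) auto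
    qed
    have W0: "AE x in lebesgue. x \<in> Q0 \<longrightarrow> W (\<lambda>_. 0) x = f x"
      using int W(2)[of "\<lambda>_. 0"] by (auto simp: weak_deriv_def elim!: eventually_elim2)
    define T where "T m = hardy_sup ?p (rearr Q0 (G m))" for m
    have Tm: "T m \<in> borel_measurable borel" for m
      unfolding T_def by (intro borel_measurable_antimono_ennreal hardy_sup_antimono)
    have wm: "(\<lambda>t. logw t powr b) \<in> borel_measurable borel" by measurable
    have "lz_norm \<infinity> r b Q0 (sharp_max Q0 f) \<le> weighted_norm r (\<lambda>t. logw t powr b) (\<lambda>t. ennreal C1 * (\<Sum>m\<in>{1..k}. T m t))"
      unfolding lz_norm_eq_weighted_norm
    proof (rule weighted_norm_mono)
      fix t :: real assume t: "t \<in> {0<..<1}"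
      then have "rearr Q0 (sharp_max Q0 f) t \<le> ennreal C1 * (\<Sum>m\<in>{1..k}. T m t)"
        unfolding T_def G_def[abs_def] by (intro sharp fam W0) auto
      then show "ennreal (t powr recip \<infinity> * logw t powr b) * rearr Q0 (sharp_max Q0 f) t
          \<le> ennreal (logw t powr b) * (ennreal C1 * (\<Sum>m\<in>{1..k}. T m t))"
        using t by (simp add: recip_def mult_left_mono)
    qed
    also have "\<dots> = ennreal C1 * weighted_norm r (\<lambda>t. logw t powr b) (\<lambda>t. \<Sum>m\<in>{1..k}. T m t)"
      by (intro weighted_norm_cmult assms C1 borel_measurable_sum Tm wm)
    also have "\<dots> \<le> ennreal C1 * (ennreal (real k * (real k + 1)) * (\<Sum>m\<in>{1..k}. weighted_norm r (\<lambda>t. logw t powr b) (T m)))"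
      using weighted_norm_sum[OF assms(2), of "{1..k}" T "\<lambda>t. logw t powr b"] Tm wm by (intro mult_left_mono) auto
    also have "\<dots> \<le> ennreal C1 * (ennreal (real k * (real k + 1)) * (\<Sum>m\<in>{1..k}. ennreal C2 * n m))"
      unfolding T_def n_def by (intro mult_left_mono sum_mono hardy) auto
    also have "\<dots> \<le> ennreal C1 * (ennreal (real k * (real k + 1)) * (\<Sum>m\<le>k. ennreal C2 * n m))"
      by (intro mult_left_mono sum_mono2) auto
    also have "\<dots> = ennreal (C1 * (real k * (real k + 1)) * C2) * (\<Sum>m\<le>k. n m)"
      using C1 C2 by (simp add: ennreal_mult mult.assoc del: ennreal_plus flip: sum_distrib_left)
    also have "\<dots> \<le> ennreal C * (\<Sum>m\<le>k. n m)"
      by (intro mult_right_mono ennreal_leI) (auto simp: C_def)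
    finally show ?thesis by (simp only: norm)
  qed
  moreover have "0 < C" using C1 C2 by (auto simp: C_def intro!: add_nonneg_pos)
  ultimately show ?thesis by blast
qed

end
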